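(* Consider the asymptotic rare and weak (ARW) two-class Gaussian model described in the context, with $\Omega_0=I_p$ and parameters $\alpha,\beta,\gamma,\zeta,\theta,\delta$. Define $$\rho_\delta(\zeta)=\begin{cases}1/2-\zeta, & 0<\zeta\le (1-\delta)/2,\\ \delta/2, & (1-\delta)/2<\zeta\le 1-\delta,\\ (1-\zeta)/2, & 1-\delta<\zeta<1.\end{cases}$$ If $\|\Omega_1-I\|_F^2\to 0$ (in probability) as $p\to\infty$ and $\theta>\rho_\delta(\zeta)$, then for any (sequence of) classifier(s) $L$, the mis-classification rate satisfies $\liminf_{p\to\infty} MR(L)\ge 1/2$.
   Context: Two-class model. For each $p$ let $n=n_p=p^{\delta}$ (rounded to an integer), $0<\delta<1$. Training labels $Y_1,\dots,Y_n$ and the test label $Y$ are i.i.d. Bernoulli$(1/2)$. Given the labels and the parameters $(\mu,\Omega_0,\Omega_1)$, the feature vectors $X_1,\dots,X_n$ and the test vector $X$ in $\mathbb{R}^p$ are independent, with law $N(-\mu,\Omega_0^{-1})$ when the corresponding label is $0$ and $N(\mu,\Omega_1^{-1})$ when it is $1$. Here $\Omega_0=I_p$. ARW parameters. The coordinates of $\mu$ are i.i.d., equal to $\tau_p$ with probability $\epsilon_p$ and to $0$ otherwise, with $\epsilon_p=p^{-\zeta}$, $\tau_p=p^{-\theta}$, $0<\zeta,\theta<1$. Independently, $\Omega_1=D+V$, where $D$ is diagonal with i.i.d. entries $D(i,i)=1+\Delta_i$, $|\Delta_i|=\xi_p=p^{-\gamma}$, and $V$ is symmetric with zero diagonal and i.i.d.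 entries $V_{ij}$ ($i<j$) equal to $\eta_p$ with probability $\nu_p/2$, to $-\eta_p$ with probability $\nu_p/2$, and to $0$ with probability $1-\nu_p$, with $\eta_p=p^{-\alpha}$, $\nu_p=p^{-\beta}$. Here $0<\alpha,\gamma<1$, $0<\beta<2$ and $\beta>1-2\alpha$ (so that $\Omega_1$ is positive definite with probability tending to 1; on the complementary event replace $\Omega_1$ by $I$). A classifier $L$ is a measurable $\{0,1\}$-valued function $\hat Y$ of the training data, the test vector $X$ and the known matrix $\Omega_1$ ($\mu$ is unknown). Its mis-classification rate is $MR(L)=[P(\hat Y=0\mid Y=1)+P(\hat Y=1\mid Y=0)]/2$, the probability being over all the randomness, including $\mu$ and $\Omega_1$. *)

theory Defs
  imports "HOL-Probability.Probability" "Jordan_Normal_Form.Determinant"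
begin

text \<open>
  Vectors of \<open>\<real>\<^sup>p\<close> are functions on \<open>{..<p}\<close> carrying the product sigma-algebra; matrices are
  the dimension-indexed matrices of \<open>Jordan_Normal_Form\<close>.  A label is a Boolean, with \<open>True\<close>
  for class 1 and \<open>False\<close> for class 0.
\<close>

definition pos_def_mat :: "nat \<Rightarrow> real mat \<Rightarrow> bool" where
  "pos_def_mat p A \<longleftrightarrow> A \<in> carrier_mat p p \<and> transpose_mat A = A \<and>
     (\<forall>v \<in> carrier_vec p. v \<noteq> 0\<^sub>v p \<longrightarrow> 0 < scalar_prod v (A *\<^sub>v v))"

definition frobenius_norm :: "real mat \<Rightarrow> real" where
  "frobenius_norm A = sqrt (\<Sum>i<dim_row A. \<Sum>j<dim_col A. (A $$ (i, j))\<^sup>2)"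

text \<open>
  The normal law with mean \<open>m\<close> and covariance matrix \<open>\<Omega>\<inverse>\<close>, given by its Lebesgue density;
  it is parametrized by the precision matrix \<open>\<Omega>\<close>, which is meant to be positive definite.
\<close>

definition mvn_precision :: "nat \<Rightarrow> (nat \<Rightarrow> real) \<Rightarrow> real mat \<Rightarrow> (nat \<Rightarrow> real) measure" where
  "mvn_precision p m \<Omega> = density (Pi\<^sub>M {..<p} (\<lambda>_. lborel))
     (\<lambda>x. let z = vec p (\<lambda>i. x i - m i) in
        ennreal (sqrt (Determinant.det \<Omega>) / (2 * pi) powr (real p / 2)
                 * exp (- scalar_prod z (\<Omega> *\<^sub>v z) / 2)))"

definition train_size :: "real \<Rightarrow> nat \<Rightarrow> nat" where
  "train_size \<delta> p = nat (round (real p powr \<delta>))"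

definition mean_pmf :: "real \<Rightarrow> real \<Rightarrow> nat \<Rightarrow> (nat \<Rightarrow> real) pmf" where
  "mean_pmf \<zeta> \<theta> p = Pi_pmf {..<p} 0
     (\<lambda>_. pmf_of_list [(real p powr - \<theta>, real p powr - \<zeta>), (0, 1 - real p powr - \<zeta>)])"

text \<open>
  The law of \<open>(\<Delta>, V)\<close>.  Only \<open>\<bar>\<Delta>\<^sub>i\<bar>\<close> is prescribed by the model, so the common law \<open>\<Delta>law p\<close> of the
  \<open>\<Delta>\<^sub>i\<close> is a parameter.  \<open>V\<close> is represented by its entries strictly above the diagonal.
\<close>

definition perturbation_pmf ::
    "real \<Rightarrow> real \<Rightarrow> (nat \<Rightarrow> real pmf) \<Rightarrow> nat \<Rightarrow> ((nat \<Rightarrow> real) \<times> (nat \<times> nat \<Rightarrow> real)) pmf" where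
  "perturbation_pmf \<alpha> \<beta> \<Delta>law p = pair_pmf
     (Pi_pmf {..<p} 0 (\<lambda>_. \<Delta>law p))
     (Pi_pmf {(i, j). i < j \<and> j < p} 0
        (\<lambda>_. pmf_of_list [(real p powr - \<alpha>, real p powr - \<beta> / 2),
                          (- (real p powr - \<alpha>), real p powr - \<beta> / 2),
                          (0, 1 - real p powr - \<beta>)]))"

definition raw_precision :: "nat \<Rightarrow> (nat \<Rightarrow> real) \<Rightarrow> (nat \<times> nat \<Rightarrow> real) \<Rightarrow> real mat" where
  "raw_precision p \<Delta> V =
     mat p p (\<lambda>(i, j). if i = j then 1 + \<Delta> i else V (min i j, max i j))"

definition Omega1 :: "nat \<Rightarrow> (nat \<Rightarrow> real) \<Rightarrow> (nat \<times> nat \<Rightarrow> real) \<Rightarrow> real mat" where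
  "Omega1 p \<Delta> V =
     (if pos_def_mat p (raw_precision p \<Delta> V) then raw_precision p \<Delta> V else 1\<^sub>m p)"

definition feature_law ::
    "nat \<Rightarrow> (nat \<Rightarrow> real) \<Rightarrow> real mat \<Rightarrow> bool \<Rightarrow> (nat \<Rightarrow> real) measure" where
  "feature_law p \<mu> \<Omega>\<^sub>1 y =
     (if y then mvn_precision p \<mu> \<Omega>\<^sub>1 else mvn_precision p (\<lambda>i. - \<mu> i) (1\<^sub>m p))"

text \<open>The parameters and the labels: \<open>(\<mu>, (\<Delta>, V), (Y\<^sub>i)\<^sub>i, Y)\<close>, all components independent.\<close>

type_synonym latent =
  "(nat \<Rightarrow> real) \<times> ((nat \<Rightarrow> real) \<times> (nat \<times> nat \<Rightarrow> real)) \<times> (nat \<Rightarrow> bool) \<times> bool"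

definition latent_pmf ::
    "real \<Rightarrow> real \<Rightarrow> real \<Rightarrow> real \<Rightarrow> real \<Rightarrow> (nat \<Rightarrow> real pmf) \<Rightarrow> nat \<Rightarrow> latent pmf" where
  "latent_pmf \<alpha> \<beta> \<zeta> \<theta> \<delta> \<Delta>law p =
     pair_pmf (mean_pmf \<zeta> \<theta> p)
    (pair_pmf (perturbation_pmf \<alpha> \<beta> \<Delta>law p)
    (pair_pmf (Pi_pmf {..<train_size \<delta> p} False (\<lambda>_. bernoulli_pmf (1/2)))
              (bernoulli_pmf (1/2))))"

definition feature_space :: "nat \<Rightarrow> (nat \<Rightarrow> real) measure" where
  "feature_space p = Pi\<^sub>M {..<p} (\<lambda>_. borel)"

text \<open>Training features \<open>(X\<^sub>1, \<dots>, X\<^sub>n)\<close>, indexed by \<open>{..<n}\<close>, together with the test vector \<open>X\<close>.\<close>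

definition features_space :: "real \<Rightarrow> nat \<Rightarrow> ((nat \<Rightarrow> nat \<Rightarrow> real) \<times> (nat \<Rightarrow> real)) measure" where
  "features_space \<delta> p =
     Pi\<^sub>M {..<train_size \<delta> p} (\<lambda>_. feature_space p) \<Otimes>\<^sub>M feature_space p"

definition features_given ::
    "real \<Rightarrow> nat \<Rightarrow> latent \<Rightarrow> ((nat \<Rightarrow> nat \<Rightarrow> real) \<times> (nat \<Rightarrow> real)) measure" where
  "features_given \<delta> p = (\<lambda>(\<mu>, (\<Delta>, V), ys, y).
     Pi\<^sub>M {..<train_size \<delta> p} (\<lambda>i. feature_law p \<mu> (Omega1 p \<Delta> V) (ys i))
       \<Otimes>\<^sub>M feature_law p \<mu> (Omega1 p \<Delta> V) y)"

text \<open>The joint law of the parameters, the labels and all feature vectors.\<close>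

definition arw_model ::
    "real \<Rightarrow> real \<Rightarrow> real \<Rightarrow> real \<Rightarrow> real \<Rightarrow> (nat \<Rightarrow> real pmf) \<Rightarrow> nat
       \<Rightarrow> (latent \<times> (nat \<Rightarrow> nat \<Rightarrow> real) \<times> (nat \<Rightarrow> real)) measure" where
  "arw_model \<alpha> \<beta> \<zeta> \<theta> \<delta> \<Delta>law p =
     measure_pmf (latent_pmf \<alpha> \<beta> \<zeta> \<theta> \<delta> \<Delta>law p) \<bind>
       (\<lambda>\<omega>. distr (features_given \<delta> p \<omega>)
              (count_space UNIV \<Otimes>\<^sub>M features_space \<delta> p) (Pair \<omega>))"

text \<open>
  A classifier sees \<open>((Y\<^sub>i)\<^sub>i, (X\<^sub>i)\<^sub>i, X, \<Omega>\<^sub>1)\<close>.  For each \<open>p\<close>, the labels and \<open>\<Omega>\<^sub>1\<close> take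
  only finitely many values almost surely, so they are given the discrete sigma-algebra; every
  Borel measurable rule is measurable in this sense.
\<close>

type_synonym observation = "(nat \<Rightarrow> bool) \<times> (nat \<Rightarrow> nat \<Rightarrow> real) \<times> (nat \<Rightarrow> real) \<times> real mat"

definition is_classifier :: "real \<Rightarrow> nat \<Rightarrow> (observation \<Rightarrow> bool) \<Rightarrow> bool" where
  "is_classifier \<delta> p L \<longleftrightarrow>
     L \<in> (count_space UNIV \<Otimes>\<^sub>M Pi\<^sub>M {..<train_size \<delta> p} (\<lambda>_. feature_space p)
            \<Otimes>\<^sub>M feature_space p \<Otimes>\<^sub>M count_space UNIV) \<rightarrow>\<^sub>M count_space UNIV"

definition test_label :: "latent \<times> (nat \<Rightarrow> nat \<Rightarrow> real) \<times> (nat \<Rightarrow> real) \<Rightarrow> bool" where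
  "test_label = (\<lambda>((\<mu>, (\<Delta>, V), ys, y), xs, x). y)"

definition predicted_label ::
    "nat \<Rightarrow> (observation \<Rightarrow> bool) \<Rightarrow> latent \<times> (nat \<Rightarrow> nat \<Rightarrow> real) \<times> (nat \<Rightarrow> real) \<Rightarrow> bool" where
  "predicted_label p L = (\<lambda>((\<mu>, (\<Delta>, V), ys, y), xs, x). L (ys, xs, x, Omega1 p \<Delta> V))"

definition misclassification_rate ::
    "real \<Rightarrow> real \<Rightarrow> real \<Rightarrow> real \<Rightarrow> real \<Rightarrow> (nat \<Rightarrow> real pmf) \<Rightarrow> nat \<Rightarrow> (observation \<Rightarrow> bool) \<Rightarrow> real"
  where
  "misclassification_rate \<alpha> \<beta> \<zeta> \<theta> \<delta> \<Delta>law p L =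
     (let M = arw_model \<alpha> \<beta> \<zeta> \<theta> \<delta> \<Delta>law p in
        (cond_prob M (\<lambda>\<omega>. \<not> predicted_label p L \<omega>) (\<lambda>\<omega>. test_label \<omega>)
       + cond_prob M (\<lambda>\<omega>. predicted_label p L \<omega>) (\<lambda>\<omega>. \<not> test_label \<omega>)) / 2)"

definition rho :: "real \<Rightarrow> real \<Rightarrow> real" where
  "rho \<delta> \<zeta> = (if \<zeta> \<le> (1 - \<delta>) / 2 then 1/2 - \<zeta>
              else if \<zeta> \<le> 1 - \<delta> then \<delta> / 2
              else (1 - \<zeta>) / 2)"

end

theory Submission
  imports Defs
begin

text \<open>
  Fix \<open>\<Omega>\<^sub>1\<close> and the training labels, and compare the joint law of the training data and the test
  vector, under either test label, with the product of the law of the training data and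
  \<open>N(0, I)\<close>.  If both are close in total variation, no classifier beats guessing.

  In class 1 the test law \<open>N(\<mu>, \<Omega>\<^sub>1\<inverse>)\<close> is first replaced by \<open>N(\<mu>, I)\<close>, at a cost controlled by
  \<open>\<parallel>\<Omega>\<^sub>1 - I\<parallel>\<^sub>F\<close>.  The training data keep \<open>\<Omega>\<^sub>1\<close>, since replacing it \<open>n\<close> times would be too costly.
  Then the coordinates of the test vector are revealed one at a time, as in the chain rule for
  relative entropy.  By convexity the contribution of coordinate \<open>k\<close> only increases when all the
  other coordinates of \<open>\<mu>\<close> are revealed as well, and then the posterior probability \<open>q\<^sub>k\<close> that
  \<open>\<mu>\<^sub>k \<noteq> 0\<close> is that of a one-dimensional problem depending on \<open>\<Omega>\<^sub>1\<close> only through its diagonal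
  entry.  The contributions add up to \<open>p (exp (\<tau>\<^sup>2) - 1) E q\<^sub>k\<^sup>2\<close>, where \<open>E q\<^sub>k\<^sup>2\<close> is at most \<open>\<epsilon>\<close> and
  at most \<open>\<epsilon>\<^sup>2 exp (2 n \<tau>\<^sup>2) / (1 - \<epsilon>)\<close>.
\<close>

section \<open>Gaussian integrals by Schur complements\<close>

text \<open>The obstacle is that a non-diagonal \<open>\<Omega>\<^sub>1\<close> in the training data
  couples the coordinates of \<mu> in the posterior, so a second moment of the whole likelihood
  ratio does not factor. Conditioning on all other coordinates of \<mu> removes the coupling; and
  since the test vector has identity covariance by then, its earlier coordinates say nothing more
  about \<open>\<mu>\<^sub>k\<close>. No posterior is ever formed: for a fixed training sample the
  weights, prior times likelihood, stay unnormalised, and they are integrated over the sample at the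
  end. Logarithms are avoided through \<open>u \<le> exp (u - 1)\<close>, and Cauchy-Schwarz for the
  Hellinger affinity is replaced by a free parameter, which keeps the bounds linear in what is
  integrated. The branches of \<open>rho\<close> come from the two bounds on
  \<open>E q\<^sub>k\<^sup>2\<close>: \<open>p \<tau>\<^sup>2 \<epsilon>\<close> vanishes for
  \<open>\<theta> > (1 - \<zeta>) / 2\<close>, \<open>p \<tau>\<^sup>2 \<epsilon>\<^sup>2\<close>
  for \<open>\<theta> > 1/2 - \<zeta>\<close>, and \<open>n \<tau>\<^sup>2\<close> stays bounded for
  \<open>\<theta> \<ge> \<delta> / 2\<close>.\<close>

definition quad_form :: "nat \<Rightarrow> (nat \<Rightarrow> nat \<Rightarrow> real) \<Rightarrow> (nat \<Rightarrow> real) \<Rightarrow> real" where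
  "quad_form p a x = (\<Sum>i<p. \<Sum>j<p. a i j * x i * x j)"

definition sym_pos_def :: "nat \<Rightarrow> (nat \<Rightarrow> nat \<Rightarrow> real) \<Rightarrow> bool" where
  "sym_pos_def p a \<longleftrightarrow> (\<forall>i<p. \<forall>j<p. a i j = a j i) \<and>
     (\<forall>x. (\<exists>i<p. x i \<noteq> 0) \<longrightarrow> 0 < quad_form p a x)"

text \<open>Eliminates the last index \<open>p\<close> of a matrix of size \<open>Suc p\<close>.
  Matrices are plain functions with a separate dimension, so that the result has the same type and
  inductions on \<open>p\<close> need no submatrices.\<close>

definition schur_compl :: "nat \<Rightarrow> (nat \<Rightarrow> nat \<Rightarrow> real) \<Rightarrow> nat \<Rightarrow> nat \<Rightarrow> real" where
  "schur_compl p a i j = a i j - a i p * a p j / a p p"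

lemma quad_form_cong:
  "(\<And>i. i < p \<Longrightarrow> x i = y i) \<Longrightarrow> quad_form p a x = quad_form p a y"
  by (auto simp: quad_form_def intro!: sum.cong)

lemma sym_pos_def_diag_pos:
  assumes "sym_pos_def p a" "k < p"
  shows "0 < a k k"
proof -
  have "quad_form p a (\<lambda>i. if i = k then 1 else 0) = a k k"
    using assms(2) by (simp add: quad_form_def if_distrib[of "\<lambda>t. _ * t"] sum.delta cong: if_cong)
  moreover have "0 < quad_form p a (\<lambda>i. if i = k then 1 else 0)"
    using assms(1) unfolding sym_pos_def_def by (elim conjE allE impE) (use assms(2) in auto)
  ultimately show ?thesis by simp
qed

text \<open>Completing the square in the last variable. Given the first \<open>p\<close> variables,
  what remains is one-dimensional with pivot \<open>a p p\<close>, whatever their values.\<close>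

lemma quad_form_Suc:
  assumes "sym_pos_def (Suc p) a"
  shows "quad_form (Suc p) a x =
    quad_form p (schur_compl p a) x + a p p * (x p + (\<Sum>i<p. a i p * x i) / a p p)\<^sup>2"
proof -
  have pos: "a p p > 0" using sym_pos_def_diag_pos[OF assms] by simp
  have sym: "a p i = a i p" if "i < p" for i
    using assms that by (auto simp: sym_pos_def_def)
  let ?s = "\<Sum>i<p. a i p * x i"
  have "(\<Sum>i<p. \<Sum>j<p. a i p * a p j / a p p * x i * x j)
      = (\<Sum>i<p. \<Sum>j<p. (a i p * x i) * (a j p * x j)) / a p p"
    by (simp add: sum_divide_distrib sym mult_ac)
  also have "\<dots> = ?s * ?s / a p p" by (simp add: sum_product)
  finally have "quad_form p (schur_compl p a) x = quad_form p a x - ?s * ?s / a p p"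
    by (simp add: quad_form_def schur_compl_def left_diff_distrib sum_subtractf)
  moreover have "quad_form (Suc p) a x = quad_form p a x + 2 * (x p * ?s) + a p p * x p * x p"
    by (simp add: quad_form_def sum.distrib sum_distrib_left sym mult_ac)
  moreover have "a p p * (x p + s / a p p)\<^sup>2 = s * s / a p p + 2 * (x p * s) + a p p * x p * x p" for s
    using pos by (simp add: field_simps power2_eq_square)
  ultimately show ?thesis by simp
qed

lemma sym_pos_def_schur_compl:
  assumes "sym_pos_def (Suc p) a"
  shows "sym_pos_def p (schur_compl p a)"
  unfolding sym_pos_def_def
proof (intro conjI allI impI)
  fix i j assume "i < p" "j < p"
  then show "schur_compl p a i j = schur_compl p a j i"
    using assms by (simp add: sym_pos_def_def schur_compl_def less_SucI)
next
  fix x :: "nat \<Rightarrow> real" assume "\<exists>i<p. x i \<noteq> 0"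
  then obtain i where i: "i < p" "x i \<noteq> 0" by auto
  \<comment> \<open>The last coordinate is the minimiser: it makes the square in
    \<open>quad_form_Suc\<close> vanish, so positivity in dimension \<open>Suc p\<close> passes to
    the Schur complement.\<close>
  define y where "y = x(p := - (\<Sum>i<p. a i p * x i) / a p p)"
  have s: "(\<Sum>i<p. a i p * y i) = (\<Sum>i<p. a i p * x i)" by (auto simp: y_def intro!: sum.cong)
  have "0 < quad_form (Suc p) a y"
    using assms i unfolding sym_pos_def_def by (metis fun_upd_other less_Suc_eq less_irrefl y_def)
  also have "\<dots> = quad_form p (schur_compl p a) y"
    unfolding quad_form_Suc[OF assms] s by (simp add: y_def)
  also have "\<dots> = quad_form p (schur_compl p a) x"
    by (intro quad_form_cong) (auto simp: y_def)
  finally show "0 < quad_form p (schur_compl p a) x" .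
qed

section \<open>Determinants by elimination of the last index\<close>

definition mat_of :: "nat \<Rightarrow> (nat \<Rightarrow> nat \<Rightarrow> real) \<Rightarrow> real mat" where
  "mat_of p a = mat p p (\<lambda>(i, j). a i j)"

lemma det_mat_of_Suc:
  assumes "a p p \<noteq> 0"
  shows "Determinant.det (mat_of (Suc p) a) = a p p * Determinant.det (mat_of p (schur_compl p a))"
proof -
  \<comment> \<open>Unit triangular row operations that clear the last column above the pivot
    \<open>a p p\<close>; the leading block then is the Schur complement.\<close>
  define U where "U = mat (Suc p) (Suc p)
    (\<lambda>(i, j). if i = j then 1 else if j = p then - a i p / a p p else 0 :: real)"
  have U: "U \<in> carrier_mat (Suc p) (Suc p)" and M: "mat_of (Suc p) a \<in> carrier_mat (Suc p) (Suc p)"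
    by (auto simp: U_def mat_of_def)
  have "Determinant.det U = prod_list (diag_mat U)"
    by (rule det_upper_triangular[OF _ U]) (auto simp: U_def)
  also have "\<dots> = 1"
  proof -
    have "diag_mat U = map (\<lambda>_. 1) [0..<Suc p]"
      unfolding diag_mat_def by (intro map_cong) (auto simp: U_def)
    then show ?thesis by (simp add: map_replicate_const del: upt_Suc)
  qed
  finally have dU: "Determinant.det U = 1" .
  have "U * mat_of (Suc p) a = four_block_mat (mat_of p (schur_compl p a)) (0\<^sub>m p 1)
     (mat 1 p (\<lambda>(i, j). a p j)) (mat 1 1 (\<lambda>_. a p p))" (is "?L = ?R")
  proof (rule eq_matI)
    fix i j assume "i < dim_row ?R" "j < dim_col ?R"
    then have ij: "i < Suc p" "j < Suc p" by (auto simp: mat_of_def)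
    have "?L $$ (i, j) = (\<Sum>k<Suc p. U $$ (i, k) * mat_of (Suc p) a $$ (k, j))"
      using ij U M by (simp add: scalar_prod_def atLeast0LessThan del: sum.lessThan_Suc)
    also have "\<dots> = (\<Sum>k<Suc p. U $$ (i, k) * a k j)"
      using ij by (intro sum.cong) (auto simp: mat_of_def)
    also have "\<dots> = (\<Sum>k<p. U $$ (i, k) * a k j) + U $$ (i, p) * a p j" by simp
    also have "(\<Sum>k<p. U $$ (i, k) * a k j) = (\<Sum>k<p. if i = k then a k j else 0)"
      using ij by (intro sum.cong) (auto simp: U_def)
    also have "(\<Sum>k<p. if i = k then a k j else 0) + U $$ (i, p) * a p j
        = (if i < p then a i j - a i p * a p j / a p p else a p j)"
      using ij by (auto simp: U_def)
    also have "\<dots> = ?R $$ (i, j)"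
      using ij assms by (auto simp: mat_of_def schur_compl_def less_Suc_eq)
    finally show "?L $$ (i, j) = ?R $$ (i, j)" .
  qed (auto simp: U_def mat_of_def)
  then have "Determinant.det (U * mat_of (Suc p) a)
      = Determinant.det (mat_of p (schur_compl p a)) * Determinant.det (mat 1 1 (\<lambda>_. a p p))"
    by (simp, intro det_four_block_mat_upper_right_zero_col) (auto simp: mat_of_def)
  then show ?thesis
    using det_mult[OF U M] dU by (simp add: det_single)
qed

lemma det_mat_of_pos:
  assumes "sym_pos_def p a"
  shows "0 < Determinant.det (mat_of p a)"
  using assms
proof (induction p arbitrary: a)
  case 0
  then show ?case by (simp add: mat_of_def)
next
  case (Suc p)
  have "a p p > 0" using sym_pos_def_diag_pos[OF Suc.prems] by simp
  then show ?case
    using Suc.IH[OF sym_pos_def_schur_compl[OF Suc.prems]] by (simp add: det_mat_of_Suc)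
qed

section \<open>The Gaussian integral, one variable at a time\<close>

lemma nn_integral_shifted_gaussian:
  fixes d m :: real
  assumes "0 < d"
  shows "(\<integral>\<^sup>+y. ennreal (exp (- (d * (y - m)\<^sup>2 / 2))) \<partial>lborel) = ennreal (sqrt (2 * pi / d))"
proof -
  interpret prob_space "density lborel (\<lambda>x. ennreal (normal_density m (sqrt (1 / d)) x))"
    by (rule prob_space_normal_density) (use assms in simp)
  have e: "exp (- (d * (y - m)\<^sup>2 / 2)) = sqrt (2 * pi / d) * normal_density m (sqrt (1 / d)) y" for y
    using assms by (simp add: normal_density_def real_sqrt_mult real_sqrt_divide field_simps)
  have "(\<integral>\<^sup>+y. ennreal (normal_density m (sqrt (1 / d)) y) \<partial>lborel) = 1"
    using emeasure_space_1 by (simp add: emeasure_density)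
  then show ?thesis
    unfolding e using assms by (simp add: ennreal_mult nn_integral_cmult)
qed

lemma quad_form_shift_measurable [measurable]:
  "(\<lambda>x. quad_form p a (\<lambda>i. x i - m i)) \<in> borel_measurable (Pi\<^sub>M {..<p} (\<lambda>_. lborel))"
  unfolding quad_form_def
  by (intro borel_measurable_sum borel_measurable_times borel_measurable_diff
      borel_measurable_const borel_measurable_const measurable_component_singleton) auto

text \<open>The last variable is integrated first. Its integral depends only on the pivot, because
  the other variables merely move the centre of the square; the pivots multiply up to the
  determinant.\<close>

lemma gaussian_integral:
  assumes "sym_pos_def p a"
  shows "(\<integral>\<^sup>+x. ennreal (exp (- quad_form p a (\<lambda>i. x i - m i) / 2)) \<partial>(Pi\<^sub>M {..<p} (\<lambda>_. lborel)))
    = ennreal ((2 * pi) powr (real p / 2) / sqrt (Determinant.det (mat_of p a)))"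
  using assms
proof (induction p arbitrary: a)
  case 0
  then show ?case
    by (simp add: quad_form_def mat_of_def PiM_empty nn_integral_count_space_finite)
next
  case (Suc p)
  interpret product_sigma_finite "\<lambda>_::nat. lborel :: real measure" by standard
  have pos: "a p p > 0" using sym_pos_def_diag_pos[OF Suc.prems] by simp
  note spd = sym_pos_def_schur_compl[OF Suc.prems]
  have dpos: "Determinant.det (mat_of p (schur_compl p a)) > 0" by (rule det_mat_of_pos[OF spd])
  let ?q = "\<lambda>x. quad_form p (schur_compl p a) (\<lambda>i. x i - m i)"
  let ?c = "\<lambda>x. m p - (\<Sum>i<p. a i p * (x i - m i)) / a p p"
  have "(\<integral>\<^sup>+x. ennreal (exp (- quad_form (Suc p) a (\<lambda>i. x i - m i) / 2)) \<partial>(Pi\<^sub>M {..<Suc p} (\<lambda>_. lborel)))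
      = (\<integral>\<^sup>+x. (\<integral>\<^sup>+y. ennreal (exp (- quad_form (Suc p) a (\<lambda>i. (x(p := y)) i - m i) / 2)) \<partial>lborel)
           \<partial>(Pi\<^sub>M {..<p} (\<lambda>_. lborel)))"
    unfolding lessThan_Suc
  proof (rule product_nn_integral_insert)
    show "(\<lambda>x. ennreal (exp (- quad_form (Suc p) a (\<lambda>i. x i - m i) / 2)))
        \<in> borel_measurable (Pi\<^sub>M (insert p {..<p}) (\<lambda>_. lborel))"
      unfolding lessThan_Suc[symmetric] by measurable
  qed auto
  also have "\<dots> = (\<integral>\<^sup>+x. ennreal (exp (- ?q x / 2)) * ennreal (sqrt (2 * pi / a p p)) \<partial>(Pi\<^sub>M {..<p} (\<lambda>_. lborel)))"
  proof (rule nn_integral_cong)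
    fix x :: "nat \<Rightarrow> real"
    have "quad_form (Suc p) a (\<lambda>i. (x(p := y)) i - m i) = ?q x + a p p * (y - ?c x)\<^sup>2" for y
      unfolding quad_form_Suc[OF Suc.prems]
      by (intro arg_cong2[where f = "(+)"] quad_form_cong) (auto simp: algebra_simps)
    then have "(\<integral>\<^sup>+y. ennreal (exp (- quad_form (Suc p) a (\<lambda>i. (x(p := y)) i - m i) / 2)) \<partial>lborel)
       = (\<integral>\<^sup>+y. ennreal (exp (- ?q x / 2)) * ennreal (exp (- (a p p * (y - ?c x)\<^sup>2 / 2))) \<partial>lborel)"
      by (intro nn_integral_cong) (simp add: ennreal_mult[symmetric] exp_add[symmetric] add_divide_distrib)
    also have "\<dots> = ennreal (exp (- ?q x / 2)) * ennreal (sqrt (2 * pi / a p p))"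
      by (subst nn_integral_cmult) (auto simp: nn_integral_shifted_gaussian[OF pos])
    finally show "(\<integral>\<^sup>+y. ennreal (exp (- quad_form (Suc p) a (\<lambda>i. (x(p := y)) i - m i) / 2)) \<partial>lborel)
       = ennreal (exp (- ?q x / 2)) * ennreal (sqrt (2 * pi / a p p))" .
  qed
  also have "\<dots> = ennreal ((2 * pi) powr (real p / 2) / sqrt (Determinant.det (mat_of p (schur_compl p a))))
      * ennreal (sqrt (2 * pi / a p p))"
    by (subst nn_integral_multc, measurable) (simp only: Suc.IH[OF spd])
  also have "\<dots> = ennreal ((2 * pi) powr (real p / 2) / sqrt (Determinant.det (mat_of p (schur_compl p a)))
      * sqrt (2 * pi / a p p))"
    using pos dpos by (intro ennreal_mult[symmetric]) auto
  also have "\<dots> = ennreal ((2 * pi) powr (real (Suc p) / 2) / sqrt (Determinant.det (mat_of (Suc p) a)))"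
  proof -
    have "(2 * pi) powr (real (Suc p) / 2) = (2 * pi) powr (real p / 2) * sqrt (2 * pi)"
      by (simp add: add_divide_distrib powr_add powr_half_sqrt[symmetric])
    then show ?thesis
      using pos by (simp add: det_mat_of_Suc real_sqrt_mult real_sqrt_divide mult.commute)
  qed
  finally show ?case .
qed

section \<open>Total variation between normal laws\<close>

text \<open>The second-order bound of \<open>ln det\<close> near the identity, obtained from the
  pivots instead of the eigenvalues. The threshold 1/64 keeps every pivot within 1/8 of 1 and is
  inherited by the Schur complement, since elimination does not increase the Frobenius distance to
  the identity.\<close>

lemma det_mat_of_ge_exp:
  assumes "sym_pos_def p a"
    and "(\<Sum>i<p. \<Sum>j<p. (a i j - (if i = j then 1 else 0))\<^sup>2) \<le> 1 / 64"
  shows "exp ((\<Sum>i<p. a i i - 1) - 2 * (\<Sum>i<p. \<Sum>j<p. (a i j - (if i = j then 1 else 0))\<^sup>2))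
    \<le> Determinant.det (mat_of p a)"
  using assms
proof (induction p arbitrary: a)
  case 0
  then show ?case by (simp add: mat_of_def)
next
  case (Suc p)
  define e where "e = (\<lambda>i j. a i j - (if i = j then 1 else 0 :: real))"
  define v where "v = (\<lambda>i. a i p)"
  define d where "d = a p p"
  define u where "u = d - 1"
  define S where "S = (\<Sum>i<p. (v i)\<^sup>2)"
  define F where "F = (\<Sum>i<p. \<Sum>j<p. (e i j)\<^sup>2)"
  define C where "C = (\<Sum>i<p. \<Sum>j<p. e i j * (v i * v j))"
  define F2 where "F2 = (\<Sum>i<p. \<Sum>j<p. (schur_compl p a i j - (if i = j then 1 else 0))\<^sup>2)"
  have sym: "a p i = a i p" if "i < p" for i
    using Suc.prems that by (auto simp: sym_pos_def_def)
  have tot: "(\<Sum>i<Suc p. \<Sum>j<Suc p. (a i j - (if i = j then 1 else 0))\<^sup>2) = F + 2 * S + u\<^sup>2"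
    by (simp add: F_def S_def e_def v_def u_def d_def sum.distrib sym)
  have S0: "0 \<le> S" and F0: "0 \<le> F"
    by (auto simp: S_def F_def intro!: sum_nonneg)
  have bnd: "F + 2 * S + u\<^sup>2 \<le> 1 / 64" using Suc.prems(2) unfolding tot .
  have S_le: "S \<le> 1 / 128" and F_le: "F \<le> 1 / 64" and u_le: "u\<^sup>2 \<le> (1 / 8)\<^sup>2"
    using bnd S0 F0 zero_le_power2[of u] unfolding power_divide by (simp_all, linarith+)
  have u_abs: "\<bar>u\<bar> \<le> 1 / 8" using u_le by (metis abs_le_square_iff abs_of_nonneg zero_le_divide_1_iff zero_le_numeral)
  have d78: "7 / 8 \<le> d" using u_abs unfolding u_def by linarith
  \<comment> \<open>Cauchy-Schwarz over index pairs; the factor 1/8 is the root of the bound 1/64 on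
    \<open>F\<close>.\<close>
  have C_abs: "\<bar>C\<bar> \<le> S / 8"
  proof -
    have "C\<^sup>2 \<le> (\<Sum>z\<in>{..<p} \<times> {..<p}. (case z of (i, j) \<Rightarrow> e i j)\<^sup>2)
        * (\<Sum>z\<in>{..<p} \<times> {..<p}. (case z of (i, j) \<Rightarrow> v i * v j)\<^sup>2)"
      unfolding C_def sum.cartesian_product
      by (rule order_trans[OF _ Cauchy_Schwarz_ineq_sum]) (simp add: case_prod_beta)
    also have "\<dots> = F * (S * S)"
      unfolding F_def S_def sum_product sum.cartesian_product by (simp add: case_prod_beta power_mult_distrib)
    also have "\<dots> \<le> (1 / 64) * (S * S)" by (intro mult_right_mono F_le) simp
    also have "\<dots> = (S / 8)\<^sup>2" by (simp add: power2_eq_square)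
    finally show ?thesis using S0 by (metis abs_le_square_iff abs_of_nonneg zero_le_divide_iff zero_le_numeral)
  qed
  \<comment> \<open>Expansion of the squared Frobenius norm of the rank-one update
    \<open>e i j - v i * v j / d\<close>.\<close>
  have F2: "F2 = F - 2 * C / d + (S * S) / (d * d)"
  proof -
    have "F2 = (\<Sum>i<p. \<Sum>j<p. (e i j)\<^sup>2 - (2 / d) * (e i j * (v i * v j)) + ((v i)\<^sup>2 * (v j)\<^sup>2) / (d * d))"
      unfolding F2_def
      by (intro sum.cong refl)
         (simp add: e_def v_def d_def schur_compl_def sym power2_eq_square algebra_simps diff_divide_distrib)
    also have "\<dots> = F - (2 / d) * C + (\<Sum>i<p. \<Sum>j<p. (v i)\<^sup>2 * (v j)\<^sup>2) / (d * d)"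
      by (simp add: F_def C_def S_def sum.distrib sum_subtractf sum_distrib_left sum_divide_distrib[symmetric])
    also have "(\<Sum>i<p. \<Sum>j<p. (v i)\<^sup>2 * (v j)\<^sup>2) = S * S"
      by (simp add: S_def sum_product)
    finally show ?thesis by simp
  qed
  have "- 2 * C / d \<le> (S / 4) / d" using C_abs d78 by (intro divide_right_mono) auto
  also have "\<dots> \<le> (S / 4) / (7 / 8)" using d78 S0 by (intro divide_left_mono) auto
  finally have t1: "- 2 * C / d \<le> S / 3" using S0 by simp
  have "(S * S) / (d * d) \<le> (S * S) / ((7 / 8) * (7 / 8))"
    using d78 S0 by (intro divide_left_mono mult_mono) auto
  also have "\<dots> \<le> S * (1 / 64)" using S_le S0 mult_left_mono[OF S_le S0] by simp
  finally have t2: "(S * S) / (d * d) \<le> S / 64" by simp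
  have F2_le: "F2 \<le> F + S / 2" using t1 t2 S0 unfolding F2 by simp
  have "S / d \<le> S / (7 / 8)" using d78 S0 by (intro divide_left_mono) auto
  also have "\<dots> \<le> 2 * S" using S0 by simp
  finally have t3: "S / d \<le> 2 * S" .
  have IH: "exp ((\<Sum>i<p. schur_compl p a i i - 1) - 2 * F2) \<le> Determinant.det (mat_of p (schur_compl p a))"
    unfolding F2_def
    by (rule Suc.IH[OF sym_pos_def_schur_compl[OF Suc.prems(1)]])
       (use F2_le bnd S0 zero_le_power2[of u] in \<open>unfold F2_def[symmetric], linarith\<close>)
  have tr: "(\<Sum>i<p. schur_compl p a i i - 1) = (\<Sum>i<p. a i i - 1) - S / d"
    by (simp add: schur_compl_def S_def d_def v_def sum_subtractf sum_divide_distrib sym power2_eq_square)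
  \<comment> \<open>The origin of the factor 2 in front of the squared norm in the
    statement.\<close>
  have "u - 2 * u\<^sup>2 \<le> ln (1 + u)"
    using abs_ln_one_plus_x_minus_x_bound[of u] u_abs by auto
  then have d_ge: "exp (u - 2 * u\<^sup>2) \<le> d"
    using d78 by (metis add.commute diff_add_cancel exp_le_cancel_iff exp_ln less_le_trans u_def zero_less_divide_iff zero_less_numeral)
  \<comment> \<open>The budget: the last row and column allow a loss of \<open>4 * S\<close>. The
    trace loses \<open>S / d \<le> 2 * S\<close>, and twice the growth of the squared norm is at
    most \<open>S\<close>.\<close>
  have "exp ((\<Sum>i<Suc p. a i i - 1) - 2 * (\<Sum>i<Suc p. \<Sum>j<Suc p. (a i j - (if i = j then 1 else 0))\<^sup>2))
      \<le> exp ((u - 2 * u\<^sup>2) + ((\<Sum>i<p. schur_compl p a i i - 1) - 2 * F2))"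
    unfolding tot tr using F2_le t3 S0 by (simp add: u_def d_def)
  also have "\<dots> \<le> d * Determinant.det (mat_of p (schur_compl p a))"
    unfolding exp_add using d_ge IH d78 by (intro mult_mono) auto
  also have "\<dots> = Determinant.det (mat_of (Suc p) a)"
    using d78 by (simp add: det_mat_of_Suc d_def)
  finally show ?case .
qed

section \<open>Normal densities parametrised by a precision matrix\<close>

definition mat_entries :: "real mat \<Rightarrow> nat \<Rightarrow> nat \<Rightarrow> real" where
  "mat_entries A i j = A $$ (i, j)"

lemma scalar_prod_mult_mat_vec:
  assumes "A \<in> carrier_mat p p"
  shows "scalar_prod (vec p x) (A *\<^sub>v vec p x) = quad_form p (mat_entries A) x"
  using assms
  by (auto simp: quad_form_def mat_entries_def scalar_prod_def atLeast0LessThan sum_distrib_left mult_ac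
      intro!: sum.cong)

lemma mat_of_mat_entries: "A \<in> carrier_mat p p \<Longrightarrow> mat_of p (mat_entries A) = A"
  by (auto simp: mat_of_def mat_entries_def intro!: eq_matI)

lemma sym_pos_def_mat_entries:
  assumes "pos_def_mat p A"
  shows "sym_pos_def p (mat_entries A)"
  unfolding sym_pos_def_def
proof (intro conjI allI impI)
  have A: "A \<in> carrier_mat p p" and T: "transpose_mat A = A"
    using assms by (auto simp: pos_def_mat_def)
  fix i j assume "i < p" "j < p"
  then have "A $$ (i, j) = transpose_mat A $$ (j, i)" using A by auto
  then show "mat_entries A i j = mat_entries A j i" unfolding T by (simp add: mat_entries_def)
next
  have A: "A \<in> carrier_mat p p" using assms by (auto simp: pos_def_mat_def)
  fix x :: "nat \<Rightarrow> real" assume "\<exists>i<p. x i \<noteq> 0"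
  then have "vec p x \<noteq> 0\<^sub>v p" by (auto simp: vec_eq_iff)
  then have "0 < scalar_prod (vec p x) (A *\<^sub>v vec p x)"
    using assms by (auto simp: pos_def_mat_def)
  then show "0 < quad_form p (mat_entries A) x" by (simp add: scalar_prod_mult_mat_vec[OF A])
qed

definition gauss_density :: "nat \<Rightarrow> real mat \<Rightarrow> (nat \<Rightarrow> real) \<Rightarrow> (nat \<Rightarrow> real) \<Rightarrow> real" where
  "gauss_density p A m x = sqrt (Determinant.det A) / (2 * pi) powr (real p / 2)
     * exp (- quad_form p (mat_entries A) (\<lambda>i. x i - m i) / 2)"

lemma gauss_density_measurable [measurable]:
  "gauss_density p A m \<in> borel_measurable (Pi\<^sub>M {..<p} (\<lambda>_. lborel))"
  unfolding gauss_density_def by measurable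

lemma mvn_precision_eq:
  assumes "pos_def_mat p A"
  shows "mvn_precision p m A = density (Pi\<^sub>M {..<p} (\<lambda>_. lborel)) (\<lambda>x. ennreal (gauss_density p A m x))"
proof -
  have A: "A \<in> carrier_mat p p" using assms by (auto simp: pos_def_mat_def)
  show ?thesis
    unfolding mvn_precision_def gauss_density_def Let_def scalar_prod_mult_mat_vec[OF A] by simp
qed

lemma det_pos_def_mat: "pos_def_mat p A \<Longrightarrow> 0 < Determinant.det A"
  using det_mat_of_pos[OF sym_pos_def_mat_entries] mat_of_mat_entries
  by (fastforce simp: pos_def_mat_def)

lemma gauss_density_pos: "pos_def_mat p A \<Longrightarrow> 0 < gauss_density p A m x"
  using det_pos_def_mat by (simp add: gauss_density_def)

lemma nn_integral_gauss_density:
  assumes "pos_def_mat p A"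
  shows "(\<integral>\<^sup>+x. ennreal (gauss_density p A m x) \<partial>(Pi\<^sub>M {..<p} (\<lambda>_. lborel))) = 1"
proof -
  have A: "A \<in> carrier_mat p p" using assms by (auto simp: pos_def_mat_def)
  have d: "0 < Determinant.det A" by (rule det_pos_def_mat[OF assms])
  let ?c = "sqrt (Determinant.det A) / (2 * pi) powr (real p / 2)"
  have c: "?c > 0" using d by simp
  have "(\<integral>\<^sup>+x. ennreal (gauss_density p A m x) \<partial>(Pi\<^sub>M {..<p} (\<lambda>_. lborel)))
     = (\<integral>\<^sup>+x. ennreal ?c * ennreal (exp (- quad_form p (mat_entries A) (\<lambda>i. x i - m i) / 2)) \<partial>(Pi\<^sub>M {..<p} (\<lambda>_. lborel)))"
    unfolding gauss_density_def using c by (intro nn_integral_cong ennreal_mult) auto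
  also have "\<dots> = ennreal ?c * ennreal ((2 * pi) powr (real p / 2) / sqrt (Determinant.det A))"
    by (subst nn_integral_cmult)
       (auto simp only: gaussian_integral[OF sym_pos_def_mat_entries[OF assms]] mat_of_mat_entries[OF A], measurable)
  also have "\<dots> = ennreal (?c * ((2 * pi) powr (real p / 2) / sqrt (Determinant.det A)))"
    using c d by (intro ennreal_mult[symmetric]) auto
  also have "\<dots> = 1" using d by simp
  finally show ?thesis .
qed

lemma prob_space_mvn_precision:
  "pos_def_mat p A \<Longrightarrow> prob_space (mvn_precision p m A)"
  unfolding mvn_precision_eq
  by (intro prob_spaceI) (simp add: emeasure_density nn_integral_gauss_density)

lemma sets_mvn_precision: "sets (mvn_precision p m A) = sets (Pi\<^sub>M {..<p} (\<lambda>_. borel))"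
  unfolding mvn_precision_def by (auto intro!: sets_PiM_cong)

lemma quad_form_shift:
  assumes "sym_pos_def p a" "k < p"
  shows "quad_form p a (\<lambda>i. z i - (if i = k then t else 0))
    = quad_form p a z - 2 * t * (\<Sum>j<p. a k j * z j) + t\<^sup>2 * a k k"
proof -
  have sym: "a i k = a k i" if "i < p" for i
    using assms that by (auto simp: sym_pos_def_def)
  have "quad_form p a (\<lambda>i. z i - (if i = k then t else 0))
     = (\<Sum>i<p. \<Sum>j<p. a i j * z i * z j - (if j = k then a i j * z i * t else 0)
         - (if i = k then a i j * t * z j else 0) + (if j = k then (if i = k then a i j * t * t else 0) else 0))"
    unfolding quad_form_def by (intro sum.cong refl) (auto simp: algebra_simps)
  also have "\<dots> = quad_form p a z - (\<Sum>i<p. a i k * z i * t) - (\<Sum>j<p. a k j * t * z j) + a k k * t * t"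
  proof -
    have "(\<Sum>i<p. \<Sum>j<p. if i = k then a i j * t * z j else 0) = (\<Sum>j<p. a k j * t * z j)"
      using assms(2) by (subst sum.swap) (simp add: sum.delta)
    then show ?thesis
      using assms(2) by (simp add: quad_form_def sum.distrib sum_subtractf sum.delta)
  qed
  also have "(\<Sum>i<p. a i k * z i * t) = (\<Sum>j<p. a k j * t * z j)"
    by (intro sum.cong) (auto simp: sym)
  finally show ?thesis by (simp add: sum_distrib_left sum_negf power2_eq_square mult_ac)
qed

text \<open>Squaring the shifted density and dividing by the unshifted one doubles the linear term
  in the exponent, which is the linear term of a shift by \<open>2 * t\<close>. Only the quadratic
  terms fail to match, and they involve the diagonal entry alone. Hence a single-coordinate
  chi-square distance ignores the rest of the matrix.\<close>

lemma gauss_density_shift_ratio: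
  assumes "pos_def_mat p A" "k < p"
  shows "(gauss_density p A (m(k := m k + t)) x)\<^sup>2 / gauss_density p A m x
    = exp (t\<^sup>2 * A $$ (k, k)) * gauss_density p A (m(k := m k + 2 * t)) x"
proof -
  let ?a = "mat_entries A" and ?c = "sqrt (Determinant.det A) / (2 * pi) powr (real p / 2)"
  let ?z = "\<lambda>i. x i - m i"
  let ?L = "\<Sum>j<p. ?a k j * ?z j"
  have spd: "sym_pos_def p ?a" by (rule sym_pos_def_mat_entries[OF assms(1)])
  have c: "?c > 0" using det_pos_def_mat[OF assms(1)] by simp
  have q: "quad_form p ?a (\<lambda>i. x i - (m(k := m k + s)) i)
      = quad_form p ?a ?z - 2 * s * ?L + s\<^sup>2 * ?a k k" for s
    unfolding quad_form_shift[OF spd assms(2), symmetric] by (intro quad_form_cong) auto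
  have "(gauss_density p A (m(k := m k + t)) x)\<^sup>2 / gauss_density p A m x
     = ?c * (exp (- (quad_form p ?a ?z - 2 * t * ?L + t\<^sup>2 * ?a k k) / 2)
        * exp (- (quad_form p ?a ?z - 2 * t * ?L + t\<^sup>2 * ?a k k) / 2)
        / exp (- quad_form p ?a ?z / 2))"
    unfolding gauss_density_def q using c by (simp add: power2_eq_square)
  also have "\<dots> = ?c * exp (t\<^sup>2 * ?a k k + - (quad_form p ?a ?z - 2 * (2 * t) * ?L + (2 * t)\<^sup>2 * ?a k k) / 2)"
    unfolding exp_add[symmetric] exp_diff[symmetric]
    by (intro arg_cong2[where f = "(*)"] arg_cong[where f = exp] refl) (simp add: field_simps power2_eq_square)
  also have "\<dots> = exp (t\<^sup>2 * A $$ (k, k)) * gauss_density p A (m(k := m k + 2 * t)) x"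
    unfolding gauss_density_def q exp_add by (simp add: mat_entries_def)
  finally show ?thesis .
qed


section \<open>Comparison with the identity precision matrix\<close>

lemma pos_def_mat_one: "pos_def_mat p (1\<^sub>m p)"
  unfolding pos_def_mat_def
proof (intro conjI ballI impI)
  fix v :: "real vec" assume v: "v \<in> carrier_vec p" "v \<noteq> 0\<^sub>v p"
  then obtain i where i: "i < p" "v $ i \<noteq> 0" by (auto simp: vec_eq_iff)
  have "0 < (\<Sum>j\<in>{0..<p}. v $ j * v $ j)"
    by (rule sum_pos2[of _ i]) (use i in \<open>auto simp: power2_eq_square[symmetric]\<close>)
  then show "0 < scalar_prod v (1\<^sub>m p *\<^sub>v v)" using v by (simp add: scalar_prod_def)
qed auto

lemma gauss_density_one:
  "gauss_density p (1\<^sub>m p) m x = (\<Prod>i<p. normal_density (m i) 1 (x i))"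
proof -
  have "(\<Prod>i<p. normal_density (m i) 1 (x i)) = (\<Prod>i<p. 1 / sqrt (2 * pi)) * exp (\<Sum>i<p. - (x i - m i)\<^sup>2 / 2)"
    unfolding normal_density_def exp_sum[OF finite_lessThan] prod.distrib[symmetric] by simp
  also have "(\<Sum>i<p. - (x i - m i)\<^sup>2 / 2) = - quad_form p (mat_entries (1\<^sub>m p)) (\<lambda>i. x i - m i) / 2"
  proof -
    have "quad_form p (mat_entries (1\<^sub>m p)) (\<lambda>i. x i - m i)
        = (\<Sum>i<p. \<Sum>j<p. if i = j then (x i - m i) * (x j - m j) else 0)"
      unfolding quad_form_def by (intro sum.cong refl) (auto simp: mat_entries_def)
    also have "\<dots> = (\<Sum>i<p. (x i - m i)\<^sup>2)" by (simp add: power2_eq_square)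
    finally show ?thesis by (simp add: sum_divide_distrib sum_negf)
  qed
  also have "(\<Prod>i<p. 1 / sqrt (2 * pi)) = 1 / (2 * pi) powr (real p / 2)"
    by (simp add: powr_half_sqrt[symmetric] powr_powr powr_realpow[symmetric] power_one_over[symmetric] power_divide
        del: powr_realpow)
  finally show ?thesis by (simp add: gauss_density_def)
qed

definition dev_entries :: "real mat \<Rightarrow> nat \<Rightarrow> nat \<Rightarrow> real" where
  "dev_entries A i j = mat_entries A i j - (if i = j then 1 else 0)"

lemma gauss_density_eq_one_mult:
  "gauss_density p A m x = gauss_density p (1\<^sub>m p) m x *
     (sqrt (Determinant.det A) * exp (- quad_form p (dev_entries A) (\<lambda>i. x i - m i) / 2))"
proof -
  have "quad_form p (mat_entries A) z = quad_form p (mat_entries (1\<^sub>m p)) z + quad_form p (dev_entries A) z" for z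
    unfolding quad_form_def sum.distrib[symmetric]
    by (intro sum.cong refl) (auto simp: mat_entries_def dev_entries_def algebra_simps)
  then show ?thesis
    by (simp add: gauss_density_def exp_add[symmetric] add_divide_distrib)
qed

text \<open>Each product of two centred coordinates integrates factor by factor. Distinct indices
  leave first moments, which vanish, so only the trace survives.\<close>

lemma has_bochner_integral_gauss_quad_form:
  "has_bochner_integral (Pi\<^sub>M {..<p} (\<lambda>_. lborel))
     (\<lambda>x. gauss_density p (1\<^sub>m p) m x * quad_form p e (\<lambda>i. x i - m i)) (\<Sum>i<p. e i i)"
proof -
  interpret product_sigma_finite "\<lambda>_::nat. lborel :: real measure" by standard
  define h where "h = (\<lambda>i j k y. normal_density (m k) 1 y *
    ((if k = i then y - m k else 1) * (if k = j then y - m k else 1)))"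
  \<comment> \<open>The zeroth or second moment if \<open>k\<close> matches neither or both of
    \<open>i\<close>, \<open>j\<close>; the first moment if it matches exactly one.\<close>
  have h: "has_bochner_integral lborel (h i j k) (if (k = i) = (k = j) then 1 else 0)" for i j k
    using normal_moment_even[of 1 "m k" 0] normal_moment_even[of 1 "m k" 1] normal_moment_odd[of 1 "m k" 0]
    by (cases "k = i"; cases "k = j") (auto simp: h_def power2_eq_square cong: if_cong)
  have eq: "gauss_density p (1\<^sub>m p) m x * quad_form p e (\<lambda>i. x i - m i)
      = (\<Sum>i<p. \<Sum>j<p. e i j * (\<Prod>k<p. h i j k (x k)))" for x
  proof -
    have "(\<Prod>k<p. h i j k (x k)) = (\<Prod>k<p. normal_density (m k) 1 (x k)) * ((x i - m i) * (x j - m j))"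
      if "i < p" "j < p" for i j
      unfolding h_def using that by (simp add: prod.distrib)
    then show ?thesis
      unfolding gauss_density_one quad_form_def sum_distrib_left
      by (intro sum.cong refl) (simp add: mult_ac)
  qed
  have "has_bochner_integral (Pi\<^sub>M {..<p} (\<lambda>_. lborel)) (\<lambda>x. \<Prod>k<p. h i j k (x k))
      (if i = j then 1 else 0)" if ij: "i < p" "j < p" for i j
  proof -
    have "integrable (Pi\<^sub>M {..<p} (\<lambda>_. lborel)) (\<lambda>x. \<Prod>k<p. h i j k (x k))"
      by (rule product_integrable_prod) (auto intro: integrable.intros[OF h])
    moreover have "(\<integral>x. (\<Prod>k<p. h i j k (x k)) \<partial>(Pi\<^sub>M {..<p} (\<lambda>_. lborel)))
        = (\<Prod>k<p. if (k = i) = (k = j) then 1 else 0)"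
      by (subst product_integral_prod)
         (auto intro: integrable.intros[OF h] simp: has_bochner_integral_integral_eq[OF h])
    moreover have "(\<Prod>k<p. if (k = i) = (k = j) then 1 else 0 :: real) = (if i = j then 1 else 0)"
      using ij by (auto intro!: prod_zero)
    ultimately show ?thesis by (simp add: has_bochner_integral_iff)
  qed
  then have "has_bochner_integral (Pi\<^sub>M {..<p} (\<lambda>_. lborel))
      (\<lambda>x. \<Sum>i<p. \<Sum>j<p. e i j * (\<Prod>k<p. h i j k (x k))) (\<Sum>i<p. \<Sum>j<p. e i j * (if i = j then 1 else 0))"
    by (intro has_bochner_integral_sum has_bochner_integral_mult_right) auto
  then show ?thesis
    unfolding eq by (simp add: if_distrib[of "\<lambda>t. _ * t"] sum.delta cong: if_cong)
qed

text \<open>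
  With \<open>s\<^sup>2\<close> and \<open>t\<^sup>2\<close> two densities, this bounds the \<open>L\<^sup>1\<close> distance by the Hellinger affinity,
  with a free parameter \<open>l\<close> in place of the Cauchy-Schwarz inequality.
\<close>

lemma abs_diff_squares_le:
  fixes s t l :: real
  assumes "0 \<le> s" "0 \<le> t" "0 < l"
  shows "\<bar>s\<^sup>2 - t\<^sup>2\<bar> \<le> l / 2 * (s\<^sup>2 + t\<^sup>2) + (s\<^sup>2 + t\<^sup>2 - 2 * (s * t)) / l"
proof -
  let ?a = "s + t" and ?b = "\<bar>s - t\<bar>"
  have "0 \<le> (l * ?a - 2 * ?b)\<^sup>2 / (4 * l)" using assms by simp
  also have "\<dots> = l / 4 * ?a\<^sup>2 + ?b\<^sup>2 / l - ?a * ?b"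
    using assms by (simp add: power2_eq_square field_simps)
  finally have "?a * ?b \<le> l / 4 * ?a\<^sup>2 + ?b\<^sup>2 / l" by simp
  moreover have "\<bar>s\<^sup>2 - t\<^sup>2\<bar> = ?a * ?b"
    using assms by (simp add: power2_eq_square square_diff_square_factored abs_mult)
  moreover have "l / 4 * ?a\<^sup>2 \<le> l / 2 * (s\<^sup>2 + t\<^sup>2)"
  proof -
    have "?a\<^sup>2 \<le> 2 * (s\<^sup>2 + t\<^sup>2)"
      using zero_le_power2[of "s - t"] by (simp add: power2_eq_square algebra_simps)
    then have "l / 4 * ?a\<^sup>2 \<le> l / 4 * (2 * (s\<^sup>2 + t\<^sup>2))" using assms by (intro mult_left_mono) auto
    then show ?thesis by (simp add: algebra_simps)
  qed
  moreover have "?b\<^sup>2 = s\<^sup>2 + t\<^sup>2 - 2 * (s * t)" by (simp add: power2_eq_square algebra_simps)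
  ultimately show ?thesis by simp
qed

text \<open>The Hellinger affinity is the mean, under the identity normal law, of the root of the
  likelihood ratio, an exponential of \<open>- ?q x / 4\<close>. Jensen's inequality bounds it below
  through the mean \<open>tr\<close> of the quadratic form, and in the determinant bound
  \<open>tr\<close> cancels: first-order deviations cost nothing and only \<open>F\<close>
  remains.\<close>

lemma gauss_density_total_variation:
  assumes A: "pos_def_mat p A"
    and F: "(\<Sum>i<p. \<Sum>j<p. (dev_entries A i j)\<^sup>2) = F" "F \<le> 1 / 64"
    and l: "0 < l"
  shows "(\<integral>\<^sup>+x. ennreal \<bar>gauss_density p A m x - gauss_density p (1\<^sub>m p) m x\<bar> \<partial>(Pi\<^sub>M {..<p} (\<lambda>_. lborel)))
     \<le> ennreal (l + F / l)"
proof -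
  let ?M = "Pi\<^sub>M {..<p} (\<lambda>_. lborel) :: (nat \<Rightarrow> real) measure"
  let ?f = "gauss_density p (1\<^sub>m p) m" and ?g = "gauss_density p A m"
  let ?q = "\<lambda>x. quad_form p (dev_entries A) (\<lambda>i. x i - m i)"
  define tr where "tr = (\<Sum>i<p. dev_entries A i i)"
  define D where "D = Determinant.det A"
  \<comment> \<open>The Jensen lower bound of the affinity, with \<open>?q x\<close> replaced by its
    mean \<open>tr\<close>.\<close>
  define K where "K = sqrt (sqrt D) * exp (- tr / 4)"
  have D: "D > 0" unfolding D_def by (rule det_pos_def_mat[OF A])
  have K: "K > 0" using D by (simp add: K_def)
  have "exp (tr - 2 * F) \<le> D"
    using det_mat_of_ge_exp[OF sym_pos_def_mat_entries[OF A]] F A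
    by (simp add: tr_def dev_entries_def D_def mat_of_mat_entries pos_def_mat_def)
  then have "sqrt (sqrt (exp (tr - 2 * F))) \<le> sqrt (sqrt D)" by simp
  moreover have "sqrt (sqrt (exp (tr - 2 * F))) = exp ((tr - 2 * F) / 4)"
  proof -
    have "sqrt (exp y) = exp (y / 2)" for y :: real
      by (intro real_sqrt_unique) (auto simp: exp_double[symmetric])
    then show ?thesis by simp
  qed
  ultimately have "exp ((tr - 2 * F) / 4) * exp (- tr / 4) \<le> K"
    unfolding K_def by (intro mult_right_mono) auto
  then have "exp (- F / 2) \<le> K" by (simp add: exp_add[symmetric] field_simps)
  then have K_ge: "1 - F / 2 \<le> K" using exp_ge_add_one_self[of "- F / 2"] by simp
  \<comment> \<open>A majorant that is linear in the densities and in \<open>?f x * ?q x\<close>, so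
    that its integral is known exactly; the root of the likelihood ratio has been replaced by its
    tangent line at \<open>tr\<close>.\<close>
  define R where "R = (\<lambda>x. (l / 2 + 1 / l) * (?f x + ?g x)
      - 2 / l * K * (?f x - (?f x * ?q x - tr * ?f x) / 4))"
  have le: "\<bar>?g x - ?f x\<bar> \<le> R x" for x
  proof -
    let ?r = "sqrt (sqrt D) * exp (- ?q x / 4)"
    have r2: "?r\<^sup>2 = sqrt D * exp (- ?q x / 2)"
      using D by (simp add: power_mult_distrib exp_double[symmetric])
    have f: "?f x > 0" by (rule gauss_density_pos[OF pos_def_mat_one])
    have g: "?g x = ?f x * ?r\<^sup>2"
      unfolding r2 unfolding D_def by (rule gauss_density_eq_one_mult)
    have e: "1 - y / 4 \<le> exp (- y / 4)" for y :: real
      using exp_ge_add_one_self[of "- y / 4"] by simp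
    have "K * (1 - (?q x - tr) / 4) \<le> K * exp (- (?q x - tr) / 4)"
      by (rule mult_left_mono[OF e less_imp_le[OF K]])
    also have "\<dots> = ?r"
      unfolding K_def by (simp add: exp_add[symmetric] field_simps)
    finally have r: "K * (1 - (?q x - tr) / 4) \<le> ?r" .
    have "\<bar>?r\<^sup>2 - 1\<^sup>2\<bar> \<le> l / 2 * (?r\<^sup>2 + 1\<^sup>2) + (?r\<^sup>2 + 1\<^sup>2 - 2 * (?r * 1)) / l"
      by (rule abs_diff_squares_le) (use D l in auto)
    also have "\<dots> \<le> (l / 2 + 1 / l) * (?r\<^sup>2 + 1) - 2 / l * (K * (1 - (?q x - tr) / 4))"
    proof -
      have "2 / l * (K * (1 - (?q x - tr) / 4)) \<le> 2 / l * ?r" using r l by (intro mult_left_mono) auto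
      then show ?thesis by (simp add: algebra_simps add_divide_distrib diff_divide_distrib)
    qed
    finally have "?f x * \<bar>?r\<^sup>2 - 1\<bar> \<le> ?f x * ((l / 2 + 1 / l) * (?r\<^sup>2 + 1) - 2 / l * (K * (1 - (?q x - tr) / 4)))"
      using f by (intro mult_left_mono) auto
    moreover have "\<bar>?g x - ?f x\<bar> = ?f x * \<bar>?r\<^sup>2 - 1\<bar>"
    proof -
      have "?g x - ?f x = ?f x * (?r\<^sup>2 - 1)" unfolding g right_diff_distrib by simp
      then show ?thesis by (simp only: abs_mult abs_of_pos[OF f])
    qed
    moreover have "?f x * ((l / 2 + 1 / l) * (?r\<^sup>2 + 1) - 2 / l * (K * (1 - (?q x - tr) / 4))) = R x"
      unfolding R_def g by (simp add: algebra_simps)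
    ultimately show ?thesis by simp
  qed
  have f1: "has_bochner_integral ?M ?f 1" and g1: "has_bochner_integral ?M ?g 1"
    using gauss_density_pos[OF pos_def_mat_one] gauss_density_pos[OF A]
    by (auto intro!: has_bochner_integral_nn_integral simp: nn_integral_gauss_density A pos_def_mat_one less_imp_le)
  have fq: "has_bochner_integral ?M (\<lambda>x. ?f x * ?q x) tr"
    unfolding tr_def by (rule has_bochner_integral_gauss_quad_form)
  have R: "has_bochner_integral ?M R ((l / 2 + 1 / l) * (1 + 1) - 2 / l * K * (1 - (tr - tr * 1) / 4))"
    unfolding R_def
    by (intro has_bochner_integral_diff has_bochner_integral_mult_right has_bochner_integral_add
        has_bochner_integral_divide_zero f1 g1 fq)
  have "(\<integral>\<^sup>+x. ennreal \<bar>?g x - ?f x\<bar> \<partial>?M) \<le> (\<integral>\<^sup>+x. ennreal (R x) \<partial>?M)"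
    by (intro nn_integral_mono ennreal_leI le)
  also have "\<dots> = ennreal ((l / 2 + 1 / l) * (1 + 1) - 2 / l * K * (1 - (tr - tr * 1) / 4))"
    using R le by (subst nn_integral_eq_integral)
      (auto simp: has_bochner_integral_iff intro!: AE_I2 order_trans[OF abs_ge_zero])
  also have "\<dots> \<le> ennreal (l + F / l)"
  proof (rule ennreal_leI)
    have "2 / l * (1 - F / 2) \<le> 2 / l * K" using K_ge l by (intro mult_left_mono) auto
    then show "(l / 2 + 1 / l) * (1 + 1) - 2 / l * K * (1 - (tr - tr * 1) / 4) \<le> l + F / l"
      by (simp add: algebra_simps)
  qed
  finally show ?thesis .
qed

text \<open>The cost is additive and uniform in \<open>m\<close> and \<open>B\<close>, so it
  survives integration over the training data and averaging over mean vectors.\<close>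

lemma mvn_precision_one_le:
  assumes A: "pos_def_mat p A"
    and F: "(\<Sum>i<p. \<Sum>j<p. (dev_entries A i j)\<^sup>2) = F" "F \<le> 1 / 64"
    and l: "0 < l"
    and B: "B \<in> sets (Pi\<^sub>M {..<p} (\<lambda>_. lborel))"
  shows "emeasure (mvn_precision p m (1\<^sub>m p)) B \<le> emeasure (mvn_precision p m A) B + ennreal (l + F / l)"
proof -
  let ?M = "Pi\<^sub>M {..<p} (\<lambda>_. lborel) :: (nat \<Rightarrow> real) measure"
  let ?f = "gauss_density p (1\<^sub>m p) m" and ?g = "gauss_density p A m"
  have "emeasure (mvn_precision p m (1\<^sub>m p)) B = (\<integral>\<^sup>+x. ennreal (?f x) * indicator B x \<partial>?M)"
    using B by (simp add: mvn_precision_eq[OF pos_def_mat_one] emeasure_density)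
  also have "\<dots> \<le> (\<integral>\<^sup>+x. ennreal (?g x) * indicator B x + ennreal \<bar>?g x - ?f x\<bar> \<partial>?M)"
    using gauss_density_pos[OF A, of m]
    by (intro nn_integral_mono)
       (auto simp: ennreal_plus[symmetric] less_imp_le split: split_indicator simp del: ennreal_plus intro!: ennreal_leI)
  also have "\<dots> = emeasure (mvn_precision p m A) B + (\<integral>\<^sup>+x. ennreal \<bar>?g x - ?f x\<bar> \<partial>?M)"
    using B by (simp add: mvn_precision_eq[OF A] emeasure_density nn_integral_add)
  also have "\<dots> \<le> emeasure (mvn_precision p m A) B + ennreal (l + F / l)"
    by (intro add_left_mono gauss_density_total_variation[OF A F l])
  finally show ?thesis .
qed

section \<open>Mixtures revealed coordinate by coordinate\<close>

lemma sum_Pow_insert: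
  assumes "finite A" "k \<notin> A"
  shows "(\<Sum>S\<in>Pow (insert k A). f S) = (\<Sum>S\<in>Pow A. f S + f (insert k S))"
proof -
  have "(\<Sum>S\<in>insert k ` Pow A. f S) = (\<Sum>S\<in>Pow A. f (insert k S))"
    by (rule sum.reindex_cong[where l = "insert k"]) (use assms in \<open>auto simp: inj_on_def dest: insert_ident\<close>)
  then show ?thesis
    unfolding Pow_insert using assms by (subst sum.union_disjoint) (auto simp: sum.distrib)
qed

lemma ennreal_sum_mult:
  assumes "\<And>i. i \<in> I \<Longrightarrow> 0 \<le> a i" "\<And>i. i \<in> I \<Longrightarrow> 0 \<le> b i"
  shows "ennreal (\<Sum>i\<in>I. a i * b i) = (\<Sum>i\<in>I. ennreal (a i) * ennreal (b i))"
proof -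
  have "ennreal (\<Sum>i\<in>I. a i * b i) = (\<Sum>i\<in>I. ennreal (a i * b i))"
    using assms by (intro sum_ennreal[symmetric]) auto
  also have "\<dots> = (\<Sum>i\<in>I. ennreal (a i) * ennreal (b i))"
    using assms by (intro sum.cong refl ennreal_mult) auto
  finally show ?thesis .
qed

text \<open>\<open>M\<close> is the law of a null coordinate, \<open>l\<close> the likelihood ratio
  of a shifted one and \<open>c\<close> its chi-square distance. The weights \<open>C\<close> need
  not sum to 1: they will be prior times training likelihood at a fixed sample, which avoids
  dividing by the marginal density of that sample.\<close>

locale coordinate_mixture = prob_space M for M :: "real measure" +
  fixes l :: "real \<Rightarrow> real" and c :: real and p :: nat and C :: "nat set \<Rightarrow> real"
  assumes l_measurable [measurable]: "l \<in> borel_measurable M"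
    and l_pos: "\<And>y. 0 < l y"
    and l_int: "(\<integral>\<^sup>+y. ennreal (l y) \<partial>M) = 1"
    and l_int2: "(\<integral>\<^sup>+y. ennreal ((l y)\<^sup>2) \<partial>M) = ennreal (1 + c)"
    and c_nonneg: "0 \<le> c"
    and C_pos: "\<And>S. S \<subseteq> {..<p} \<Longrightarrow> 0 < C S"
begin

lemma emeasure_space_M: "emeasure M (space M) = 1"
  by (rule emeasure_space_1)

sublocale product_prob_space "\<lambda>_::nat. M"
  by unfold_locales

abbreviation G :: "nat \<Rightarrow> (nat \<Rightarrow> real) measure" where
  "G k \<equiv> Pi\<^sub>M {..<k} (\<lambda>_. M)"

text \<open>
  \<open>w k\<close> is the density of a mixture, with weights \<open>C\<close>, of laws which differ from \<open>M\<close> only in the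
  coordinates of \<open>S\<close> below \<open>k\<close>; it interpolates between the constant \<open>W = w 0\<close> and the full mixture
  \<open>w p\<close>.  The parts \<open>w0 k\<close> and \<open>w1 k\<close> come from the sets without and with \<open>k\<close>.
\<close>

definition likelihood :: "nat \<Rightarrow> nat set \<Rightarrow> (nat \<Rightarrow> real) \<Rightarrow> real" where
  "likelihood k S x = (\<Prod>i\<in>S \<inter> {..<k}. l (x i))"

definition w :: "nat \<Rightarrow> (nat \<Rightarrow> real) \<Rightarrow> real" where
  "w k x = (\<Sum>S\<in>Pow {..<p}. C S * likelihood k S x)"

definition w0 :: "nat \<Rightarrow> (nat \<Rightarrow> real) \<Rightarrow> real" where
  "w0 k x = (\<Sum>S\<in>Pow ({..<p} - {k}). C S * likelihood k S x)"

definition w1 :: "nat \<Rightarrow> (nat \<Rightarrow> real) \<Rightarrow> real" where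
  "w1 k x = (\<Sum>S\<in>Pow ({..<p} - {k}). C (insert k S) * likelihood k S x)"

definition W :: real where
  "W = (\<Sum>S\<in>Pow {..<p}. C S)"

text \<open>The weight \<open>C S + C (insert k S)\<close> of the pair times the squared conditional
  probability of \<open>k\<close> when the rest of the support is known to be
  \<open>S\<close>.\<close>

definition D :: "nat \<Rightarrow> nat set \<Rightarrow> real" where
  "D k S = (C (insert k S))\<^sup>2 / (C S + C (insert k S))"

lemma likelihood_pos: "0 < likelihood k S x"
  unfolding likelihood_def by (intro prod_pos) (auto simp: l_pos)

lemma likelihood_measurable [measurable]:
  assumes "k \<le> j" shows "likelihood k S \<in> borel_measurable (G j)"
  unfolding likelihood_def
  by (intro borel_measurable_prod measurable_compose[OF _ l_measurable] measurable_component_singleton)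
     (use assms in auto)

lemma nn_integral_likelihood: "(\<integral>\<^sup>+x. ennreal (likelihood k S x) \<partial>G k) = 1"
proof -
  have "likelihood k S x = (\<Prod>i<k. if i \<in> S then l (x i) else 1)" for x
    unfolding likelihood_def by (subst prod.inter_restrict[symmetric]) (auto intro!: prod.cong)
  then have "(\<integral>\<^sup>+x. ennreal (likelihood k S x) \<partial>G k)
     = (\<integral>\<^sup>+x. (\<Prod>i<k. ennreal (if i \<in> S then l (x i) else 1)) \<partial>G k)"
    by (intro nn_integral_cong) (auto simp: prod_ennreal l_pos less_imp_le)
  also have "\<dots> = (\<Prod>i<k. (\<integral>\<^sup>+y. ennreal (if i \<in> S then l y else 1) \<partial>M))"
    by (subst product_nn_integral_prod) auto
  also have "\<dots> = 1"
  proof (intro prod.neutral ballI)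
    fix i
    show "(\<integral>\<^sup>+y. ennreal (if i \<in> S then l y else 1) \<partial>M) = 1"
      by (cases "i \<in> S") (simp_all add: l_int emeasure_space_M)
  qed
  finally show ?thesis .
qed

lemma w_measurable [measurable]: "k \<le> j \<Longrightarrow> w k \<in> borel_measurable (G j)"
  unfolding w_def by (intro borel_measurable_sum borel_measurable_times likelihood_measurable) auto

lemma w_pos: "0 < w k x"
  unfolding w_def by (intro sum_pos) (auto simp: C_pos likelihood_pos)

lemma W_pos: "0 < W"
  unfolding W_def by (intro sum_pos) (auto simp: C_pos)

lemma w_zero: "w 0 x = W"
  by (simp add: w_def W_def likelihood_def)

lemma
  assumes "k < p"
  shows w0_nonneg: "0 \<le> w0 k x" and w1_nonneg: "0 \<le> w1 k x"
  unfolding w0_def w1_def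
  by (intro sum_nonneg mult_nonneg_nonneg less_imp_le[OF likelihood_pos] less_imp_le[OF C_pos];
      use assms in auto)+

lemma sum_Pow_split:
  assumes "k < p"
  shows "(\<Sum>S\<in>Pow {..<p}. f S) = (\<Sum>S\<in>Pow ({..<p} - {k}). f S + f (insert k S))"
proof -
  have "{..<p} = insert k ({..<p} - {k})" using assms by auto
  then have "(\<Sum>S\<in>Pow {..<p}. f S) = (\<Sum>S\<in>Pow (insert k ({..<p} - {k})). f S)" by simp
  also have "\<dots> = (\<Sum>S\<in>Pow ({..<p} - {k}). f S + f (insert k S))"
    by (rule sum_Pow_insert) auto
  finally show ?thesis .
qed

lemma w_split:
  assumes "k < p"
  shows "w k x = w0 k x + w1 k x" (is ?A) and "w (Suc k) x = w0 k x + w1 k x * l (x k)" (is ?B)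
proof -
  have "insert k S \<inter> {..<k} = S \<inter> {..<k}" for S by auto
  then have *: "likelihood k (insert k S) x = likelihood k S x" for S
    by (simp add: likelihood_def)
  then show ?A
    unfolding w_def w0_def w1_def sum_Pow_split[OF assms] sum.distrib by simp
  have 1: "likelihood (Suc k) (insert k S) x = likelihood k S x * l (x k)"
    and 2: "likelihood (Suc k) S x = likelihood k S x" if "S \<in> Pow ({..<p} - {k})" for S
  proof -
    have "insert k S \<inter> {..<Suc k} = insert k (S \<inter> {..<k})" by auto
    then show "likelihood (Suc k) (insert k S) x = likelihood k S x * l (x k)"
      unfolding likelihood_def by simp
    have "S \<inter> {..<Suc k} = S \<inter> {..<k}" using that by (auto simp: less_Suc_eq)
    then show "likelihood (Suc k) S x = likelihood k S x"
      unfolding likelihood_def by simp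
  qed
  show ?B
    unfolding w_def w0_def w1_def sum_Pow_split[OF assms] sum.distrib sum_distrib_right
    by (intro arg_cong2[where f = "(+)"] sum.cong refl) (simp_all add: 1 2)
qed

lemma update_simps:
  "w k (x(k := y)) = w k x" "w0 k (x(k := y)) = w0 k x" "w1 k (x(k := y)) = w1 k x"
  by (auto simp: w_def w0_def w1_def likelihood_def intro!: sum.cong prod.cong arg_cong2[where f = "(*)"])

lemma nn_integral_w: "(\<integral>\<^sup>+x. ennreal (w k x) \<partial>G k) = ennreal W"
proof -
  have "(\<integral>\<^sup>+x. ennreal (w k x) \<partial>G k)
      = (\<integral>\<^sup>+x. (\<Sum>S\<in>Pow {..<p}. ennreal (C S) * ennreal (likelihood k S x)) \<partial>G k)"
    unfolding w_def
    by (intro nn_integral_cong ennreal_sum_mult) (auto simp: C_pos likelihood_pos less_imp_le)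
  also have "\<dots> = (\<Sum>S\<in>Pow {..<p}. ennreal (C S))"
    by (subst nn_integral_sum) (auto simp: nn_integral_cmult nn_integral_likelihood)
  also have "\<dots> = ennreal W"
    unfolding W_def by (intro sum_ennreal) (auto simp: C_pos less_imp_le)
  finally show ?thesis .
qed

text \<open>\<open>w\<close> is a martingale in the coordinates: \<open>l\<close> has integral 1, so
  averaging over coordinate \<open>j\<close> turns \<open>w (Suc j)\<close> into \<open>w j\<close>.
  Thus \<open>w k\<close> is the density of the mixture on the first \<open>k\<close>
  coordinates.\<close>

lemma nn_integral_w_marginal:
  assumes "k \<le> j" "j \<le> p" and [measurable]: "H \<in> borel_measurable (G k)"
  shows "(\<integral>\<^sup>+x. ennreal (w j x) * H (restrict x {..<k}) \<partial>G j) = (\<integral>\<^sup>+x. ennreal (w k x) * H x \<partial>G k)"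
  using assms(1,2)
proof (induction j rule: dec_induct)
  case base
  show ?case
    by (intro nn_integral_cong) (auto simp: space_PiM PiE_def extensional_restrict)
next
  case (step j)
  have H_restrict [measurable]: "(\<lambda>x. H (restrict x {..<k})) \<in> borel_measurable (G i)" if "k \<le> i" for i
    by (rule measurable_compose[OF measurable_restrict_subset assms(3)]) (use that in auto)
  have j: "j < p" using step by simp
  have "(\<integral>\<^sup>+x. ennreal (w (Suc j) x) * H (restrict x {..<k}) \<partial>G (Suc j))
     = (\<integral>\<^sup>+x. (\<integral>\<^sup>+y. ennreal (w (Suc j) (x(j := y))) * H (restrict (x(j := y)) {..<k}) \<partial>M) \<partial>G j)"
    unfolding lessThan_Suc
  proof (rule product_nn_integral_insert)
    show "(\<lambda>x. ennreal (w (Suc j) x) * H (restrict x {..<k})) \<in> borel_measurable (Pi\<^sub>M (insert j {..<j}) (\<lambda>_. M))"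
      unfolding lessThan_Suc[symmetric]
      by (intro borel_measurable_times_ennreal measurable_compose[OF w_measurable measurable_ennreal] H_restrict)
         (use step in auto)
  qed auto
  also have "\<dots> = (\<integral>\<^sup>+x. ennreal (w j x) * H (restrict x {..<k}) \<partial>G j)"
  proof (intro nn_integral_cong)
    fix x :: "nat \<Rightarrow> real"
    have r: "restrict (x(j := y)) {..<k} = restrict x {..<k}" for y
      using step by (auto simp: restrict_def)
    have "(\<integral>\<^sup>+y. ennreal (w (Suc j) (x(j := y))) * H (restrict (x(j := y)) {..<k}) \<partial>M)
      = (\<integral>\<^sup>+y. (ennreal (w0 j x) + ennreal (w1 j x) * ennreal (l y)) * H (restrict x {..<k}) \<partial>M)"
      unfolding w_split(2)[OF j] update_simps r
      by (intro nn_integral_cong)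
         (simp add: w0_nonneg[OF j] w1_nonneg[OF j] l_pos less_imp_le ennreal_mult[symmetric] ennreal_plus[symmetric] del: ennreal_plus)
    also have "\<dots> = (ennreal (w0 j x) + ennreal (w1 j x)) * H (restrict x {..<k})"
      by (subst nn_integral_multc) (auto simp: nn_integral_add nn_integral_cmult l_int emeasure_space_M)
    also have "ennreal (w0 j x) + ennreal (w1 j x) = ennreal (w j x)"
      by (simp add: w_split(1)[OF j] w0_nonneg[OF j] w1_nonneg[OF j])
    finally show "(\<integral>\<^sup>+y. ennreal (w (Suc j) (x(j := y))) * H (restrict (x(j := y)) {..<k}) \<partial>M)
       = ennreal (w j x) * H (restrict x {..<k})" .
  qed
  also have "\<dots> = (\<integral>\<^sup>+x. ennreal (w k x) * H x \<partial>G k)"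
    by (rule step.IH) (use step.prems in simp)
  finally show ?case .
qed

section \<open>Chi-square contribution of one coordinate\<close>

lemma D_nonneg: "k < p \<Longrightarrow> S \<in> Pow ({..<p} - {k}) \<Longrightarrow> 0 \<le> D k S"
  unfolding D_def using C_pos[of S] C_pos[of "insert k S"]
  by (intro divide_nonneg_pos add_pos_pos) auto

text \<open>The convexity step: revealing the rest of the support can only raise the second moment
  of the probability of \<open>k\<close>. Test coordinates below \<open>k\<close> have the same
  likelihood under \<open>S\<close> and \<open>insert k S\<close>, so they drop out of that
  conditional probability and \<open>D\<close> contains only the weights.\<close>

lemma w1_sq_le:
  assumes "k < p"
  shows "(w1 k x)\<^sup>2 / w k x \<le> (\<Sum>S\<in>Pow ({..<p} - {k}). D k S * likelihood k S x)"
proof -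
  let ?P = "Pow ({..<p} - {k})"
  \<comment> \<open>The Cauchy-Schwarz factors are balanced so that the squares of \<open>b\<close>
    sum to \<open>w k x\<close>, the denominator.\<close>
  define a where "a = (\<lambda>S. C (insert k S) * sqrt (likelihood k S x) / sqrt (C S + C (insert k S)))"
  define b where "b = (\<lambda>S. sqrt (C S + C (insert k S)) * sqrt (likelihood k S x))"
  have pos: "0 < C S + C (insert k S)" if "S \<in> ?P" for S
    using C_pos[of S] C_pos[of "insert k S"] that assms by (intro add_pos_pos) auto
  have "w1 k x = (\<Sum>S\<in>?P. a S * b S)"
    unfolding w1_def
  proof (intro sum.cong refl)
    fix S assume "S \<in> ?P"
    from pos[OF this] show "C (insert k S) * likelihood k S x = a S * b S"
      by (simp add: a_def b_def less_imp_le[OF likelihood_pos])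
  qed
  then have "(w1 k x)\<^sup>2 \<le> (\<Sum>S\<in>?P. (a S)\<^sup>2) * (\<Sum>S\<in>?P. (b S)\<^sup>2)"
    using Cauchy_Schwarz_ineq_sum by metis
  also have "(\<Sum>S\<in>?P. (a S)\<^sup>2) = (\<Sum>S\<in>?P. D k S * likelihood k S x)"
    using pos by (intro sum.cong refl)
      (simp add: a_def D_def power_mult_distrib power_divide less_imp_le less_imp_le[OF likelihood_pos])
  also have "(\<Sum>S\<in>?P. (b S)\<^sup>2) = w0 k x + w1 k x"
    unfolding w0_def w1_def sum.distrib[symmetric]
    using pos by (intro sum.cong refl)
      (simp add: b_def power_mult_distrib less_imp_le less_imp_le[OF likelihood_pos] distrib_right)
  also have "\<dots> = w k x" by (simp add: w_split(1)[OF assms])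
  finally show ?thesis using w_pos by (simp add: divide_le_eq)
qed

text \<open>Given the earlier coordinates, this is one plus the chi-square distance of coordinate
  \<open>k\<close> from \<open>M\<close>, weighted by the mixture. As \<open>l\<close> has mean 1
  and second moment \<open>1 + c\<close>, the excess is \<open>c\<close> times the squared
  probability that \<open>k\<close> is in the support.\<close>

lemma nn_integral_step:
  assumes k: "k < p"
  shows "(\<integral>\<^sup>+x. ennreal (w p x) * ennreal (w (Suc k) x / w k x) \<partial>G p)
    \<le> ennreal (W + c * (\<Sum>S\<in>Pow ({..<p} - {k}). D k S))"
proof -
  let ?P = "Pow ({..<p} - {k})"
  \<comment> \<open>\<open>w i\<close> reads only coordinates below \<open>i\<close>, so the
    integrand besides \<open>w p\<close> lives on the first \<open>Suc k\<close> coordinates and the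
    others integrate out.\<close>
  have "w i (restrict x {..<Suc k}) = w i x" if "i \<le> Suc k" for i x
    using that by (auto simp: w_def likelihood_def intro!: sum.cong prod.cong arg_cong2[where f = "(*)"])
  then have "(\<integral>\<^sup>+x. ennreal (w p x) * ennreal (w (Suc k) x / w k x) \<partial>G p)
     = (\<integral>\<^sup>+x. ennreal (w p x) * ennreal (w (Suc k) (restrict x {..<Suc k}) / w k (restrict x {..<Suc k})) \<partial>G p)"
    by simp
  also have "\<dots> = (\<integral>\<^sup>+x. ennreal (w (Suc k) x) * ennreal (w (Suc k) x / w k x) \<partial>G (Suc k))"
    by (rule nn_integral_w_marginal) (use k in auto)
  also have "\<dots> = (\<integral>\<^sup>+x. ennreal ((w (Suc k) x)\<^sup>2 / w k x) \<partial>G (Suc k))"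
    by (intro nn_integral_cong) (simp add: ennreal_mult[symmetric] w_pos less_imp_le power2_eq_square)
  also have "\<dots> = (\<integral>\<^sup>+x. (\<integral>\<^sup>+y. ennreal ((w (Suc k) (x(k := y)))\<^sup>2 / w k (x(k := y))) \<partial>M) \<partial>G k)"
    unfolding lessThan_Suc
  proof (rule product_nn_integral_insert)
    show "(\<lambda>x. ennreal ((w (Suc k) x)\<^sup>2 / w k x)) \<in> borel_measurable (Pi\<^sub>M (insert k {..<k}) (\<lambda>_. M))"
      unfolding lessThan_Suc[symmetric] by measurable
  qed auto
  also have "\<dots> \<le> (\<integral>\<^sup>+x. ennreal (w k x) + ennreal c * (\<Sum>S\<in>?P. ennreal (D k S) * ennreal (likelihood k S x)) \<partial>G k)"
  proof (intro nn_integral_mono)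
    fix x
    note nn = w0_nonneg[OF k, of x] w1_nonneg[OF k, of x] less_imp_le[OF l_pos] less_imp_le[OF w_pos]
    have "(\<integral>\<^sup>+y. ennreal ((w (Suc k) (x(k := y)))\<^sup>2 / w k (x(k := y))) \<partial>M)
       = (\<integral>\<^sup>+y. ennreal ((w0 k x)\<^sup>2 / w k x) + ennreal (2 * w0 k x * w1 k x / w k x) * ennreal (l y)
              + ennreal ((w1 k x)\<^sup>2 / w k x) * ennreal ((l y)\<^sup>2) \<partial>M)"
      unfolding w_split(2)[OF k] update_simps
      by (intro nn_integral_cong)
         (simp add: nn ennreal_mult[symmetric] ennreal_plus[symmetric] power2_eq_square algebra_simps add_divide_distrib
            del: ennreal_plus)
    also have "\<dots> = ennreal ((w0 k x)\<^sup>2 / w k x) + ennreal (2 * w0 k x * w1 k x / w k x)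
          + ennreal ((w1 k x)\<^sup>2 / w k x) * ennreal (1 + c)"
      by (simp add: nn_integral_add nn_integral_cmult l_int l_int2 emeasure_space_M)
    also have "\<dots> = ennreal ((w0 k x)\<^sup>2 / w k x + 2 * w0 k x * w1 k x / w k x + (w1 k x)\<^sup>2 / w k x * (1 + c))"
      using nn c_nonneg by (simp add: ennreal_mult[symmetric] ennreal_plus[symmetric] del: ennreal_plus)
    \<comment> \<open>Without \<open>c\<close> the three terms form a perfect square.\<close>
    also have "(w0 k x)\<^sup>2 / w k x + 2 * w0 k x * w1 k x / w k x + (w1 k x)\<^sup>2 / w k x * (1 + c)
        = (w0 k x + w1 k x)\<^sup>2 / w k x + c * ((w1 k x)\<^sup>2 / w k x)"
      by (simp add: power2_eq_square algebra_simps add_divide_distrib)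
    also have "(w0 k x + w1 k x)\<^sup>2 / w k x = w k x"
      using w_pos[of k x] by (simp add: w_split(1)[OF k, symmetric] power2_eq_square)
    also have "ennreal (w k x + c * ((w1 k x)\<^sup>2 / w k x))
        \<le> ennreal (w k x + c * (\<Sum>S\<in>?P. D k S * likelihood k S x))"
      using w1_sq_le[OF k, of x] c_nonneg by (intro ennreal_leI add_left_mono mult_left_mono)
    also have "\<dots> = ennreal (w k x) + ennreal c * (\<Sum>S\<in>?P. ennreal (D k S) * ennreal (likelihood k S x))"
    proof -
      have "0 \<le> (\<Sum>S\<in>?P. D k S * likelihood k S x)"
        using D_nonneg[OF k] by (intro sum_nonneg mult_nonneg_nonneg less_imp_le[OF likelihood_pos]) auto
      then have "ennreal (w k x + c * (\<Sum>S\<in>?P. D k S * likelihood k S x))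
          = ennreal (w k x) + ennreal c * ennreal (\<Sum>S\<in>?P. D k S * likelihood k S x)"
        using c_nonneg nn by (simp add: ennreal_mult)
      also have "ennreal (\<Sum>S\<in>?P. D k S * likelihood k S x) = (\<Sum>S\<in>?P. ennreal (D k S) * ennreal (likelihood k S x))"
        using D_nonneg[OF k] by (intro ennreal_sum_mult less_imp_le[OF likelihood_pos]) auto
      finally show ?thesis .
    qed
    finally show "(\<integral>\<^sup>+y. ennreal ((w (Suc k) (x(k := y)))\<^sup>2 / w k (x(k := y))) \<partial>M)
      \<le> ennreal (w k x) + ennreal c * (\<Sum>S\<in>?P. ennreal (D k S) * ennreal (likelihood k S x))" .
  qed
  also have "\<dots> = ennreal W + ennreal c * (\<Sum>S\<in>?P. ennreal (D k S))"
    by (simp add: nn_integral_add nn_integral_cmult nn_integral_sum nn_integral_likelihood nn_integral_w)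
  also have "\<dots> = ennreal (W + c * (\<Sum>S\<in>?P. D k S))"
  proof -
    have "(\<Sum>S\<in>?P. ennreal (D k S)) = ennreal (\<Sum>S\<in>?P. D k S)" and "0 \<le> (\<Sum>S\<in>?P. D k S)"
      using D_nonneg[OF k] by (auto intro!: sum_ennreal sum_nonneg)
    then show ?thesis using c_nonneg W_pos by (simp add: ennreal_mult)
  qed
  finally show ?thesis .
qed

text \<open>The chain rule as a telescoping product of the ratios
  \<open>w (Suc k) x / w k x\<close>. The inequality \<open>u \<le> exp (u - 1)\<close> on each
  ratio replaces the logarithm in relative entropy, and \<open>1 - y \<le> exp (- y)\<close> then
  leaves a sum that can be integrated term by term.\<close>

lemma sqrt_w_ge:
  "w p x * (1 - (\<Sum>k<p. w (Suc k) x / w k x - 1) / 2) \<le> sqrt (w p x) * sqrt W"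
proof -
  let ?R = "\<Sum>k<p. w (Suc k) x / w k x - 1"
  have prod: "(\<Prod>k<j. w (Suc k) x / w k x) = w j x / W" for j
  proof (induction j)
    case 0
    then show ?case using W_pos by (simp add: w_zero)
  next
    case (Suc j)
    then show ?case using w_pos[of j x] by simp
  qed
  have "w p x / W \<le> (\<Prod>k<p. exp (w (Suc k) x / w k x - 1))"
    unfolding prod[symmetric]
  proof (rule prod_mono)
    fix k
    show "0 \<le> w (Suc k) x / w k x \<and> w (Suc k) x / w k x \<le> exp (w (Suc k) x / w k x - 1)"
      using exp_ge_add_one_self[of "w (Suc k) x / w k x - 1"] w_pos[of k x] w_pos[of "Suc k" x] by auto
  qed
  also have "\<dots> = exp ?R" by (simp add: exp_sum)
  finally have "w p x \<le> W * exp ?R" using W_pos by (simp add: divide_le_eq mult.commute)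
  then have "sqrt (w p x) \<le> sqrt (W * exp ?R)" by simp
  also have "\<dots> = sqrt W * exp (?R / 2)"
    using W_pos by (intro real_sqrt_unique) (auto simp: power_mult_distrib exp_double[symmetric])
  finally have "sqrt (w p x) * exp (- ?R / 2) \<le> sqrt W * exp (?R / 2) * exp (- ?R / 2)"
    by (intro mult_right_mono) auto
  then have s: "sqrt (w p x) * exp (- ?R / 2) \<le> sqrt W"
    by (simp add: mult.assoc exp_add[symmetric])
  have "1 - ?R / 2 \<le> exp (- ?R / 2)"
    using exp_ge_add_one_self[of "- ?R / 2"] by simp
  then have "w p x * (1 - ?R / 2) \<le> w p x * exp (- ?R / 2)"
    using w_pos[of p x] by (intro mult_left_mono) auto
  also have "\<dots> = sqrt (w p x) * (sqrt (w p x) * exp (- ?R / 2))"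
    using w_pos[of p x] by (simp add: mult.assoc[symmetric])
  also have "\<dots> \<le> sqrt (w p x) * sqrt W"
    using s w_pos[of p x] by (intro mult_left_mono) auto
  finally show ?thesis .
qed

lemma nn_integral_abs_diff:
  assumes t: "0 < t"
  shows "(\<integral>\<^sup>+x. ennreal \<bar>w p x - W\<bar> \<partial>G p)
    \<le> ennreal (t * W + c / t * (\<Sum>k<p. \<Sum>S\<in>Pow ({..<p} - {k}). D k S))"
proof -
  interpret Gp: prob_space "G p" by (rule prob_space_PiM) unfold_locales
  let ?S = "\<lambda>x. \<Sum>k<p. w p x * (w (Suc k) x / w k x)"
  let ?DD = "\<Sum>k<p. \<Sum>S\<in>Pow ({..<p} - {k}). D k S"
  \<comment> \<open>The lower bound on the affinity has negative terms. Moving them to the left as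
    \<open>?a * w p x\<close> keeps both sides nonnegative, as the extended integral requires; after
    integration both sides contain \<open>?a * W\<close>, which cancels.\<close>
  let ?a = "(1 + real p) / t"
  have DD: "0 \<le> ?DD" by (intro sum_nonneg D_nonneg) auto
  have pw: "\<bar>w p x - W\<bar> + ?a * w p x \<le> (t / 2) * w p x + (t / 2 + 1 / t) * W + (1 / t) * ?S x" for x
  proof -
    have "\<bar>w p x - W\<bar> \<le> t / 2 * (w p x + W) + (w p x + W - 2 * (sqrt (w p x) * sqrt W)) / t"
      using abs_diff_squares_le[of "sqrt (w p x)" "sqrt W" t] t w_pos[of p x] W_pos by simp
    also have "\<dots> \<le> t / 2 * (w p x + W) + (w p x + W - 2 * (w p x * (1 - (\<Sum>k<p. w (Suc k) x / w k x - 1) / 2))) / t"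
      using sqrt_w_ge[of x] t by (intro add_left_mono divide_right_mono) auto
    also have "w p x + W - 2 * (w p x * (1 - (\<Sum>k<p. w (Suc k) x / w k x - 1) / 2))
        = W + ?S x - (1 + real p) * w p x"
    proof -
      have "(\<Sum>k<p. w (Suc k) x / w k x - 1) = (\<Sum>k<p. w (Suc k) x / w k x) - real p"
        by (simp add: sum_subtractf)
      moreover have "?S x = w p x * (\<Sum>k<p. w (Suc k) x / w k x)"
        by (simp add: sum_distrib_left)
      moreover have "a + W - 2 * (a * (1 - (X - q) / 2)) = W + a * X - (1 + q) * a" for a X q :: real
        by (simp add: field_simps)
      ultimately show ?thesis by (simp only:)
    qed
    finally show ?thesis by (simp add: algebra_simps add_divide_distrib diff_divide_distrib)
  qed
  have S0: "0 \<le> w p x * (w (Suc k) x / w k x)" for x k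
    using w_pos[of p x] w_pos[of k x] w_pos[of "Suc k" x] by auto
  have "(\<integral>\<^sup>+x. ennreal \<bar>w p x - W\<bar> \<partial>G p) + ennreal (?a * W)
     = (\<integral>\<^sup>+x. ennreal \<bar>w p x - W\<bar> + ennreal ?a * ennreal (w p x) \<partial>G p)"
  proof -
    have "ennreal (?a * W) = ennreal ?a * ennreal W" using t W_pos by (intro ennreal_mult) auto
    then show ?thesis by (simp add: nn_integral_add nn_integral_cmult nn_integral_w)
  qed
  also have "\<dots> \<le> (\<integral>\<^sup>+x. ennreal (t / 2) * ennreal (w p x) + ennreal ((t / 2 + 1 / t) * W)
        + ennreal (1 / t) * (\<Sum>k<p. ennreal (w p x) * ennreal (w (Suc k) x / w k x)) \<partial>G p)"
  proof (intro nn_integral_mono)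
    fix x
    have "ennreal \<bar>w p x - W\<bar> + ennreal ?a * ennreal (w p x) = ennreal (\<bar>w p x - W\<bar> + ?a * w p x)"
      using t w_pos[of p x] by (simp add: ennreal_mult[symmetric] ennreal_plus[symmetric] del: ennreal_plus)
    also have "\<dots> \<le> ennreal ((t / 2) * w p x + (t / 2 + 1 / t) * W + (1 / t) * ?S x)"
      by (rule ennreal_leI[OF pw])
    also have "\<dots> = ennreal ((t / 2) * w p x) + ennreal ((t / 2 + 1 / t) * W) + ennreal ((1 / t) * ?S x)"
      using t w_pos[of p x] W_pos S0[of x] by (simp add: ennreal_plus sum_nonneg)
    also have "ennreal ((1 / t) * ?S x) = ennreal (1 / t) * (\<Sum>k<p. ennreal (w p x * (w (Suc k) x / w k x)))"
    proof -
      have "ennreal ((1 / t) * ?S x) = ennreal (1 / t) * ennreal (?S x)"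
        using t by (intro ennreal_mult sum_nonneg S0) auto
      also have "ennreal (?S x) = (\<Sum>k<p. ennreal (w p x * (w (Suc k) x / w k x)))"
        by (intro sum_ennreal[symmetric] S0)
      finally show ?thesis .
    qed
    also have "(\<Sum>k<p. ennreal (w p x * (w (Suc k) x / w k x)))
       = (\<Sum>k<p. ennreal (w p x) * ennreal (w (Suc k) x / w k x))"
      using w_pos by (intro sum.cong refl ennreal_mult) (auto simp: less_imp_le)
    also have "ennreal ((t / 2) * w p x) = ennreal (t / 2) * ennreal (w p x)"
      using t w_pos[of p x] by (intro ennreal_mult) auto
    finally show "ennreal \<bar>w p x - W\<bar> + ennreal ?a * ennreal (w p x)
      \<le> ennreal (t / 2) * ennreal (w p x) + ennreal ((t / 2 + 1 / t) * W)
        + ennreal (1 / t) * (\<Sum>k<p. ennreal (w p x) * ennreal (w (Suc k) x / w k x))" .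
  qed
  also have "\<dots> = ennreal (t / 2) * ennreal W + ennreal ((t / 2 + 1 / t) * W)
      + ennreal (1 / t) * (\<Sum>k<p. (\<integral>\<^sup>+x. ennreal (w p x) * ennreal (w (Suc k) x / w k x) \<partial>G p))"
  proof -
    have m [measurable]: "(\<lambda>x. ennreal (w p x) * ennreal (w (Suc k) x / w k x)) \<in> borel_measurable (G p)"
      if "k \<in> {..<p}" for k
    proof -
      have [measurable]: "w (Suc k) \<in> borel_measurable (G p)" "w k \<in> borel_measurable (G p)"
        using that by (auto intro: w_measurable)
      show ?thesis by measurable
    qed
    have "(\<lambda>x. \<Sum>k<p. ennreal (w p x) * ennreal (w (Suc k) x / w k x)) \<in> borel_measurable (G p)"
      by (intro borel_measurable_sum m)
    moreover have "(\<integral>\<^sup>+x. (\<Sum>k<p. ennreal (w p x) * ennreal (w (Suc k) x / w k x)) \<partial>G p)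
        = (\<Sum>k<p. (\<integral>\<^sup>+x. ennreal (w p x) * ennreal (w (Suc k) x / w k x) \<partial>G p))"
      by (intro nn_integral_sum m)
    ultimately show ?thesis
      by (simp add: nn_integral_add nn_integral_cmult nn_integral_w Gp.emeasure_space_1)
  qed
  also have "\<dots> \<le> ennreal (t / 2) * ennreal W + ennreal ((t / 2 + 1 / t) * W)
      + ennreal (1 / t) * (\<Sum>k<p. ennreal (W + c * (\<Sum>S\<in>Pow ({..<p} - {k}). D k S)))"
    by (intro add_left_mono mult_left_mono sum_mono nn_integral_step) auto
  also have "\<dots> = ennreal (t / 2 * W + (t / 2 + 1 / t) * W + 1 / t * (\<Sum>k<p. W + c * (\<Sum>S\<in>Pow ({..<p} - {k}). D k S)))"
  proof -
    have "0 \<le> W + c * (\<Sum>S\<in>Pow ({..<p} - {k}). D k S)" if "k < p" for k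
      using that W_pos c_nonneg D_nonneg[OF that] by (intro add_nonneg_nonneg mult_nonneg_nonneg sum_nonneg) auto
    then have "(\<Sum>k<p. ennreal (W + c * (\<Sum>S\<in>Pow ({..<p} - {k}). D k S)))
          = ennreal (\<Sum>k<p. W + c * (\<Sum>S\<in>Pow ({..<p} - {k}). D k S))"
      and "0 \<le> (\<Sum>k<p. W + c * (\<Sum>S\<in>Pow ({..<p} - {k}). D k S))"
      by (auto intro!: sum_ennreal sum_nonneg)
    then show ?thesis
      using t W_pos by (simp add: ennreal_mult[symmetric] ennreal_plus[symmetric] del: ennreal_plus)
  qed
  also have "t / 2 * W + (t / 2 + 1 / t) * W + 1 / t * (\<Sum>k<p. W + c * (\<Sum>S\<in>Pow ({..<p} - {k}). D k S))
     = (t * W + c / t * ?DD) + ?a * W"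
    using t by (simp add: sum.distrib sum_distrib_left[symmetric] field_simps)
  also have "ennreal \<dots> = ennreal (t * W + c / t * ?DD) + ennreal (?a * W)"
    using t W_pos c_nonneg DD by (intro ennreal_plus) auto
  finally show ?thesis by (simp add: ennreal_add_left_cancel_le add.commute[of _ "ennreal (?a * W)"])
qed

lemma mixture_approx:
  assumes t: "0 < t" and [measurable]: "A \<in> sets (G p)"
  shows "ennreal W * emeasure (G p) A
    \<le> (\<Sum>S\<in>Pow {..<p}. ennreal (C S) * emeasure (density (G p) (\<lambda>x. ennreal (\<Prod>i\<in>S. l (x i)))) A)
      + ennreal (t * W + c / t * (\<Sum>k<p. \<Sum>S\<in>Pow ({..<p} - {k}). D k S))"
proof -
  have lik: "(\<Prod>i\<in>S. l (x i)) = likelihood p S x" if "S \<in> Pow {..<p}" for S x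
    using that by (auto simp: likelihood_def intro!: prod.cong)
  have "ennreal W * emeasure (G p) A = (\<integral>\<^sup>+x. ennreal W * indicator A x \<partial>G p)"
    by (simp add: nn_integral_cmult)
  also have "\<dots> \<le> (\<integral>\<^sup>+x. ennreal (w p x) * indicator A x + ennreal \<bar>w p x - W\<bar> \<partial>G p)"
    using less_imp_le[OF w_pos] W_pos
    by (intro nn_integral_mono)
       (auto simp: ennreal_plus[symmetric] simp del: ennreal_plus split: split_indicator intro!: ennreal_leI)
  also have "\<dots> = (\<integral>\<^sup>+x. ennreal (w p x) * indicator A x \<partial>G p) + (\<integral>\<^sup>+x. ennreal \<bar>w p x - W\<bar> \<partial>G p)"
    by (intro nn_integral_add) auto
  also have "(\<integral>\<^sup>+x. ennreal (w p x) * indicator A x \<partial>G p)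
     = (\<integral>\<^sup>+x. (\<Sum>S\<in>Pow {..<p}. ennreal (C S) * (ennreal (likelihood p S x) * indicator A x)) \<partial>G p)"
    unfolding w_def
    by (intro nn_integral_cong, subst ennreal_sum_mult)
       (auto simp: sum_distrib_right C_pos likelihood_pos less_imp_le mult.assoc)
  also have "\<dots> = (\<Sum>S\<in>Pow {..<p}. ennreal (C S) * emeasure (density (G p) (\<lambda>x. ennreal (\<Prod>i\<in>S. l (x i)))) A)"
  proof -
    have "density (G p) (\<lambda>x. ennreal (\<Prod>i\<in>S. l (x i))) = density (G p) (\<lambda>x. ennreal (likelihood p S x))"
      if "S \<in> Pow {..<p}" for S
      by (simp add: lik[OF that])
    then show ?thesis
      by (subst nn_integral_sum) (auto simp: nn_integral_cmult emeasure_density intro!: sum.cong)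
  qed
  finally show ?thesis
    using nn_integral_abs_diff[OF t] by (auto intro: order_trans add_left_mono)
qed

end

section \<open>Product densities and sparse mean vectors\<close>

text \<open>Compared on boxes, where the indicator is a product as well; the product measure is
  determined by its values there.\<close>

lemma PiM_density:
  fixes N :: "'i \<Rightarrow> 'a measure"
  assumes I: "finite I" and N: "product_sigma_finite N"
    and prob: "\<And>i. prob_space (density (N i) (f i))"
    and f [measurable]: "\<And>i. f i \<in> borel_measurable (N i)"
  shows "Pi\<^sub>M I (\<lambda>i. density (N i) (f i)) = density (Pi\<^sub>M I N) (\<lambda>x. \<Prod>i\<in>I. f i (x i))"
proof -
  interpret N: product_sigma_finite N by (rule N)
  interpret D: product_sigma_finite "\<lambda>i. density (N i) (f i)"
    unfolding product_sigma_finite_def using prob by (auto intro: prob_space_imp_sigma_finite)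
  have [measurable]: "(\<lambda>x. \<Prod>i\<in>I. f i (x i)) \<in> borel_measurable (Pi\<^sub>M I N)"
  proof (rule borel_measurable_prod_ennreal)
    fix i assume "i \<in> I"
    then have "(\<lambda>x. x i) \<in> Pi\<^sub>M I N \<rightarrow>\<^sub>M N i" by (rule measurable_component_singleton)
    then show "(\<lambda>x. f i (x i)) \<in> borel_measurable (Pi\<^sub>M I N)" by (rule measurable_compose[OF _ f])
  qed
  show ?thesis
  proof (rule D.PiM_eqI[symmetric, OF I])
    show "sets (density (Pi\<^sub>M I N) (\<lambda>x. \<Prod>i\<in>I. f i (x i))) = sets (Pi\<^sub>M I (\<lambda>i. density (N i) (f i)))"
      by (auto intro!: sets_PiM_cong)
    fix A assume A: "\<And>i. i \<in> I \<Longrightarrow> A i \<in> sets (density (N i) (f i))"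
    then have A': "A i \<in> sets (N i)" if "i \<in> I" for i using that by simp
    have PA: "Pi\<^sub>E I A \<in> sets (Pi\<^sub>M I N)" using A' I by (intro sets_PiM_I_finite) auto
    have "emeasure (density (Pi\<^sub>M I N) (\<lambda>x. \<Prod>i\<in>I. f i (x i))) (Pi\<^sub>E I A)
       = (\<integral>\<^sup>+x. (\<Prod>i\<in>I. f i (x i)) * indicator (Pi\<^sub>E I A) x \<partial>Pi\<^sub>M I N)"
      using PA by (simp add: emeasure_density)
    also have "\<dots> = (\<integral>\<^sup>+x. (\<Prod>i\<in>I. f i (x i) * indicator (A i) (x i)) \<partial>Pi\<^sub>M I N)"
    proof (rule nn_integral_cong)
      fix x assume x: "x \<in> space (Pi\<^sub>M I N)"
      have "indicator (Pi\<^sub>E I A) x = (\<Prod>i\<in>I. indicator (A i) (x i) :: ennreal)"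
      proof (cases "x \<in> Pi\<^sub>E I A")
        case True
        then show ?thesis by (auto simp: PiE_def Pi_def intro!: prod.neutral[symmetric])
      next
        case False
        then obtain i where "i \<in> I" "x i \<notin> A i"
          using x by (auto simp: space_PiM PiE_def Pi_def extensional_def)
        then have "(\<Prod>i\<in>I. indicator (A i) (x i) :: ennreal) = 0"
          using I by (intro prod_zero bexI[of _ i]) auto
        then show ?thesis using False by simp
      qed
      then show "(\<Prod>i\<in>I. f i (x i)) * indicator (Pi\<^sub>E I A) x = (\<Prod>i\<in>I. f i (x i) * indicator (A i) (x i))"
        by (simp add: prod.distrib)
    qed
    also have "\<dots> = (\<Prod>i\<in>I. (\<integral>\<^sup>+y. f i y * indicator (A i) y \<partial>N i))"
      by (rule N.product_nn_integral_prod[OF I]) (use A' in measurable)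
    also have "\<dots> = (\<Prod>i\<in>I. emeasure (density (N i) (f i)) (A i))"
      using A' by (intro prod.cong refl) (simp add: emeasure_density)
    finally show "emeasure (density (Pi\<^sub>M I N) (\<lambda>x. \<Prod>i\<in>I. f i (x i))) (Pi\<^sub>E I A)
        = (\<Prod>i\<in>I. emeasure (density (N i) (f i)) (A i))" .
  qed
qed

section \<open>Sparse shifts of the standard normal law\<close>

definition spike :: "real \<Rightarrow> nat set \<Rightarrow> nat \<Rightarrow> real" where
  "spike s S i = (if i \<in> S then s else 0)"

definition std_normal_measure :: "real measure" where
  "std_normal_measure = density lborel (\<lambda>x. ennreal (normal_density 0 1 x))"

lemma normal_density_shift:
  "normal_density s 1 y = normal_density 0 1 y * exp (s * y - s\<^sup>2 / 2)"
proof -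
  have "exp (- (y - s)\<^sup>2 / 2) = exp (- y\<^sup>2 / 2) * exp (s * y - s\<^sup>2 / 2)"
    unfolding exp_add[symmetric] by (simp add: power2_eq_square field_simps)
  then show ?thesis by (simp add: normal_density_def)
qed

lemma product_sigma_finite_lborel: "product_sigma_finite (\<lambda>_. lborel :: 'a :: euclidean_space measure)"
  by standard

text \<open>With identity covariance a sparse shift contributes one likelihood factor for each
  coordinate of its support. This product form is what \<open>coordinate_mixture\<close> asks for,
  and the reason to remove the precision matrix from the test law.\<close>

lemma mvn_precision_one_eq:
  assumes S: "S \<subseteq> {..<p}"
  shows "mvn_precision p (spike s S) (1\<^sub>m p)
    = density (Pi\<^sub>M {..<p} (\<lambda>_. std_normal_measure)) (\<lambda>x. ennreal (\<Prod>i\<in>S. exp (s * x i - s\<^sup>2 / 2)))"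
proof -
  have G: "Pi\<^sub>M {..<p} (\<lambda>_. std_normal_measure)
      = density (Pi\<^sub>M {..<p} (\<lambda>_. lborel)) (\<lambda>x. \<Prod>i<p. ennreal (normal_density 0 1 (x i)))"
    unfolding std_normal_measure_def
    by (rule PiM_density) (auto intro: product_sigma_finite_lborel prob_space_normal_density)
  have m: "(\<lambda>x. ennreal (\<Prod>i\<in>S. exp (s * x i - s\<^sup>2 / 2))) \<in> borel_measurable (Pi\<^sub>M {..<p} (\<lambda>_. lborel))"
  proof -
    have "(\<lambda>x. exp (s * x i - s\<^sup>2 / 2)) \<in> borel_measurable (Pi\<^sub>M {..<p} (\<lambda>_. lborel))" if "i \<in> S" for i
    proof -
      have [measurable]: "(\<lambda>x. x i) \<in> borel_measurable (Pi\<^sub>M {..<p} (\<lambda>_. lborel :: real measure))"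
        using measurable_component_singleton[of i "{..<p}" "\<lambda>_. lborel :: real measure"] that S by auto
      show ?thesis by measurable
    qed
    then show ?thesis
      by (intro measurable_compose[OF _ measurable_ennreal] borel_measurable_prod)
  qed
  have "(\<Prod>i<p. ennreal (normal_density 0 1 (x i))) * ennreal (\<Prod>i\<in>S. exp (s * x i - s\<^sup>2 / 2))
      = ennreal (gauss_density p (1\<^sub>m p) (spike s S) x)" for x
  proof -
    have "(\<Prod>i\<in>S. exp (s * x i - s\<^sup>2 / 2)) = (\<Prod>i<p. if i \<in> S then exp (s * x i - s\<^sup>2 / 2) else 1)"
      using S by (subst prod.inter_restrict[symmetric]) (auto intro!: prod.cong)
    then have "(\<Prod>i<p. normal_density 0 1 (x i)) * (\<Prod>i\<in>S. exp (s * x i - s\<^sup>2 / 2))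
       = gauss_density p (1\<^sub>m p) (spike s S) x"
      unfolding gauss_density_one
      by (simp add: prod.distrib[symmetric]) (intro prod.cong, auto simp: spike_def normal_density_shift[of s])
    then show ?thesis
      by (simp add: prod_ennreal ennreal_mult'' prod_nonneg flip: ennreal_mult')
  qed
  then show ?thesis
    unfolding mvn_precision_eq[OF pos_def_mat_one] G
    by (subst density_density_eq) (use m in auto)
qed

lemma coordinate_mixture_normal:
  assumes "\<And>S. S \<subseteq> {..<p} \<Longrightarrow> 0 < C S"
  shows "coordinate_mixture std_normal_measure (\<lambda>y. exp (s * y - s\<^sup>2 / 2)) (exp (s\<^sup>2) - 1) p C"
proof -
  interpret prob_space std_normal_measure
    unfolding std_normal_measure_def by (rule prob_space_normal_density) simp
  have int: "(\<integral>\<^sup>+y. ennreal (normal_density m 1 y) \<partial>lborel) = 1" for m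
    using prob_space.emeasure_space_1[OF prob_space_normal_density[of 1 m]]
    by (simp add: emeasure_density)
  show ?thesis
  proof unfold_locales
    show "(\<lambda>y. exp (s * y - s\<^sup>2 / 2)) \<in> borel_measurable std_normal_measure"
      unfolding std_normal_measure_def by simp
    show "(\<integral>\<^sup>+y. ennreal (exp (s * y - s\<^sup>2 / 2)) \<partial>std_normal_measure) = 1"
      unfolding std_normal_measure_def
      by (subst nn_integral_density) (auto simp: ennreal_mult[symmetric] normal_density_shift[of s, symmetric] int)
    \<comment> \<open>Squaring the likelihood ratio doubles the mean and leaves the factor
      \<open>exp (s\<^sup>2)\<close>, hence \<open>c = exp (s\<^sup>2) - 1\<close>, the same for
      both signs of \<open>s\<close>.\<close>
    have "normal_density 0 1 y * (exp (s * y - s\<^sup>2 / 2))\<^sup>2 = exp (s\<^sup>2) * normal_density (2 * s) 1 y" for y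
      unfolding normal_density_shift[of "2 * s"]
      by (simp add: power2_eq_square exp_add[symmetric] mult.assoc mult.left_commute[of "exp _"])
    then have "(\<integral>\<^sup>+y. ennreal ((exp (s * y - s\<^sup>2 / 2))\<^sup>2) \<partial>std_normal_measure)
       = (\<integral>\<^sup>+y. ennreal (exp (s\<^sup>2)) * ennreal (normal_density (2 * s) 1 y) \<partial>lborel)"
      unfolding std_normal_measure_def
      by (subst nn_integral_density) (auto simp: ennreal_mult[symmetric])
    then show "(\<integral>\<^sup>+y. ennreal ((exp (s * y - s\<^sup>2 / 2))\<^sup>2) \<partial>std_normal_measure) = ennreal (1 + (exp (s\<^sup>2) - 1))"
      by (simp add: nn_integral_cmult int)
  qed (use assms in auto)
qed

text \<open>The probability that \<open>S\<close> is the random subset of \<open>A\<close> that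
  keeps each element independently with probability \<open>e\<close>.\<close>

definition subset_weight :: "real \<Rightarrow> nat set \<Rightarrow> nat set \<Rightarrow> real" where
  "subset_weight e A S = e ^ card S * (1 - e) ^ card (A - S)"

lemma sum_subset_weight:
  assumes "finite A"
  shows "(\<Sum>S\<in>Pow A. subset_weight e A S) = 1"
  using prod_add[OF assms, of "\<lambda>_. e" "\<lambda>_. 1 - e"] by (simp add: subset_weight_def)

lemma subset_weight_pos: "0 < e \<Longrightarrow> e < 1 \<Longrightarrow> 0 < subset_weight e A S"
  by (simp add: subset_weight_def)

lemma subset_weight_insert:
  assumes "finite A" "k \<in> A" "S \<subseteq> A - {k}"
  shows "subset_weight e A (insert k S) = e * subset_weight e (A - {k}) S"
    and "subset_weight e A S = (1 - e) * subset_weight e (A - {k}) S"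
proof -
  have S: "finite S" "k \<notin> S" using assms finite_subset by auto
  have "A - insert k S = A - {k} - S" by auto
  then show "subset_weight e A (insert k S) = e * subset_weight e (A - {k}) S"
    using S by (simp add: subset_weight_def)
  have "A - S = insert k (A - {k} - S)" using assms S by auto
  then have "card (A - S) = Suc (card (A - {k} - S))" using assms by simp
  then show "subset_weight e A S = (1 - e) * subset_weight e (A - {k}) S"
    by (simp add: subset_weight_def)
qed

section \<open>Testing the label when the mean is unknown\<close>

text \<open>The labels and the precision matrix are frozen; only the support of the mean and the
  features stay random. The threshold is that of the determinant bound, and it also controls the
  diagonal; \<open>e < 1\<close> keeps the prior odds finite.\<close>

locale two_class =
  fixes p n :: nat and ys :: "nat \<Rightarrow> bool" and \<Omega> :: "real mat" and e \<tau> :: real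
  assumes Omega: "pos_def_mat p \<Omega>"
    and dev_le: "(\<Sum>i<p. \<Sum>j<p. (dev_entries \<Omega> i j)\<^sup>2) \<le> 1 / 64"
    and e: "0 < e" "e < 1"
begin

definition prec :: "nat \<Rightarrow> real mat" where
  "prec i = (if ys i then \<Omega> else 1\<^sub>m p)"

definition shift :: "nat \<Rightarrow> real" where
  "shift i = (if ys i then \<tau> else - \<tau>)"

abbreviation lebesgue_p :: "(nat \<Rightarrow> real) measure" where
  "lebesgue_p \<equiv> Pi\<^sub>M {..<p} (\<lambda>_. lborel)"

abbreviation N :: "(nat \<Rightarrow> nat \<Rightarrow> real) measure" where
  "N \<equiv> Pi\<^sub>M {..<n} (\<lambda>_. lebesgue_p)"

abbreviation G :: "(nat \<Rightarrow> real) measure" where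
  "G \<equiv> Pi\<^sub>M {..<p} (\<lambda>_. std_normal_measure)"

definition g :: "nat set \<Rightarrow> (nat \<Rightarrow> nat \<Rightarrow> real) \<Rightarrow> real" where
  "g S T = (\<Prod>i<n. gauss_density p (prec i) (spike (shift i) S) (T i))"

definition train :: "nat set \<Rightarrow> (nat \<Rightarrow> nat \<Rightarrow> real) measure" where
  "train S = Pi\<^sub>M {..<n} (\<lambda>i. mvn_precision p (spike (shift i) S) (prec i))"

abbreviation \<pi>' :: "nat set \<Rightarrow> real" where
  "\<pi>' \<equiv> subset_weight e {..<p}"

definition train_mix :: "(nat \<Rightarrow> nat \<Rightarrow> real) measure" where
  "train_mix = density N (\<lambda>T. ennreal (\<Sum>S\<in>Pow {..<p}. \<pi>' S * g S T))"

lemma prec_pos_def: "pos_def_mat p (prec i)"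
  by (simp add: prec_def Omega pos_def_mat_one)

lemma product_sigma_finite_lebesgue_p: "product_sigma_finite (\<lambda>_::nat. lebesgue_p)"
proof -
  interpret product_sigma_finite "\<lambda>_::nat. lborel :: real measure"
    by (rule product_sigma_finite_lborel)
  show ?thesis unfolding product_sigma_finite_def using sigma_finite by auto
qed

lemma g_measurable [measurable]: "g S \<in> borel_measurable N"
  unfolding g_def
proof (rule borel_measurable_prod)
  fix i assume "i \<in> {..<n}"
  then have "(\<lambda>T. T i) \<in> N \<rightarrow>\<^sub>M lebesgue_p" by (rule measurable_component_singleton)
  then show "(\<lambda>T. gauss_density p (prec i) (spike (shift i) S) (T i)) \<in> borel_measurable N"
    by (rule measurable_compose[OF _ gauss_density_measurable])
qed

lemma g_pos: "0 < g S T"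
  unfolding g_def by (intro prod_pos) (simp add: gauss_density_pos prec_pos_def)

lemma train_eq: "train S = density N (\<lambda>T. ennreal (g S T))"
proof -
  have "train S = density N (\<lambda>T. \<Prod>i<n. ennreal (gauss_density p (prec i) (spike (shift i) S) (T i)))"
    unfolding train_def mvn_precision_eq[OF prec_pos_def]
    by (rule PiM_density)
       (auto intro: product_sigma_finite_lebesgue_p prob_space_mvn_precision[OF prec_pos_def]
         simp: mvn_precision_eq[OF prec_pos_def, symmetric])
  also have "\<dots> = density N (\<lambda>T. ennreal (g S T))"
    by (simp add: g_def prod_ennreal gauss_density_pos prec_pos_def less_imp_le)
  finally show ?thesis .
qed

lemma prob_space_train: "prob_space (train S)"
  unfolding train_def by (intro prob_space_PiM prob_space_mvn_precision prec_pos_def)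

lemma nn_integral_g: "(\<integral>\<^sup>+T. ennreal (g S T) \<partial>N) = 1"
  using prob_space.emeasure_space_1[OF prob_space_train[of S]]
  unfolding train_eq by (simp add: emeasure_density)

section \<open>Second moments of the training likelihood\<close>

lemma prec_diag_le: "k < p \<Longrightarrow> prec i $$ (k, k) \<le> 2"
proof (cases "ys i")
  case True
  assume k: "k < p"
  have "(dev_entries \<Omega> k k)\<^sup>2 \<le> (\<Sum>j<p. (dev_entries \<Omega> k j)\<^sup>2)"
    using k by (intro member_le_sum) auto
  also have "\<dots> \<le> (\<Sum>i<p. \<Sum>j<p. (dev_entries \<Omega> i j)\<^sup>2)"
    using k by (intro member_le_sum[of k _ "\<lambda>i. \<Sum>j<p. (dev_entries \<Omega> i j)\<^sup>2"] sum_nonneg) auto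
  also have "\<dots> \<le> 1 / 64" by (rule dev_le)
  finally have "(dev_entries \<Omega> k k)\<^sup>2 \<le> 1\<^sup>2" by simp
  then have "\<bar>dev_entries \<Omega> k k\<bar> \<le> 1" by (simp add: abs_square_le_1)
  then show ?thesis using True by (simp add: dev_entries_def mat_entries_def prec_def)
qed (simp add: prec_def)

text \<open>Once the rest of the support is known, the chi-square distance for adding
  \<open>k\<close> factors over the samples, and each sample contributes its diagonal entry times
  \<tau> squared. The sign of the shift disappears in the square, so both classes are treated alike;
  the 2 in the exponent is the crude diagonal bound.\<close>

lemma nn_integral_g_ratio:
  assumes k: "k < p" "k \<notin> S"
  shows "(\<integral>\<^sup>+T. ennreal ((g (insert k S) T)\<^sup>2 / g S T) \<partial>N) \<le> ennreal (exp (2 * real n * \<tau>\<^sup>2))"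
proof -
  interpret product_sigma_finite "\<lambda>_::nat. lebesgue_p"
    by (rule product_sigma_finite_lebesgue_p)
  let ?d = "\<lambda>i m. gauss_density p (prec i) m"
  define q where "q = (\<lambda>i y. exp ((shift i)\<^sup>2 * prec i $$ (k, k)) * ?d i ((spike (shift i) S)(k := 2 * shift i)) y)"
  have q: "(?d i (spike (shift i) (insert k S)) y)\<^sup>2 / ?d i (spike (shift i) S) y = q i y" for i y
  proof -
    have "spike (shift i) (insert k S) = (spike (shift i) S)(k := spike (shift i) S k + shift i)"
      using k by (auto simp: spike_def fun_eq_iff)
    moreover have "(spike (shift i) S)(k := spike (shift i) S k + 2 * shift i) = (spike (shift i) S)(k := 2 * shift i)"
      using k by (auto simp: spike_def)
    ultimately show ?thesis
      using gauss_density_shift_ratio[OF prec_pos_def k(1), of i "spike (shift i) S" "shift i" y]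
      by (simp add: q_def)
  qed
  have qpos: "0 \<le> q i y" for i y
    by (simp add: q_def gauss_density_pos[OF prec_pos_def] less_imp_le)
  have "(g (insert k S) T)\<^sup>2 / g S T = (\<Prod>i<n. q i (T i))" for T
    unfolding g_def prod_power_distrib prod_dividef[symmetric] q ..
  then have "(\<integral>\<^sup>+T. ennreal ((g (insert k S) T)\<^sup>2 / g S T) \<partial>N) = (\<integral>\<^sup>+T. (\<Prod>i<n. ennreal (q i (T i))) \<partial>N)"
    by (simp add: prod_ennreal qpos)
  also have "\<dots> = (\<Prod>i<n. (\<integral>\<^sup>+y. ennreal (q i y) \<partial>lebesgue_p))"
    by (rule product_nn_integral_prod) (auto simp: q_def)
  also have "\<dots> = (\<Prod>i<n. ennreal (exp ((shift i)\<^sup>2 * prec i $$ (k, k))))"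
    unfolding q_def
    by (intro prod.cong refl)
       (simp add: ennreal_mult gauss_density_pos[OF prec_pos_def] less_imp_le nn_integral_cmult
         nn_integral_gauss_density[OF prec_pos_def])
  also have "\<dots> = ennreal (exp (\<Sum>i<n. (shift i)\<^sup>2 * prec i $$ (k, k)))"
    by (simp add: prod_ennreal exp_sum)
  also have "\<dots> \<le> ennreal (exp (2 * real n * \<tau>\<^sup>2))"
  proof -
    have "(shift i)\<^sup>2 * prec i $$ (k, k) \<le> \<tau>\<^sup>2 * 2" for i
      using mult_left_mono[OF prec_diag_le[OF k(1), of i], of "\<tau>\<^sup>2"] by (simp add: shift_def)
    then have "(\<Sum>i<n. (shift i)\<^sup>2 * prec i $$ (k, k)) \<le> of_nat (card {..<n}) * (\<tau>\<^sup>2 * 2)"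
      by (intro sum_bounded_above)
    then show ?thesis by (simp add: mult_ac)
  qed
  finally show ?thesis .
qed

text \<open>The first entry comes from bounding a posterior probability by 1, the second from
  bounding it by the posterior odds, whose mean is a chi-square moment of the training
  likelihood.\<close>

definition post_bound :: real where
  "post_bound = min e (e\<^sup>2 / (1 - e) * exp (2 * real n * \<tau>\<^sup>2))"

lemma post_bound_nonneg: "0 \<le> post_bound"
  using e by (simp add: post_bound_def)

text \<open>
  The integrand is the joint probability of \<open>S \<union> {k}\<close> and the data times the posterior probability that
  coordinate \<open>k\<close> is nonzero, given the data and all other coordinates.
\<close>

lemma nn_integral_post:
  assumes k: "k < p" and S: "S \<in> Pow ({..<p} - {k})"
  defines "c0 \<equiv> \<lambda>T. \<pi>' S * g S T" and "c1 \<equiv> \<lambda>T. \<pi>' (insert k S) * g (insert k S) T"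
  shows "(\<integral>\<^sup>+T. ennreal ((c1 T)\<^sup>2 / (c0 T + c1 T)) \<partial>N)
    \<le> ennreal (post_bound * subset_weight e ({..<p} - {k}) S)"
proof -
  let ?w = "subset_weight e ({..<p} - {k}) S"
  have w: "0 < ?w" using e by (rule subset_weight_pos)
  have pi1: "\<pi>' (insert k S) = e * ?w" and pi0: "\<pi>' S = (1 - e) * ?w"
    using k S by (intro subset_weight_insert; auto)+
  have pos: "0 < c0 T" "0 < c1 T" for T
    unfolding c0_def c1_def using e by (auto intro!: mult_pos_pos subset_weight_pos g_pos)
  have "(\<integral>\<^sup>+T. ennreal ((c1 T)\<^sup>2 / (c0 T + c1 T)) \<partial>N) \<le> (\<integral>\<^sup>+T. ennreal (e * ?w) * ennreal (g (insert k S) T) \<partial>N)"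
  proof (intro nn_integral_mono)
    fix T
    have "(c1 T)\<^sup>2 / (c0 T + c1 T) \<le> c1 T"
      using pos[of T] by (simp add: divide_le_eq power2_eq_square)
    also have "\<dots> = e * ?w * g (insert k S) T" by (simp add: c1_def pi1)
    finally show "ennreal ((c1 T)\<^sup>2 / (c0 T + c1 T)) \<le> ennreal (e * ?w) * ennreal (g (insert k S) T)"
      using e w by (simp add: ennreal_mult[symmetric] less_imp_le[OF g_pos] ennreal_leI)
  qed
  then have 1: "(\<integral>\<^sup>+T. ennreal ((c1 T)\<^sup>2 / (c0 T + c1 T)) \<partial>N) \<le> ennreal (e * ?w)"
    by (simp add: nn_integral_cmult nn_integral_g)
  let ?r = "\<lambda>T. (g (insert k S) T)\<^sup>2 / g S T"
  have "(\<integral>\<^sup>+T. ennreal ((c1 T)\<^sup>2 / (c0 T + c1 T)) \<partial>N)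
      \<le> (\<integral>\<^sup>+T. ennreal (e\<^sup>2 / (1 - e) * ?w) * ennreal (?r T) \<partial>N)"
  proof (intro nn_integral_mono)
    fix T
    have "(c1 T)\<^sup>2 / (c0 T + c1 T) \<le> (c1 T)\<^sup>2 / c0 T"
      using pos[of T] by (intro divide_left_mono) auto
    also have "\<dots> = e\<^sup>2 / (1 - e) * ?w * ?r T"
      using w e by (simp add: c0_def c1_def pi0 pi1 power2_eq_square)
    finally show "ennreal ((c1 T)\<^sup>2 / (c0 T + c1 T)) \<le> ennreal (e\<^sup>2 / (1 - e) * ?w) * ennreal (?r T)"
      using e w by (simp add: ennreal_mult[symmetric] less_imp_le[OF g_pos] ennreal_leI)
  qed
  also have "\<dots> = ennreal (e\<^sup>2 / (1 - e) * ?w) * (\<integral>\<^sup>+T. ennreal (?r T) \<partial>N)"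
    by (rule nn_integral_cmult) measurable
  also have "\<dots> \<le> ennreal (e\<^sup>2 / (1 - e) * ?w) * ennreal (exp (2 * real n * \<tau>\<^sup>2))"
    using k S by (intro mult_left_mono nn_integral_g_ratio) auto
  also have "\<dots> = ennreal (e\<^sup>2 / (1 - e) * exp (2 * real n * \<tau>\<^sup>2) * ?w)"
    using e w by (simp add: ennreal_mult[symmetric] mult_ac)
  finally have 2: "(\<integral>\<^sup>+T. ennreal ((c1 T)\<^sup>2 / (c0 T + c1 T)) \<partial>N)
      \<le> ennreal (e\<^sup>2 / (1 - e) * exp (2 * real n * \<tau>\<^sup>2) * ?w)" .
  show ?thesis
    unfolding post_bound_def min_def using 1 2 by simp
qed

section \<open>Comparison with independent training and test data\<close>

definition sample_space :: "((nat \<Rightarrow> nat \<Rightarrow> real) \<times> (nat \<Rightarrow> real)) measure" where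
  "sample_space = Pi\<^sub>M {..<n} (\<lambda>_. feature_space p) \<Otimes>\<^sub>M feature_space p"

lemma sets_lebesgue_p: "sets lebesgue_p = sets (feature_space p)"
  unfolding feature_space_def by (intro sets_PiM_cong) auto

lemma sets_N: "sets N = sets (Pi\<^sub>M {..<n} (\<lambda>_. feature_space p))"
  by (intro sets_PiM_cong sets_lebesgue_p) auto

lemma sets_train: "sets (train S) = sets N"
  unfolding train_eq by simp

lemma sets_mvn: "sets (mvn_precision p m A) = sets (feature_space p)"
  unfolding feature_space_def by (rule sets_mvn_precision)

lemma sets_G: "sets G = sets (feature_space p)"
  unfolding feature_space_def by (intro sets_PiM_cong) (auto simp: std_normal_measure_def)

lemma sets_sample_space:
  "sets M1 = sets N \<Longrightarrow> sets M2 = sets (feature_space p) \<Longrightarrow> sets (M1 \<Otimes>\<^sub>M M2) = sets sample_space"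
  unfolding sample_space_def sets_N by (rule sets_pair_measure_cong)

lemma prob_space_G: "prob_space G"
  by (intro prob_space_PiM) (simp add: std_normal_measure_def prob_space_normal_density)

lemma prob_space_train_mix: "prob_space train_mix"
proof
  have "(\<integral>\<^sup>+T. ennreal (\<Sum>S\<in>Pow {..<p}. \<pi>' S * g S T) \<partial>N)
     = (\<integral>\<^sup>+T. (\<Sum>S\<in>Pow {..<p}. ennreal (\<pi>' S) * ennreal (g S T)) \<partial>N)"
    by (intro nn_integral_cong ennreal_sum_mult less_imp_le[OF g_pos] less_imp_le[OF subset_weight_pos] e)
  also have "\<dots> = (\<Sum>S\<in>Pow {..<p}. ennreal (\<pi>' S))"
    by (simp add: nn_integral_sum nn_integral_cmult nn_integral_g)
  also have "\<dots> = 1"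
    using sum_subset_weight[of "{..<p}" e]
    by (subst sum_ennreal) (auto intro!: less_imp_le[OF subset_weight_pos] e)
  finally show "emeasure train_mix (space train_mix) = 1"
    unfolding train_mix_def by (simp add: emeasure_density)
qed

definition loss :: "real \<Rightarrow> real" where
  "loss t = t + (exp (\<tau>\<^sup>2) - 1) / t * (real p * post_bound)"

text \<open>The mixture bound holds for each training sample \<open>T\<close> and is then integrated
  over \<open>T\<close>. Its constants depend on \<open>s\<close> only through the square, so
  \<open>s = \<tau>\<close> and \<open>s = - \<tau>\<close> have the same loss.\<close>

lemma train_mix_le:
  assumes t: "0 < t" and s: "s\<^sup>2 = \<tau>\<^sup>2" and B: "B \<in> sets sample_space"
  shows "emeasure (train_mix \<Otimes>\<^sub>M G) B
    \<le> (\<Sum>S\<in>Pow {..<p}. ennreal (\<pi>' S) * emeasure (train S \<Otimes>\<^sub>M mvn_precision p (spike s S) (1\<^sub>m p)) B)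
      + ennreal (loss t)"
proof -
  interpret G: prob_space G by (rule prob_space_G)
  let ?m = "\<lambda>S. mvn_precision p (spike s S) (1\<^sub>m p)"
  define C where "C = (\<lambda>T S. \<pi>' S * g S T)"
  define W where "W = (\<lambda>T. \<Sum>S\<in>Pow {..<p}. C T S)"
  define D where "D = (\<lambda>T k S. (C T (insert k S))\<^sup>2 / (C T S + C T (insert k S)))"
  let ?c = "exp (\<tau>\<^sup>2) - 1"
  let ?P = "\<lambda>k. Pow ({..<p} - {k})"
  have C_pos: "0 < C T S" for T S
    unfolding C_def by (intro mult_pos_pos g_pos subset_weight_pos e)
  have W_pos: "0 < W T" for T unfolding W_def by (intro sum_pos C_pos) auto
  have D_pos: "0 \<le> D T k S" for T k S
    unfolding D_def using C_pos by (intro divide_nonneg_pos add_pos_pos) auto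
  have c: "0 \<le> ?c" by simp
  have C_m [measurable]: "(\<lambda>T. C T S) \<in> borel_measurable N" for S unfolding C_def by measurable
  have W_m [measurable]: "W \<in> borel_measurable N" unfolding W_def by measurable
  have D_m [measurable]: "(\<lambda>T. D T k S) \<in> borel_measurable N" for k S unfolding D_def by measurable
  have mix: "train_mix = density N (\<lambda>T. ennreal (W T))"
    by (simp add: train_mix_def W_def C_def)
  have BG: "B \<in> sets (N \<Otimes>\<^sub>M G)" and Btm: "B \<in> sets (train_mix \<Otimes>\<^sub>M G)"
    using B sets_sample_space[OF refl sets_G] sets_sample_space[OF _ sets_G, of train_mix]
    by (auto simp: mix)
  have Bm: "B \<in> sets (N \<Otimes>\<^sub>M ?m S)" "B \<in> sets (train S \<Otimes>\<^sub>M ?m S)" for S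
    using B sets_sample_space[OF refl sets_mvn] sets_sample_space[OF sets_train sets_mvn] by auto
  have secG: "Pair T -` B \<in> sets G" for T by (rule sets_Pair1[OF BG])
  have G_m [measurable]: "(\<lambda>T. emeasure G (Pair T -` B)) \<in> borel_measurable N"
    by (rule G.measurable_emeasure_Pair[OF BG])
  have m_m [measurable]: "(\<lambda>T. emeasure (?m S) (Pair T -` B)) \<in> borel_measurable N" for S
  proof -
    interpret prob_space "?m S" by (rule prob_space_mvn_precision[OF pos_def_mat_one])
    show ?thesis by (rule measurable_emeasure_Pair[OF Bm(1)])
  qed
  have "emeasure (train_mix \<Otimes>\<^sub>M G) B = (\<integral>\<^sup>+T. emeasure G (Pair T -` B) \<partial>train_mix)"
    by (rule G.emeasure_pair_measure_alt[OF Btm])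
  also have "\<dots> = (\<integral>\<^sup>+T. ennreal (W T) * emeasure G (Pair T -` B) \<partial>N)"
    unfolding mix by (rule nn_integral_density) measurable
  also have "\<dots> \<le> (\<integral>\<^sup>+T. (\<Sum>S\<in>Pow {..<p}. ennreal (C T S) * emeasure (?m S) (Pair T -` B))
      + ennreal (t * W T + ?c / t * (\<Sum>k<p. \<Sum>S\<in>?P k. D T k S)) \<partial>N)"
  proof (intro nn_integral_mono)
    fix T
    \<comment> \<open>At fixed \<open>T\<close> the weights are the posterior of the support up to
      the factor \<open>W T\<close>, the density of \<open>train_mix\<close> at
      \<open>T\<close>.\<close>
    interpret cm: coordinate_mixture std_normal_measure "\<lambda>y. exp (s * y - s\<^sup>2 / 2)" "exp (s\<^sup>2) - 1" p "C T"
      by (rule coordinate_mixture_normal) (rule C_pos)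
    show "ennreal (W T) * emeasure G (Pair T -` B)
       \<le> (\<Sum>S\<in>Pow {..<p}. ennreal (C T S) * emeasure (?m S) (Pair T -` B))
      + ennreal (t * W T + ?c / t * (\<Sum>k<p. \<Sum>S\<in>?P k. D T k S))"
    proof -
      have "(\<Sum>S\<in>Pow {..<p}. ennreal (C T S) * emeasure (?m S) (Pair T -` B))
         = (\<Sum>S\<in>Pow {..<p}. ennreal (C T S)
             * emeasure (density G (\<lambda>x. ennreal (\<Prod>i\<in>S. exp (s * x i - s\<^sup>2 / 2)))) (Pair T -` B))"
        by (intro sum.cong refl) (simp add: mvn_precision_one_eq)
      then show ?thesis
        using cm.mixture_approx[OF t secG, of T] unfolding cm.W_def cm.D_def W_def D_def s by simp
    qed
  qed
  also have "\<dots> = (\<integral>\<^sup>+T. (\<Sum>S\<in>Pow {..<p}. ennreal (C T S) * emeasure (?m S) (Pair T -` B)) \<partial>N)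
      + (\<integral>\<^sup>+T. ennreal (t * W T + ?c / t * (\<Sum>k<p. \<Sum>S\<in>?P k. D T k S)) \<partial>N)"
    by (intro nn_integral_add) measurable
  also have "(\<integral>\<^sup>+T. (\<Sum>S\<in>Pow {..<p}. ennreal (C T S) * emeasure (?m S) (Pair T -` B)) \<partial>N)
     = (\<Sum>S\<in>Pow {..<p}. ennreal (\<pi>' S) * emeasure (train S \<Otimes>\<^sub>M ?m S) B)"
  proof (subst nn_integral_sum)
    show "(\<Sum>S\<in>Pow {..<p}. (\<integral>\<^sup>+T. ennreal (C T S) * emeasure (?m S) (Pair T -` B) \<partial>N))
      = (\<Sum>S\<in>Pow {..<p}. ennreal (\<pi>' S) * emeasure (train S \<Otimes>\<^sub>M ?m S) B)"
    proof (intro sum.cong refl)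
      fix S
      interpret prob_space "?m S" by (rule prob_space_mvn_precision[OF pos_def_mat_one])
      have "(\<integral>\<^sup>+T. ennreal (C T S) * emeasure (?m S) (Pair T -` B) \<partial>N)
        = (\<integral>\<^sup>+T. ennreal (\<pi>' S) * (ennreal (g S T) * emeasure (?m S) (Pair T -` B)) \<partial>N)"
        unfolding C_def
        by (intro nn_integral_cong)
           (simp add: ennreal_mult less_imp_le[OF g_pos] less_imp_le[OF subset_weight_pos] e mult.assoc)
      also have "\<dots> = ennreal (\<pi>' S) * (\<integral>\<^sup>+T. ennreal (g S T) * emeasure (?m S) (Pair T -` B) \<partial>N)"
        by (rule nn_integral_cmult) measurable
      also have "(\<integral>\<^sup>+T. ennreal (g S T) * emeasure (?m S) (Pair T -` B) \<partial>N)
          = (\<integral>\<^sup>+T. emeasure (?m S) (Pair T -` B) \<partial>train S)"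
        unfolding train_eq by (rule nn_integral_density[symmetric]) measurable
      also have "\<dots> = emeasure (train S \<Otimes>\<^sub>M ?m S) B"
        by (rule emeasure_pair_measure_alt[symmetric, OF Bm(2)])
      finally show "(\<integral>\<^sup>+T. ennreal (C T S) * emeasure (?m S) (Pair T -` B) \<partial>N)
          = ennreal (\<pi>' S) * emeasure (train S \<Otimes>\<^sub>M ?m S) B" .
    qed
  qed measurable
  also have "(\<integral>\<^sup>+T. ennreal (t * W T + ?c / t * (\<Sum>k<p. \<Sum>S\<in>?P k. D T k S)) \<partial>N) \<le> ennreal (loss t)"
  proof -
    have "ennreal (t * W T + ?c / t * (\<Sum>k<p. \<Sum>S\<in>?P k. D T k S))
        = ennreal t * ennreal (W T) + ennreal (?c / t) * (\<Sum>k<p. \<Sum>S\<in>?P k. ennreal (D T k S))" for T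
    proof -
      have "(\<Sum>S\<in>?P k. ennreal (D T k S)) = ennreal (\<Sum>S\<in>?P k. D T k S)" for k
        by (intro sum_ennreal D_pos)
      then have "(\<Sum>k<p. \<Sum>S\<in>?P k. ennreal (D T k S)) = ennreal (\<Sum>k<p. \<Sum>S\<in>?P k. D T k S)"
        by (simp add: sum_ennreal sum_nonneg D_pos)
      then show ?thesis
        using t c W_pos[of T]
        by (simp add: ennreal_mult[symmetric] ennreal_plus[symmetric] sum_nonneg D_pos del: ennreal_plus)
    qed
    then have "(\<integral>\<^sup>+T. ennreal (t * W T + ?c / t * (\<Sum>k<p. \<Sum>S\<in>?P k. D T k S)) \<partial>N)
       = ennreal t * (\<integral>\<^sup>+T. ennreal (W T) \<partial>N) + ennreal (?c / t) * (\<Sum>k<p. \<Sum>S\<in>?P k. (\<integral>\<^sup>+T. ennreal (D T k S) \<partial>N))"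
      by (simp add: nn_integral_add nn_integral_cmult nn_integral_sum)
    also have "(\<integral>\<^sup>+T. ennreal (W T) \<partial>N) = 1"
      using prob_space.emeasure_space_1[OF prob_space_train_mix] by (simp add: mix emeasure_density)
    also have "ennreal t * 1 + ennreal (?c / t) * (\<Sum>k<p. \<Sum>S\<in>?P k. (\<integral>\<^sup>+T. ennreal (D T k S) \<partial>N))
       \<le> ennreal t * 1 + ennreal (?c / t) * (\<Sum>k<p. \<Sum>S\<in>?P k. ennreal (post_bound * subset_weight e ({..<p} - {k}) S))"
      unfolding D_def C_def
      by (intro add_left_mono mult_left_mono sum_mono nn_integral_post) auto
    also have "(\<Sum>k<p. \<Sum>S\<in>?P k. ennreal (post_bound * subset_weight e ({..<p} - {k}) S))
       = (\<Sum>k<p. ennreal (\<Sum>S\<in>?P k. post_bound * subset_weight e ({..<p} - {k}) S))"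
      by (intro sum.cong refl sum_ennreal mult_nonneg_nonneg post_bound_nonneg less_imp_le[OF subset_weight_pos] e)
    \<comment> \<open>For each \<open>k\<close> the prior weights of the other coordinates sum to 1,
      so each of the \<open>p\<close> coordinates contributes \<open>post_bound\<close>.\<close>
    also have "\<dots> = ennreal (real p * post_bound)"
      by (simp add: sum_distrib_left[symmetric] sum_subset_weight ennreal_mult post_bound_nonneg ennreal_of_nat_eq_real_of_nat)
    also have "ennreal t * 1 + ennreal (?c / t) * ennreal (real p * post_bound) = ennreal (loss t)"
      using t c post_bound_nonneg
      by (simp add: loss_def ennreal_mult[symmetric] ennreal_plus[symmetric] del: ennreal_plus)
    finally show ?thesis .
  qed
  finally show ?thesis by (simp add: add_left_mono)
qed

lemma pair_precision_one_le:
  assumes t: "0 < t" and B: "B \<in> sets sample_space"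
    and F: "F = (\<Sum>i<p. \<Sum>j<p. (dev_entries \<Omega> i j)\<^sup>2)"
  shows "emeasure (train S \<Otimes>\<^sub>M mvn_precision p m (1\<^sub>m p)) B
    \<le> emeasure (train S \<Otimes>\<^sub>M mvn_precision p m \<Omega>) B + ennreal (t + F / t)"
proof -
  interpret T: prob_space "train S" by (rule prob_space_train)
  interpret I: prob_space "mvn_precision p m (1\<^sub>m p)" by (rule prob_space_mvn_precision[OF pos_def_mat_one])
  interpret O: prob_space "mvn_precision p m \<Omega>" by (rule prob_space_mvn_precision[OF Omega])
  have BI: "B \<in> sets (train S \<Otimes>\<^sub>M mvn_precision p m (1\<^sub>m p))"
    and BO: "B \<in> sets (train S \<Otimes>\<^sub>M mvn_precision p m \<Omega>)"
    using B sets_sample_space[OF sets_train sets_mvn] by auto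
  have [measurable]: "(\<lambda>T. emeasure (mvn_precision p m \<Omega>) (Pair T -` B)) \<in> borel_measurable (train S)"
    by (rule O.measurable_emeasure_Pair[OF BO])
  have "emeasure (train S \<Otimes>\<^sub>M mvn_precision p m (1\<^sub>m p)) B
     = (\<integral>\<^sup>+T. emeasure (mvn_precision p m (1\<^sub>m p)) (Pair T -` B) \<partial>train S)"
    by (rule I.emeasure_pair_measure_alt[OF BI])
  also have "\<dots> \<le> (\<integral>\<^sup>+T. emeasure (mvn_precision p m \<Omega>) (Pair T -` B) + ennreal (t + F / t) \<partial>train S)"
  proof (intro nn_integral_mono mvn_precision_one_le[OF Omega F[symmetric] _ t])
    fix T
    show "Pair T -` B \<in> sets lebesgue_p"
      using sets_Pair1[OF BO] unfolding sets_mvn sets_lebesgue_p .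
  qed (use F dev_le in simp)
  also have "\<dots> = emeasure (train S \<Otimes>\<^sub>M mvn_precision p m \<Omega>) B + ennreal (t + F / t)"
    by (subst nn_integral_add) (auto simp: O.emeasure_pair_measure_alt[OF BO] T.emeasure_space_1)
  finally show ?thesis .
qed

text \<open>Read \<open>B\<close> as the region where class 1 is predicted. The reference law
  \<open>train_mix \<Otimes>\<^sub>M G\<close> does not depend on the test label and splits its mass
  1 between \<open>B\<close> and the complement. Passing to the true laws costs
  \<open>loss t\<close> for each label, and the precision matrix once, under class 1.\<close>

lemma error_sum_ge:
  assumes t: "0 < t" and B: "B \<in> sets sample_space"
    and F: "F = (\<Sum>i<p. \<Sum>j<p. (dev_entries \<Omega> i j)\<^sup>2)"
  shows "1 \<le> (\<Sum>S\<in>Pow {..<p}. ennreal (\<pi>' S) * emeasure (train S \<Otimes>\<^sub>M mvn_precision p (spike (- \<tau>) S) (1\<^sub>m p)) B)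
    + (\<Sum>S\<in>Pow {..<p}. ennreal (\<pi>' S) * emeasure (train S \<Otimes>\<^sub>M mvn_precision p (spike \<tau> S) \<Omega>) (space sample_space - B))
    + ennreal (2 * loss t + (t + F / t))"
proof -
  let ?Bc = "space sample_space - B"
  have Bc: "?Bc \<in> sets sample_space" using B by auto
  interpret R: prob_space train_mix by (rule prob_space_train_mix)
  interpret G: prob_space G by (rule prob_space_G)
  interpret RG: pair_prob_space train_mix G ..
  have sets_RG: "sets (train_mix \<Otimes>\<^sub>M G) = sets sample_space"
    by (rule sets_sample_space) (auto simp: train_mix_def sets_G)
  have F0: "0 \<le> F" unfolding F by (intro sum_nonneg) auto
  have loss0: "0 \<le> loss t" unfolding loss_def using t post_bound_nonneg by simp
  have le1: "(\<Sum>S\<in>Pow {..<p}. ennreal (\<pi>' S)) = 1"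
    using sum_subset_weight[of "{..<p}" e]
    by (subst sum_ennreal) (auto intro!: less_imp_le[OF subset_weight_pos] e)
  have "1 = emeasure (train_mix \<Otimes>\<^sub>M G) (space (train_mix \<Otimes>\<^sub>M G))"
    by (rule RG.emeasure_space_1[symmetric])
  also have "space (train_mix \<Otimes>\<^sub>M G) = B \<union> ?Bc"
    using sets_eq_imp_space_eq[OF sets_RG] sets.sets_into_space[OF B] by auto
  also have "emeasure (train_mix \<Otimes>\<^sub>M G) (B \<union> ?Bc)
     = emeasure (train_mix \<Otimes>\<^sub>M G) B + emeasure (train_mix \<Otimes>\<^sub>M G) ?Bc"
    using B Bc sets_RG by (intro plus_emeasure[symmetric]) auto
  also have "\<dots> \<le> ((\<Sum>S\<in>Pow {..<p}. ennreal (\<pi>' S) * emeasure (train S \<Otimes>\<^sub>M mvn_precision p (spike (- \<tau>) S) (1\<^sub>m p)) B)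
      + ennreal (loss t))
    + ((\<Sum>S\<in>Pow {..<p}. ennreal (\<pi>' S) * emeasure (train S \<Otimes>\<^sub>M mvn_precision p (spike \<tau> S) (1\<^sub>m p)) ?Bc)
      + ennreal (loss t))"
    by (intro add_mono train_mix_le t B Bc) auto
  also have "\<dots> \<le> ((\<Sum>S\<in>Pow {..<p}. ennreal (\<pi>' S) * emeasure (train S \<Otimes>\<^sub>M mvn_precision p (spike (- \<tau>) S) (1\<^sub>m p)) B)
      + ennreal (loss t))
    + ((\<Sum>S\<in>Pow {..<p}. ennreal (\<pi>' S) * (emeasure (train S \<Otimes>\<^sub>M mvn_precision p (spike \<tau> S) \<Omega>) ?Bc + ennreal (t + F / t)))
      + ennreal (loss t))"
    by (intro add_left_mono add_right_mono sum_mono mult_left_mono pair_precision_one_le t Bc F) auto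
  also have "(\<Sum>S\<in>Pow {..<p}. ennreal (\<pi>' S) * (emeasure (train S \<Otimes>\<^sub>M mvn_precision p (spike \<tau> S) \<Omega>) ?Bc + ennreal (t + F / t)))
     = (\<Sum>S\<in>Pow {..<p}. ennreal (\<pi>' S) * emeasure (train S \<Otimes>\<^sub>M mvn_precision p (spike \<tau> S) \<Omega>) ?Bc) + ennreal (t + F / t)"
    by (simp add: distrib_left sum.distrib sum_distrib_right[symmetric] le1)
  \<comment> \<open>Naming the two sums \<open>b0\<close> and \<open>b1\<close> makes them opaque,
    so that only a rearrangement of summands is left.\<close>
  finally have "1 \<le> (b0 + ennreal (loss t)) + ((b1 + ennreal (t + F / t)) + ennreal (loss t))"
    if "b0 = (\<Sum>S\<in>Pow {..<p}. ennreal (\<pi>' S) * emeasure (train S \<Otimes>\<^sub>M mvn_precision p (spike (- \<tau>) S) (1\<^sub>m p)) B)"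
      and "b1 = (\<Sum>S\<in>Pow {..<p}. ennreal (\<pi>' S) * emeasure (train S \<Otimes>\<^sub>M mvn_precision p (spike \<tau> S) \<Omega>) ?Bc)"
    for b0 b1 unfolding that .
  moreover have "ennreal (2 * loss t + (t + F / t)) = ennreal (loss t) + ennreal (loss t) + ennreal (t + F / t)"
    using loss0 t F0 by (simp add: ennreal_plus[symmetric] del: ennreal_plus)
  ultimately show ?thesis by (simp only: ac_simps)
qed

end

section \<open>The ARW model\<close>

lemma nn_integral_two_point_pmf:
  fixes s e :: real
  assumes "0 \<le> e" "e \<le> 1" "s \<noteq> 0"
  shows "(\<integral>\<^sup>+x. f x \<partial>measure_pmf (pmf_of_list [(s, e), (0, 1 - e)])) = ennreal e * f s + ennreal (1 - e) * f 0"
proof -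
  have wf: "pmf_of_list_wf [(s, e), (0, 1 - e)]"
    using assms by (auto simp: pmf_of_list_wf_def)
  have set: "set_pmf (pmf_of_list [(s, e), (0, 1 - e)]) \<subseteq> {s, 0}"
    using set_pmf_of_list[OF wf] by simp
  have "(\<integral>\<^sup>+x. f x \<partial>measure_pmf (pmf_of_list [(s, e), (0, 1 - e)]))
     = (\<Sum>x\<in>{s, 0}. f x * ennreal (pmf (pmf_of_list [(s, e), (0, 1 - e)]) x))"
    by (rule nn_integral_measure_pmf_support) (use set in \<open>auto simp: set_pmf_iff\<close>)
  then show ?thesis
    using assms by (simp add: pmf_pmf_of_list[OF wf] mult.commute)
qed

text \<open>Turns the expectation over mean vectors into a finite sum over supports, the form in
  which the mixtures were treated. The law is discrete, so \<open>f\<close> is arbitrary.\<close>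

lemma nn_integral_Pi_two_point_pmf:
  fixes s e :: real
  assumes "0 \<le> e" "e \<le> 1" "s \<noteq> 0" "finite A"
  shows "(\<integral>\<^sup>+\<mu>. f \<mu> \<partial>measure_pmf (Pi_pmf A 0 (\<lambda>_. pmf_of_list [(s, e), (0, 1 - e)])))
     = (\<Sum>S\<in>Pow A. ennreal (subset_weight e A S) * f (spike s S))"
  using assms(4)
proof (induction A arbitrary: f rule: finite_induct)
  case empty
  then show ?case by (simp add: subset_weight_def spike_def)
next
  case (insert k A)
  have nn: "0 \<le> subset_weight e A S" for S using assms by (simp add: subset_weight_def)
  have w: "subset_weight e (insert k A) (insert k S) = e * subset_weight e A S"
    "subset_weight e (insert k A) S = (1 - e) * subset_weight e A S" if "S \<in> Pow A" for S
    using subset_weight_insert[of "insert k A" k S e] that insert.hyps by auto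
  have sp: "(spike s S)(k := s) = spike s (insert k S)" "(spike s S)(k := 0) = spike s S" if "S \<in> Pow A" for S
    using that insert.hyps by (auto simp: spike_def fun_eq_iff)
  have "(\<integral>\<^sup>+\<mu>. f \<mu> \<partial>measure_pmf (Pi_pmf (insert k A) 0 (\<lambda>_. pmf_of_list [(s, e), (0, 1 - e)])))
    = (\<integral>\<^sup>+y. (\<integral>\<^sup>+\<mu>. f (\<mu>(k := y)) \<partial>measure_pmf (Pi_pmf A 0 (\<lambda>_. pmf_of_list [(s, e), (0, 1 - e)])))
        \<partial>measure_pmf (pmf_of_list [(s, e), (0, 1 - e)]))"
    using insert.hyps by (simp add: Pi_pmf_insert nn_integral_pair_pmf' case_prod_unfold)
  also have "\<dots> = ennreal e * (\<Sum>S\<in>Pow A. ennreal (subset_weight e A S) * f ((spike s S)(k := s)))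
      + ennreal (1 - e) * (\<Sum>S\<in>Pow A. ennreal (subset_weight e A S) * f ((spike s S)(k := 0)))"
    by (simp add: nn_integral_two_point_pmf assms insert.IH)
  also have "\<dots> = (\<Sum>S\<in>Pow A. ennreal (subset_weight e (insert k A) S) * f (spike s S)
      + ennreal (subset_weight e (insert k A) (insert k S)) * f (spike s (insert k S)))"
    unfolding sum_distrib_left sum.distrib[symmetric]
    by (intro sum.cong refl) (use assms in \<open>simp add: w sp nn ennreal_mult mult.assoc add.commute\<close>)
  also have "\<dots> = (\<Sum>S\<in>Pow (insert k A). ennreal (subset_weight e (insert k A) S) * f (spike s S))"
    by (rule sum_Pow_insert[symmetric]) (use insert.hyps in auto)
  finally show ?case .
qed

lemma nn_integral_mean_pmf:
  assumes "1 \<le> p" "0 < \<zeta>"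
  shows "(\<integral>\<^sup>+\<mu>. f \<mu> \<partial>measure_pmf (mean_pmf \<zeta> \<theta> p))
     = (\<Sum>S\<in>Pow {..<p}. ennreal (subset_weight (real p powr - \<zeta>) {..<p} S) * f (spike (real p powr - \<theta>) S))"
proof -
  have "real p powr - \<zeta> \<le> real p powr 0" using assms by (intro powr_mono) auto
  then show ?thesis
    unfolding mean_pmf_def using assms by (intro nn_integral_Pi_two_point_pmf) auto
qed

section \<open>The joint law of parameters, labels and features\<close>

lemma pos_def_mat_Omega1: "pos_def_mat p (Omega1 p \<Delta> V)"
  by (simp add: Omega1_def pos_def_mat_one)

lemma frobenius_norm_sq:
  assumes "A \<in> carrier_mat p p"
  shows "(frobenius_norm (A - 1\<^sub>m p))\<^sup>2 = (\<Sum>i<p. \<Sum>j<p. (dev_entries A i j)\<^sup>2)"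
proof -
  have "(frobenius_norm (A - 1\<^sub>m p))\<^sup>2 = (\<Sum>i<p. \<Sum>j<p. ((A - 1\<^sub>m p) $$ (i, j))\<^sup>2)"
    unfolding frobenius_norm_def using assms by (auto intro!: real_sqrt_pow2 sum_nonneg)
  also have "\<dots> = (\<Sum>i<p. \<Sum>j<p. (dev_entries A i j)\<^sup>2)"
    using assms by (intro sum.cong refl) (auto simp: dev_entries_def mat_entries_def)
  finally show ?thesis .
qed

lemma sets_feature_law: "sets (feature_law p \<mu> \<Omega> y) = sets (feature_space p)"
  by (simp add: feature_law_def feature_space_def sets_mvn_precision)

lemma prob_space_feature_law: "pos_def_mat p \<Omega> \<Longrightarrow> prob_space (feature_law p \<mu> \<Omega> y)"
  by (simp add: feature_law_def prob_space_mvn_precision pos_def_mat_one)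

lemma sets_features_given: "sets (features_given \<delta> p \<omega>) = sets (features_space \<delta> p)"
  unfolding features_given_def features_space_def
  by (auto simp: split_beta intro!: sets_pair_measure_cong sets_PiM_cong sets_feature_law)

lemma prob_space_features_given: "prob_space (features_given \<delta> p \<omega>)"
proof -
  obtain \<mu> \<Delta> V ys y where \<omega>: "\<omega> = (\<mu>, (\<Delta>, V), ys, y)" by (metis surj_pair)
  interpret A: prob_space "Pi\<^sub>M {..<train_size \<delta> p} (\<lambda>i. feature_law p \<mu> (Omega1 p \<Delta> V) (ys i))"
    by (intro prob_space_PiM prob_space_feature_law pos_def_mat_Omega1)
  interpret B: prob_space "feature_law p \<mu> (Omega1 p \<Delta> V) y"
    by (intro prob_space_feature_law pos_def_mat_Omega1)
  interpret pair_prob_space "Pi\<^sub>M {..<train_size \<delta> p} (\<lambda>i. feature_law p \<mu> (Omega1 p \<Delta> V) (ys i))"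
    "feature_law p \<mu> (Omega1 p \<Delta> V) y" ..
  show ?thesis unfolding features_given_def \<omega> by simp unfold_locales
qed

definition model_space :: "real \<Rightarrow> nat \<Rightarrow> (latent \<times> (nat \<Rightarrow> nat \<Rightarrow> real) \<times> (nat \<Rightarrow> real)) measure" where
  "model_space \<delta> p = count_space UNIV \<Otimes>\<^sub>M features_space \<delta> p"

lemma Pair_measurable_model_space: "Pair \<omega> \<in> features_given \<delta> p \<omega>' \<rightarrow>\<^sub>M model_space \<delta> p"
  unfolding model_space_def
  by (subst measurable_cong_sets[OF sets_features_given refl]) (rule measurable_Pair1', simp)

text \<open>The latent variables carry the discrete sigma-algebra, so it is enough that every value
  of the kernel is a subprobability.\<close>

lemma arw_kernel_measurable:
  "(\<lambda>\<omega>. distr (features_given \<delta> p \<omega>) (model_space \<delta> p) (Pair \<omega>))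
     \<in> measure_pmf (latent_pmf \<alpha> \<beta> \<zeta> \<theta> \<delta> \<Delta>law p) \<rightarrow>\<^sub>M subprob_algebra (model_space \<delta> p)"
proof -
  have "distr (features_given \<delta> p \<omega>) (model_space \<delta> p) (Pair \<omega>) \<in> space (subprob_algebra (model_space \<delta> p))" for \<omega>
    by (simp add: space_subprob_algebra prob_space_imp_subprob_space
        prob_space.prob_space_distr[OF prob_space_features_given Pair_measurable_model_space])
  then show ?thesis by (simp add: measurable_def Pi_def)
qed

lemma emeasure_arw_model:
  assumes "X \<in> sets (model_space \<delta> p)"
  shows "emeasure (arw_model \<alpha> \<beta> \<zeta> \<theta> \<delta> \<Delta>law p) X
    = (\<integral>\<^sup>+\<omega>. emeasure (features_given \<delta> p \<omega>) (Pair \<omega> -` X \<inter> space (features_space \<delta> p))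
        \<partial>measure_pmf (latent_pmf \<alpha> \<beta> \<zeta> \<theta> \<delta> \<Delta>law p))"
proof -
  have "emeasure (arw_model \<alpha> \<beta> \<zeta> \<theta> \<delta> \<Delta>law p) X
    = (\<integral>\<^sup>+\<omega>. emeasure (distr (features_given \<delta> p \<omega>) (model_space \<delta> p) (Pair \<omega>)) X
        \<partial>measure_pmf (latent_pmf \<alpha> \<beta> \<zeta> \<theta> \<delta> \<Delta>law p))"
    unfolding arw_model_def model_space_def[symmetric]
    by (rule emeasure_bind[OF _ arw_kernel_measurable assms]) simp
  also have "\<dots> = (\<integral>\<^sup>+\<omega>. emeasure (features_given \<delta> p \<omega>) (Pair \<omega> -` X \<inter> space (features_space \<delta> p))
        \<partial>measure_pmf (latent_pmf \<alpha> \<beta> \<zeta> \<theta> \<delta> \<Delta>law p))"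
    using assms
    by (intro nn_integral_cong)
       (simp add: emeasure_distr[OF Pair_measurable_model_space] sets_eq_imp_space_eq[OF sets_features_given])
  finally show ?thesis .
qed

lemma space_arw_model: "space (arw_model \<alpha> \<beta> \<zeta> \<theta> \<delta> \<Delta>law p) = space (model_space \<delta> p)"
  and sets_arw_model: "sets (arw_model \<alpha> \<beta> \<zeta> \<theta> \<delta> \<Delta>law p) = sets (model_space \<delta> p)"
proof -
  show "sets (arw_model \<alpha> \<beta> \<zeta> \<theta> \<delta> \<Delta>law p) = sets (model_space \<delta> p)"
    unfolding arw_model_def model_space_def[symmetric]
    by (rule sets_bind[OF sets_kernel[OF arw_kernel_measurable]]) auto
  then show "space (arw_model \<alpha> \<beta> \<zeta> \<theta> \<delta> \<Delta>law p) = space (model_space \<delta> p)"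
    by (rule sets_eq_imp_space_eq)
qed

lemma prob_space_arw_model: "prob_space (arw_model \<alpha> \<beta> \<zeta> \<theta> \<delta> \<Delta>law p)"
proof
  have "Pair \<omega> -` space (model_space \<delta> p) \<inter> space (features_space \<delta> p) = space (features_given \<delta> p \<omega>)" for \<omega>
    by (auto simp: model_space_def space_pair_measure sets_eq_imp_space_eq[OF sets_features_given])
  then show "emeasure (arw_model \<alpha> \<beta> \<zeta> \<theta> \<delta> \<Delta>law p) (space (arw_model \<alpha> \<beta> \<zeta> \<theta> \<delta> \<Delta>law p)) = 1"
    unfolding space_arw_model
    by (simp add: emeasure_arw_model prob_space.emeasure_space_1[OF prob_space_features_given])
qed

lemma test_label_measurable: "test_label \<in> model_space \<delta> p \<rightarrow>\<^sub>M count_space UNIV"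
proof -
  have "test_label = (\<lambda>z. snd (snd (snd (fst z))))"
    by (auto simp: test_label_def fun_eq_iff)
  moreover have "(\<lambda>z. snd (snd (snd (fst z)))) \<in> model_space \<delta> p \<rightarrow>\<^sub>M count_space UNIV"
    unfolding model_space_def by (rule measurable_compose[OF measurable_fst]) simp
  ultimately show ?thesis by simp
qed

lemma predicted_label_measurable:
  assumes "is_classifier \<delta> p L"
  shows "predicted_label p L \<in> model_space \<delta> p \<rightarrow>\<^sub>M count_space UNIV"
proof -
  let ?f = "\<lambda>z. (fst (snd (snd (fst z))), fst (snd z), snd (snd z),
     Omega1 p (fst (fst (snd (fst z)))) (snd (fst (snd (fst z)))))"
  have eq: "predicted_label p L = (\<lambda>z. L (?f z))"
    by (auto simp: predicted_label_def fun_eq_iff)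
  have m: "?f \<in> model_space \<delta> p \<rightarrow>\<^sub>M (count_space UNIV \<Otimes>\<^sub>M Pi\<^sub>M {..<train_size \<delta> p} (\<lambda>_. feature_space p)
            \<Otimes>\<^sub>M feature_space p \<Otimes>\<^sub>M count_space UNIV)"
  proof -
    have fst: "(\<lambda>z. h (fst z)) \<in> model_space \<delta> p \<rightarrow>\<^sub>M count_space UNIV" for h
      unfolding model_space_def by (rule measurable_compose[OF measurable_fst]) simp
    have snd: "snd \<in> model_space \<delta> p \<rightarrow>\<^sub>M features_space \<delta> p"
      unfolding model_space_def by (rule measurable_snd)
    show ?thesis
      by (intro measurable_Pair fst measurable_compose[OF snd])
         (auto simp: features_space_def)
  qed
  show ?thesis
    unfolding eq by (rule measurable_compose[OF m]) (use assms in \<open>simp add: is_classifier_def\<close>)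
qed

section \<open>Error probabilities of a classifier\<close>

lemma nn_integral_latent_pmf:
  "(\<integral>\<^sup>+\<omega>. f \<omega> \<partial>measure_pmf (latent_pmf \<alpha> \<beta> \<zeta> \<theta> \<delta> \<Delta>law p))
   = (\<integral>\<^sup>+\<mu>. \<integral>\<^sup>+dv. \<integral>\<^sup>+ys. (f (\<mu>, dv, ys, True) + f (\<mu>, dv, ys, False)) / 2
       \<partial>measure_pmf (Pi_pmf {..<train_size \<delta> p} False (\<lambda>_. bernoulli_pmf (1/2)))
       \<partial>measure_pmf (perturbation_pmf \<alpha> \<beta> \<Delta>law p) \<partial>measure_pmf (mean_pmf \<zeta> \<theta> p))"
  unfolding latent_pmf_def nn_integral_pair_pmf'
  by (intro nn_integral_cong, subst nn_integral_bernoulli_pmf)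
     (auto simp: divide_ennreal_def inverse_ennreal distrib_right)

lemma uminus_spike: "(\<lambda>i. - spike s S i) = spike (- s) S"
  by (auto simp: spike_def)

text \<open>The total \<open>2 * loss t + (t + F / t)\<close> with the loss written out and the
  squared Frobenius norm \<open>F\<close> replaced by a bound \<open>r\<close> on it.\<close>

definition error_bound :: "nat \<Rightarrow> nat \<Rightarrow> real \<Rightarrow> real \<Rightarrow> real \<Rightarrow> real \<Rightarrow> real" where
  "error_bound p n e \<tau> t r = 2 * (t + (exp (\<tau>\<^sup>2) - 1) / t *
      (real p * min e (e\<^sup>2 / (1 - e) * exp (2 * real n * \<tau>\<^sup>2)))) + (t + r / t)"

definition pointwise_error ::
    "real \<Rightarrow> nat \<Rightarrow> (observation \<Rightarrow> bool) \<Rightarrow> bool \<Rightarrow> (nat \<Rightarrow> real) \<Rightarrow> (nat \<Rightarrow> real) \<times> (nat \<times> nat \<Rightarrow> real)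
      \<Rightarrow> (nat \<Rightarrow> bool) \<Rightarrow> ennreal" where
  "pointwise_error \<delta> p L b \<mu> dv ys = emeasure (features_given \<delta> p (\<mu>, dv, ys, b))
     {z \<in> space (features_space \<delta> p). L (ys, fst z, snd z, Omega1 p (fst dv) (snd dv)) \<noteq> b}"

lemma classifier_section:
  assumes "is_classifier \<delta> p L"
  shows "{z \<in> space (features_space \<delta> p). L (ys, fst z, snd z, \<Omega>)} \<in> sets (features_space \<delta> p)"
proof -
  have "(\<lambda>z. (ys, fst z, snd z, \<Omega>)) \<in> features_space \<delta> p \<rightarrow>\<^sub>M (count_space UNIV \<Otimes>\<^sub>M
      Pi\<^sub>M {..<train_size \<delta> p} (\<lambda>_. feature_space p) \<Otimes>\<^sub>M feature_space p \<Otimes>\<^sub>M count_space UNIV)"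
    unfolding features_space_def by (intro measurable_Pair measurable_fst measurable_snd) auto
  then have "(\<lambda>z. L (ys, fst z, snd z, \<Omega>)) \<in> features_space \<delta> p \<rightarrow>\<^sub>M count_space UNIV"
    by (rule measurable_compose) (use assms in \<open>simp add: is_classifier_def\<close>)
  then show ?thesis by measurable
qed

text \<open>The classifier sees the precision matrix and the training labels, so the bound is proved
  for each of their values; only the unknown mean is averaged.\<close>

lemma pointwise_error_sum_ge:
  assumes L: "is_classifier \<delta> p L" and e: "0 < e" "e < 1" and t: "0 < t"
    and r: "(frobenius_norm (Omega1 p (fst dv) (snd dv) - 1\<^sub>m p))\<^sup>2 \<le> r" "r \<le> 1 / 64"
  shows "1 \<le> (\<Sum>S\<in>Pow {..<p}. ennreal (subset_weight e {..<p} S) * pointwise_error \<delta> p L False (spike \<tau> S) dv ys)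
    + (\<Sum>S\<in>Pow {..<p}. ennreal (subset_weight e {..<p} S) * pointwise_error \<delta> p L True (spike \<tau> S) dv ys)
    + ennreal (error_bound p (train_size \<delta> p) e \<tau> t r)"
proof -
  let ?\<Omega> = "Omega1 p (fst dv) (snd dv)" and ?n = "train_size \<delta> p"
  define F where "F = (\<Sum>i<p. \<Sum>j<p. (dev_entries ?\<Omega> i j)\<^sup>2)"
  have \<Omega>: "pos_def_mat p ?\<Omega>" by (rule pos_def_mat_Omega1)
  then have F: "F \<le> r"
    using r frobenius_norm_sq[of ?\<Omega> p] by (simp add: F_def pos_def_mat_def)
  interpret tc: two_class p ?n ys ?\<Omega> e \<tau>
    by unfold_locales (use \<Omega> F r e in \<open>auto simp: F_def\<close>)
  have train: "Pi\<^sub>M {..<?n} (\<lambda>i. feature_law p (spike \<tau> S) ?\<Omega> (ys i)) = tc.train S" for S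
    unfolding tc.train_def by (intro PiM_cong) (auto simp: feature_law_def tc.shift_def tc.prec_def uminus_spike)
  have given: "features_given \<delta> p (spike \<tau> S, dv, ys, b) = tc.train S \<Otimes>\<^sub>M
     mvn_precision p (spike (if b then \<tau> else - \<tau>) S) (if b then ?\<Omega> else 1\<^sub>m p)" for S b
    unfolding features_given_def train[symmetric]
    by (cases dv) (simp add: feature_law_def uminus_spike)
  have sp: "tc.sample_space = features_space \<delta> p"
    by (simp add: tc.sample_space_def features_space_def)
  let ?B = "{z \<in> space (features_space \<delta> p). L (ys, fst z, snd z, ?\<Omega>)}"
  have "?B \<in> sets tc.sample_space" unfolding sp by (rule classifier_section[OF L])
  note ge = tc.error_sum_ge[OF t this F_def]
  have eF: "pointwise_error \<delta> p L False (spike \<tau> S) dv ys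
      = emeasure (tc.train S \<Otimes>\<^sub>M mvn_precision p (spike (- \<tau>) S) (1\<^sub>m p)) ?B" for S
    by (simp add: pointwise_error_def given)
  have "space (features_space \<delta> p) - ?B = {z \<in> space (features_space \<delta> p). L (ys, fst z, snd z, ?\<Omega>) \<noteq> True}"
    by auto
  then have eT: "pointwise_error \<delta> p L True (spike \<tau> S) dv ys
      = emeasure (tc.train S \<Otimes>\<^sub>M mvn_precision p (spike \<tau> S) ?\<Omega>) (space tc.sample_space - ?B)" for S
    by (simp add: pointwise_error_def given sp)
  have "2 * tc.loss t + (t + F / t) \<le> error_bound p ?n e \<tau> t r"
    using F t by (simp add: error_bound_def tc.loss_def tc.post_bound_def divide_right_mono)
  then have "ennreal (2 * tc.loss t + (t + F / t)) \<le> ennreal (error_bound p ?n e \<tau> t r)"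
    by (rule ennreal_leI)
  with ge show ?thesis
    unfolding eF eT by (meson add_left_mono order_trans)
qed

lemma emeasure_arw_test_label:
  "emeasure (arw_model \<alpha> \<beta> \<zeta> \<theta> \<delta> \<Delta>law p) {\<omega> \<in> space (model_space \<delta> p). test_label \<omega> = b} = 1 / 2"
proof -
  let ?X = "{\<omega> \<in> space (model_space \<delta> p). test_label \<omega> = b}"
  have X: "?X \<in> sets (model_space \<delta> p)"
    using test_label_measurable[of \<delta> p] by measurable
  have "Pair (\<mu>, dv, ys, y) -` ?X \<inter> space (features_space \<delta> p)
      = (if y = b then space (features_space \<delta> p) else {})" for \<mu> dv ys y
    by (auto simp: model_space_def space_pair_measure test_label_def)
  moreover have "emeasure (features_given \<delta> p \<omega>) (space (features_space \<delta> p)) = 1" for \<omega>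
    using prob_space.emeasure_space_1[OF prob_space_features_given, of \<delta> p \<omega>]
    by (simp add: sets_eq_imp_space_eq[OF sets_features_given])
  ultimately show ?thesis
    unfolding emeasure_arw_model[OF X] nn_integral_latent_pmf
    by (cases b) (simp_all add: measure_pmf.emeasure_space_1)
qed

text \<open>Brings the average over the mean inside the other integrals, where it is a finite sum
  and the bound for frozen perturbation and labels applies. The division by 2 is the probability of
  the test label \<open>b\<close>.\<close>

lemma emeasure_arw_error:
  assumes L: "is_classifier \<delta> p L" and p: "1 \<le> p" "0 < \<zeta>"
  shows "emeasure (arw_model \<alpha> \<beta> \<zeta> \<theta> \<delta> \<Delta>law p)
      {\<omega> \<in> space (model_space \<delta> p). predicted_label p L \<omega> \<noteq> b \<and> test_label \<omega> = b}
    = (\<integral>\<^sup>+dv. \<integral>\<^sup>+ys. (\<Sum>S\<in>Pow {..<p}. ennreal (subset_weight (real p powr - \<zeta>) {..<p} S)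
          * pointwise_error \<delta> p L b (spike (real p powr - \<theta>) S) dv ys) / 2
        \<partial>measure_pmf (Pi_pmf {..<train_size \<delta> p} False (\<lambda>_. bernoulli_pmf (1/2)))
        \<partial>measure_pmf (perturbation_pmf \<alpha> \<beta> \<Delta>law p))"
proof -
  let ?X = "{\<omega> \<in> space (model_space \<delta> p). predicted_label p L \<omega> \<noteq> b \<and> test_label \<omega> = b}"
  let ?w = "\<lambda>S. ennreal (subset_weight (real p powr - \<zeta>) {..<p} S)"
  have X: "?X \<in> sets (model_space \<delta> p)"
    using test_label_measurable[of \<delta> p] predicted_label_measurable[OF L] by measurable
  have sec: "Pair (\<mu>, dv, ys, y) -` ?X \<inter> space (features_space \<delta> p)
      = (if y = b then {z \<in> space (features_space \<delta> p). L (ys, fst z, snd z, Omega1 p (fst dv) (snd dv)) \<noteq> b} else {})"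
    for \<mu> dv ys y
    by (auto simp: model_space_def space_pair_measure test_label_def predicted_label_def split_beta)
  have "(emeasure (features_given \<delta> p (\<mu>, dv, ys, True)) (Pair (\<mu>, dv, ys, True) -` ?X \<inter> space (features_space \<delta> p))
     + emeasure (features_given \<delta> p (\<mu>, dv, ys, False)) (Pair (\<mu>, dv, ys, False) -` ?X \<inter> space (features_space \<delta> p))) / 2
     = pointwise_error \<delta> p L b \<mu> dv ys / 2" for \<mu> dv ys
    unfolding sec by (cases b) (simp_all add: pointwise_error_def)
  then have "emeasure (arw_model \<alpha> \<beta> \<zeta> \<theta> \<delta> \<Delta>law p) ?X
    = (\<Sum>S\<in>Pow {..<p}. ?w S * (\<integral>\<^sup>+dv. \<integral>\<^sup>+ys. pointwise_error \<delta> p L b (spike (real p powr - \<theta>) S) dv ys / 2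
       \<partial>measure_pmf (Pi_pmf {..<train_size \<delta> p} False (\<lambda>_. bernoulli_pmf (1/2)))
       \<partial>measure_pmf (perturbation_pmf \<alpha> \<beta> \<Delta>law p)))"
    unfolding emeasure_arw_model[OF X] nn_integral_latent_pmf nn_integral_mean_pmf[OF p] by simp
  also have "\<dots> = (\<integral>\<^sup>+dv. \<integral>\<^sup>+ys. (\<Sum>S\<in>Pow {..<p}. ?w S * (pointwise_error \<delta> p L b (spike (real p powr - \<theta>) S) dv ys / 2))
       \<partial>measure_pmf (Pi_pmf {..<train_size \<delta> p} False (\<lambda>_. bernoulli_pmf (1/2)))
       \<partial>measure_pmf (perturbation_pmf \<alpha> \<beta> \<Delta>law p))"
    by (simp add: nn_integral_sum nn_integral_cmult)
  also have "\<dots> = (\<integral>\<^sup>+dv. \<integral>\<^sup>+ys. (\<Sum>S\<in>Pow {..<p}. ?w S * pointwise_error \<delta> p L b (spike (real p powr - \<theta>) S) dv ys) / 2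
       \<partial>measure_pmf (Pi_pmf {..<train_size \<delta> p} False (\<lambda>_. bernoulli_pmf (1/2)))
       \<partial>measure_pmf (perturbation_pmf \<alpha> \<beta> \<Delta>law p))"
    by (simp add: divide_ennreal_def sum_distrib_right mult.assoc)
  finally show ?thesis .
qed

lemma misclassification_rate_ge:
  assumes L: "is_classifier \<delta> p L" and p: "2 \<le> p" "0 < \<zeta>" and t: "0 < t" and r: "0 \<le> r" "r \<le> 1 / 64"
  shows "(1 - measure_pmf.prob (perturbation_pmf \<alpha> \<beta> \<Delta>law p)
           {(\<Delta>, V). (frobenius_norm (Omega1 p \<Delta> V - 1\<^sub>m p))\<^sup>2 > r}
         - error_bound p (train_size \<delta> p) (real p powr - \<zeta>) (real p powr - \<theta>) t r) / 2
     \<le> misclassification_rate \<alpha> \<beta> \<zeta> \<theta> \<delta> \<Delta>law p L"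
proof -
  define M where "M = arw_model \<alpha> \<beta> \<zeta> \<theta> \<delta> \<Delta>law p"
  define e where "e = real p powr - \<zeta>"
  let ?P = "perturbation_pmf \<alpha> \<beta> \<Delta>law p"
  let ?Y = "Pi_pmf {..<train_size \<delta> p} False (\<lambda>_. bernoulli_pmf (1/2))"
  let ?k = "error_bound p (train_size \<delta> p) e (real p powr - \<theta>) t r"
  let ?bad = "{(\<Delta>, V). (frobenius_norm (Omega1 p \<Delta> V - 1\<^sub>m p))\<^sup>2 > r}"
  let ?X = "\<lambda>b. {\<omega> \<in> space (model_space \<delta> p). predicted_label p L \<omega> \<noteq> b \<and> test_label \<omega> = b}"
  let ?T = "\<lambda>b. {\<omega> \<in> space (model_space \<delta> p). test_label \<omega> = b}"
  define H where "H = (\<lambda>b dv ys. \<Sum>S\<in>Pow {..<p}. ennreal (subset_weight e {..<p} S)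
          * pointwise_error \<delta> p L b (spike (real p powr - \<theta>) S) dv ys)"
  interpret M: prob_space M unfolding M_def by (rule prob_space_arw_model)
  \<comment> \<open>Strict because \<open>2 \<le> p\<close>; for \<open>p = 1\<close> every
    coordinate of the mean would be nonzero.\<close>
  have "e < real p powr 0" unfolding e_def using p by (intro powr_less_mono) auto
  then have e: "0 < e" "e < 1" using p by (auto simp: e_def)
  have k0: "0 \<le> ?k"
    using e t r unfolding error_bound_def
    by (intro add_nonneg_nonneg mult_nonneg_nonneg divide_nonneg_pos) (auto simp: min_def)
  have X: "emeasure M (?X b) = (\<integral>\<^sup>+dv. \<integral>\<^sup>+ys. H b dv ys / 2 \<partial>measure_pmf ?Y \<partial>measure_pmf ?P)" for b
    unfolding M_def H_def e_def by (rule emeasure_arw_error) (use L p in auto)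
  have "emeasure (measure_pmf ?P) (- ?bad) = (\<integral>\<^sup>+dv. \<integral>\<^sup>+ys. indicator (- ?bad) dv \<partial>measure_pmf ?Y \<partial>measure_pmf ?P)"
    by (simp add: measure_pmf.emeasure_space_1)
  also have "\<dots> \<le> (\<integral>\<^sup>+dv. \<integral>\<^sup>+ys. 2 * (H False dv ys / 2) + 2 * (H True dv ys / 2) + ennreal ?k \<partial>measure_pmf ?Y \<partial>measure_pmf ?P)"
  proof (intro nn_integral_mono)
    fix dv ys
    have half: "2 * (x / 2) = x" for x :: ennreal
    proof -
      have "2 * (x / 2) = x * (2 / 2)" unfolding divide_ennreal_def by (simp only: mult_ac)
      then show ?thesis by (simp add: ennreal_divide_self)
    qed
    show "indicator (- ?bad) dv \<le> 2 * (H False dv ys / 2) + 2 * (H True dv ys / 2) + ennreal ?k"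
    proof (cases "dv \<in> ?bad")
      case False
      then have "(frobenius_norm (Omega1 p (fst dv) (snd dv) - 1\<^sub>m p))\<^sup>2 \<le> r"
        by (auto simp: split_beta)
      from pointwise_error_sum_ge[OF L e t this r(2), of "real p powr - \<theta>" ys]
      show ?thesis unfolding H_def half using False by simp
    qed simp
  qed
  also have "\<dots> = 2 * emeasure M (?X False) + 2 * emeasure M (?X True) + ennreal ?k"
    unfolding X by (simp add: nn_integral_add nn_integral_cmult measure_pmf.emeasure_space_1)
  also have "\<dots> = ennreal (2 * measure M (?X False) + 2 * measure M (?X True) + ?k)"
    using k0 by (simp add: M.emeasure_eq_measure ennreal_mult ennreal_plus)
  finally have "ennreal (measure_pmf.prob ?P (- ?bad)) \<le> ennreal (2 * measure M (?X False) + 2 * measure M (?X True) + ?k)"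
    unfolding measure_pmf.emeasure_eq_measure .
  then have "measure_pmf.prob ?P (- ?bad) \<le> 2 * measure M (?X False) + 2 * measure M (?X True) + ?k"
    by (subst (asm) ennreal_le_iff) (use k0 in \<open>auto intro!: add_nonneg_nonneg\<close>)
  then have ge: "1 - measure_pmf.prob ?P ?bad - ?k \<le> 2 * (measure M (?X True) + measure M (?X False))"
    using measure_pmf.prob_compl[of ?bad ?P] by (simp add: Compl_eq_Diff_UNIV)
  have T: "measure M (?T b) = 1 / 2" for b
  proof -
    have "ennreal (measure M (?T b)) = 1 / 2"
      unfolding M.emeasure_eq_measure[symmetric] unfolding M_def by (rule emeasure_arw_test_label)
    also have "\<dots> = ennreal 1 / ennreal 2" by simp
    also have "\<dots> = ennreal (1 / 2)" by (rule divide_ennreal) auto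
    finally show ?thesis by (subst (asm) ennreal_inj) auto
  qed
  have "misclassification_rate \<alpha> \<beta> \<zeta> \<theta> \<delta> \<Delta>law p L
     = (measure M (?X True) / measure M (?T True) + measure M (?X False) / measure M (?T False)) / 2"
    unfolding misclassification_rate_def M_def[symmetric] Let_def cond_prob_def
    by (simp add: M_def space_arw_model)
  also have "\<dots> = measure M (?X True) + measure M (?X False)" unfolding T by simp
  finally show ?thesis using ge by (simp add: e_def)
qed

section \<open>Asymptotics\<close>

lemma powr_neg_tendsto_zero:
  "s < 0 \<Longrightarrow> (\<lambda>p. real p powr s) \<longlonglongrightarrow> 0"
  by (rule tendsto_neg_powr[OF _ filterlim_real_sequentially])

lemma train_size_le: "real (train_size \<delta> p) \<le> real p powr \<delta> + 1"
proof -
  have "0 \<le> real p powr \<delta>" by simp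
  then show ?thesis
    using of_int_round_le[of "real p powr \<delta>"] unfolding train_size_def by linarith
qed

text \<open>
  The minimum reflects the two reasons why the posterior probabilities are small: for
  \<open>\<zeta> > 1 - \<delta>\<close> even a known mean vector vanishes in norm, while otherwise \<open>n \<tau>\<^sup>2\<close> stays
  bounded and the training data leave the prior unchanged up to a constant factor.
\<close>

lemma error_term_tendsto_zero:
  assumes "\<delta> < 1" "0 < \<zeta>" "0 < \<theta>" and "\<theta> > rho \<delta> \<zeta>"
  defines "\<tau> \<equiv> \<lambda>p. real p powr - \<theta>" and "e \<equiv> \<lambda>p. real p powr - \<zeta>"
  shows "(\<lambda>p. (exp ((\<tau> p)\<^sup>2) - 1) *
      (real p * min (e p) ((e p)\<^sup>2 / (1 - e p) * exp (2 * real (train_size \<delta> p) * (\<tau> p)\<^sup>2)))) \<longlonglongrightarrow> 0"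
    (is "?A \<longlonglongrightarrow> 0")
proof -
  have tau2: "(\<tau> p)\<^sup>2 = real p powr (- 2 * \<theta>)" for p
    unfolding \<tau>_def by (simp add: power2_eq_square powr_add[symmetric])
  have e2: "(e p)\<^sup>2 = real p powr (- 2 * \<zeta>)" for p
    unfolding e_def by (simp add: power2_eq_square powr_add[symmetric])
  have e_small: "\<forall>\<^sub>F p in sequentially. e p < 1 / 2"
    unfolding e_def using powr_neg_tendsto_zero[of "- \<zeta>"] assms
    by (intro order_tendstoD(2)[where y = 0]) auto
  have tau_le: "(\<tau> p)\<^sup>2 \<le> 1" if "1 \<le> p" for p
    unfolding tau2 using that assms powr_mono[of "- 2 * \<theta>" 0 "real p"] by simp
  have c_le: "exp ((\<tau> p)\<^sup>2) - 1 \<le> 2 * (\<tau> p)\<^sup>2" if "1 \<le> p" for p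
  proof -
    have "exp ((\<tau> p)\<^sup>2) \<le> 1 + (\<tau> p)\<^sup>2 + ((\<tau> p)\<^sup>2)\<^sup>2"
      using tau_le[OF that] by (intro exp_bound) auto
    also have "((\<tau> p)\<^sup>2)\<^sup>2 \<le> (\<tau> p)\<^sup>2"
      using mult_left_mono[OF tau_le[OF that], of "(\<tau> p)\<^sup>2"] by (simp add: power2_eq_square)
    finally show ?thesis by simp
  qed
  have A_nonneg: "\<forall>\<^sub>F p in sequentially. 0 \<le> ?A p"
    using e_small by eventually_elim (auto simp: e_def min_def)
  have mult: "real p * (real p powr s1 * real p powr s2) = real p powr (1 + s1 + s2)" if "1 \<le> p" for p s1 s2
    using that by (simp add: powr_add)
  show ?thesis
  proof (cases "1 - \<delta> < \<zeta>")
    case True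
    then have "\<not> \<zeta> \<le> (1 - \<delta>) / 2" "\<not> \<zeta> \<le> 1 - \<delta>"
      using assms(1) by auto
    \<comment> \<open>The exponent of \<open>p \<tau>\<^sup>2 \<epsilon>\<close>; in this range the
      minimum is bounded by its first argument.\<close>
    then have neg: "1 + - 2 * \<theta> + - \<zeta> < 0" using assms(4) by (simp add: rho_def)
    have "\<forall>\<^sub>F p in sequentially. ?A p \<le> 2 * real p powr (1 + - 2 * \<theta> + - \<zeta>)"
      using eventually_ge_at_top[of 1] e_small
    proof eventually_elim
      case (elim p)
      have "?A p \<le> (2 * (\<tau> p)\<^sup>2) * (real p * e p)"
        using elim c_le[OF elim(1)] by (intro mult_mono mult_left_mono) (auto simp: e_def min_def)
      also have "\<dots> = 2 * real p powr (1 + - 2 * \<theta> + - \<zeta>)"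
        unfolding mult[OF elim(1), symmetric] tau2 by (simp add: e_def)
      finally show ?case .
    qed
    then show ?thesis
      by (rule tendsto_sandwich[OF A_nonneg _ tendsto_const
            tendsto_mult_right_zero[OF powr_neg_tendsto_zero[OF neg]]])
  next
    case False
    \<comment> \<open>Both inequalities hold on both remaining branches: \<open>rho\<close> is there
      the larger of \<open>1/2 - \<zeta>\<close> and \<open>\<delta> / 2\<close>, which agree at
      \<open>\<zeta> = (1 - \<delta>) / 2\<close>.\<close>
    have *: "1 / 2 - \<zeta> < \<theta>" "\<delta> / 2 < \<theta>"
      using False assms(4) by (auto simp: rho_def split: if_splits)
    then have neg: "1 + - 2 * \<theta> + - 2 * \<zeta> < 0" by simp
    have "\<forall>\<^sub>F p in sequentially. ?A p \<le> 4 * exp 4 * real p powr (1 + - 2 * \<theta> + - 2 * \<zeta>)"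
      using eventually_ge_at_top[of 1] e_small
    proof eventually_elim
      case (elim p)
      \<comment> \<open>The extra 1 pays for rounding the sample size. In all
        \<open>n \<tau>\<^sup>2 \<le> 2\<close>, which gives the constant
        \<open>exp 4\<close>.\<close>
      have "real (train_size \<delta> p) * (\<tau> p)\<^sup>2 \<le> (real p powr \<delta> + 1) * (\<tau> p)\<^sup>2"
        by (intro mult_right_mono train_size_le) auto
      also have "\<dots> = real p powr (\<delta> - 2 * \<theta>) + (\<tau> p)\<^sup>2"
        unfolding tau2 distrib_right by (simp add: powr_add[symmetric])
      also have "\<dots> \<le> 1 + 1"
        using tau_le[OF elim(1)] powr_mono[of "\<delta> - 2 * \<theta>" 0 "real p"] elim * by (intro add_mono) auto
      finally have "exp (2 * real (train_size \<delta> p) * (\<tau> p)\<^sup>2) \<le> exp 4" by simp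
      moreover have "(e p)\<^sup>2 / (1 - e p) \<le> (e p)\<^sup>2 / (1 / 2)"
        using elim by (intro divide_left_mono) auto
      ultimately have "(e p)\<^sup>2 / (1 - e p) * exp (2 * real (train_size \<delta> p) * (\<tau> p)\<^sup>2) \<le> (e p)\<^sup>2 / (1 / 2) * exp 4"
        using elim by (intro mult_mono) auto
      then have "?A p \<le> (2 * (\<tau> p)\<^sup>2) * (real p * ((e p)\<^sup>2 / (1 / 2) * exp 4))"
        using elim c_le[OF elim(1)] by (intro mult_mono mult_left_mono) (auto simp: e_def min_def)
      also have "\<dots> = 4 * exp 4 * real p powr (1 + - 2 * \<theta> + - 2 * \<zeta>)"
        unfolding mult[OF elim(1), symmetric] tau2 e2 by simp
      finally show ?case .
    qed
    then show ?thesis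
      by (rule tendsto_sandwich[OF A_nonneg _ tendsto_const
            tendsto_mult_right_zero[OF powr_neg_tendsto_zero[OF neg]]])
  qed
qed

theorem theorem1p1:
  fixes \<alpha> \<beta> \<gamma> \<zeta> \<theta> \<delta> :: real
    and \<Delta>law :: "nat \<Rightarrow> real pmf"
    and L :: "nat \<Rightarrow> observation \<Rightarrow> bool"
  assumes "0 < \<delta>" "\<delta> < 1"
    and "0 < \<zeta>" "\<zeta> < 1"
    and "0 < \<theta>" "\<theta> < 1"
    and "0 < \<alpha>" "\<alpha> < 1"
    and "0 < \<gamma>" "\<gamma> < 1"
    and "0 < \<beta>" "\<beta> < 2"
    and "\<beta> > 1 - 2 * \<alpha>"
    and "\<forall>p. \<forall>d \<in> set_pmf (\<Delta>law p). \<bar>d\<bar> = real p powr - \<gamma>"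
    and "\<forall>e > 0. (\<lambda>p. measure_pmf.prob (perturbation_pmf \<alpha> \<beta> \<Delta>law p)
           {(\<Delta>, V). (frobenius_norm (Omega1 p \<Delta> V - 1\<^sub>m p))\<^sup>2 > e}) \<longlonglongrightarrow> 0"
    and "\<theta> > rho \<delta> \<zeta>"
    and "\<forall>p. is_classifier \<delta> p (L p)"
  shows "liminf (\<lambda>p. ereal (misclassification_rate \<alpha> \<beta> \<zeta> \<theta> \<delta> \<Delta>law p (L p))) \<ge> 1/2"
  unfolding le_Liminf_iff
proof (intro allI impI)
  fix y :: ereal assume "y < 1 / 2"
  also have "(1 / 2 :: ereal) = ereal (1 / 2)"
    by (simp only: one_ereal_def numeral_eq_ereal ereal_divide) simp
  finally obtain z where z: "y < ereal z" "z < 1 / 2"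
    using ereal_dense2 by (metis ereal_less_eq(3) less_ereal.simps(1))
  \<comment> \<open>With \<open>r = t\<^sup>2\<close> the errors that do not vanish add up to
    \<open>4 * t\<close>: twice \<open>t\<close> from the two losses, and
    \<open>t + t\<^sup>2 / t\<close> from the precision matrix. The limit \<open>1/2 - 2 * t\<close>
    then exceeds \<open>z\<close>, while \<open>t \<le> 1/8\<close> ensures
    \<open>r \<le> 1/64\<close>.\<close>
  define t where "t = min (1 / 8) ((1 / 2 - z) / 4)"
  have "t \<le> (1 / 2 - z) / 4" unfolding t_def by (rule min.cobounded2)
  then have t: "0 < t" "t \<le> 1 / 8" "4 * t \<le> 1 / 2 - z" using z by (auto simp: t_def)
  have "t\<^sup>2 \<le> (1 / 8)\<^sup>2" using t by (intro power_mono) auto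
  then have r: "0 < t\<^sup>2" "0 \<le> t\<^sup>2" "t\<^sup>2 \<le> 1 / 64" using t by (auto simp: power_divide)
  let ?bad = "\<lambda>p. measure_pmf.prob (perturbation_pmf \<alpha> \<beta> \<Delta>law p)
           {(\<Delta>, V). (frobenius_norm (Omega1 p \<Delta> V - 1\<^sub>m p))\<^sup>2 > t\<^sup>2}"
  let ?A = "\<lambda>p. (exp ((real p powr - \<theta>)\<^sup>2) - 1) * (real p * min (real p powr - \<zeta>)
     ((real p powr - \<zeta>)\<^sup>2 / (1 - real p powr - \<zeta>) * exp (2 * real (train_size \<delta> p) * (real p powr - \<theta>)\<^sup>2)))"
  have "(\<lambda>p. (1 - ?bad p - (4 * t + 2 / t * ?A p)) / 2) \<longlonglongrightarrow> (1 - 0 - (4 * t + 2 / t * 0)) / 2"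
    using assms r by (intro tendsto_intros error_term_tendsto_zero) auto
  moreover have "z < (1 - 0 - (4 * t + 2 / t * 0)) / 2" using t by simp
  ultimately have "\<forall>\<^sub>F p in sequentially. z < (1 - ?bad p - (4 * t + 2 / t * ?A p)) / 2"
    by (rule order_tendstoD(1))
  then show "\<forall>\<^sub>F p in sequentially. y < ereal (misclassification_rate \<alpha> \<beta> \<zeta> \<theta> \<delta> \<Delta>law p (L p))"
    using eventually_ge_at_top[of 2]
  proof eventually_elim
    case (elim p)
    have "error_bound p (train_size \<delta> p) (real p powr - \<zeta>) (real p powr - \<theta>) t (t\<^sup>2) = 4 * t + 2 / t * ?A p"
      using t by (simp add: error_bound_def power2_eq_square)
    then have "z < misclassification_rate \<alpha> \<beta> \<zeta> \<theta> \<delta> \<Delta>law p (L p)"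
      using elim misclassification_rate_ge[of \<delta> p "L p" \<zeta> t "t\<^sup>2" \<alpha> \<beta> \<Delta>law \<theta>] assms t r by auto
    then show ?case using z by (metis ereal_less(2) less_ereal.simps(1) order.strict_trans)
  qed
qed

end
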